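(* Let $R$ be an associative ring with unit. Let $\langle\text{Qs-ch}\rangle$ be the full subcategory of the category of $\mathcal R$-modules whose objects are the $\mathcal R$-modules that preserve direct limits. Then $\langle\text{Qs-ch}\rangle$ is the smallest full subcategory of the category of $\mathcal R$-modules stable by kernels, cokernels, direct limits and isomorphisms (if an $\mathcal R$-module is isomorphic to an object of the subcategory then it belongs to the subcategory) that contains the $\mathcal R$-module $\mathcal R$ (or quasi-coherent modules: that is, the same holds with "contains the $\mathcal R$-module $\mathcal R$" replaced by "contains the quasi-coherent $\mathcal R$-modules").
   Context: "$R$-module" means left $R$-module. An $\mathcal R$-module is a covariant additive functor from the category of left $R$-modules to the category of abelian groups; morphisms of $\mathcal R$-modules are natural transformations. Kernels, cokernels and direct limits (over upward directed sets) of $\mathcal R$-modules are taken in the category of $\mathcal R$-modules and are computed objectwise. An $\mathcal R$-module $\mathbb M$ preserves direct limits if the natural map $\varinjlim_i\mathbb M(S_i)\to\mathbb M(\varinjlim_i S_i)$ is an isomorphism for every direct system of $R$-modules $\{S_i\}_{i\in I}$, with $I$ an upward directed set. For a right $R$-module $M$, the quasi-coherent $\mathcal R$-module associated with $M$ is the $\mathcal R$-module $\mathcal M$ defined by $\mathcal M(S)=M\otimes_R S$; in particular, $\mathcal R$ is the quasi-coherent $\mathcal R$-module associated with $R$, $\mathcal R(S)=R\otimes_R S=S$.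
   Formalization: In the version "contains R" the subcategories are also required to be stable by finite direct sums (over a field, the functors isomorphic to 0 or R refute it otherwise); modules, abelian groups and index sets lie in an arbitrary infinite universe at least as large as R. *)

theory Defs
  imports "HOL-Algebra.Algebra" "HOL-Library.Equipollence"
begin

text \<open>
  The type variable \<open>'u\<close> is the universe: modules, abelian groups and index sets of direct systems
  have their elements in \<open>'u\<close>. Constructions whose elements naturally live in another type
  (quotients, direct limits, tensor products, direct sums) are carried out there, and "is an object
  of the category" is then read up to isomorphism. If \<open>'u\<close> is infinite and at least as large as
  \<open>R\<close>, all the constructions below have isomorphic copies in \<open>'u\<close>.
\<close>


section \<open>Modules over a ring that need not be commutative\<close>

text \<open>
  The record \<open>module\<close> is that of the library; its multiplication and unit are not used. The
  locale \<open>module\<close> of the library assumes a commutative ring of scalars.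
\<close>

definition left_module :: "('r, 'k) ring_scheme \<Rightarrow> ('r, 'a) module \<Rightarrow> bool" where
  "left_module R M \<longleftrightarrow> ring R \<and> abelian_group M \<and>
     (\<forall>a\<in>carrier R. \<forall>x\<in>carrier M. a \<odot>\<^bsub>M\<^esub> x \<in> carrier M) \<and>
     (\<forall>a\<in>carrier R. \<forall>b\<in>carrier R. \<forall>x\<in>carrier M.
        (a \<oplus>\<^bsub>R\<^esub> b) \<odot>\<^bsub>M\<^esub> x = a \<odot>\<^bsub>M\<^esub> x \<oplus>\<^bsub>M\<^esub> b \<odot>\<^bsub>M\<^esub> x) \<and>
     (\<forall>a\<in>carrier R. \<forall>x\<in>carrier M. \<forall>y\<in>carrier M.
        a \<odot>\<^bsub>M\<^esub> (x \<oplus>\<^bsub>M\<^esub> y) = a \<odot>\<^bsub>M\<^esub> x \<oplus>\<^bsub>M\<^esub> a \<odot>\<^bsub>M\<^esub> y) \<and>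
     (\<forall>a\<in>carrier R. \<forall>b\<in>carrier R. \<forall>x\<in>carrier M.
        (a \<otimes>\<^bsub>R\<^esub> b) \<odot>\<^bsub>M\<^esub> x = a \<odot>\<^bsub>M\<^esub> (b \<odot>\<^bsub>M\<^esub> x)) \<and>
     (\<forall>x\<in>carrier M. \<one>\<^bsub>R\<^esub> \<odot>\<^bsub>M\<^esub> x = x)"

text \<open>For a right module, \<open>a \<odot>\<^bsub>M\<^esub> x\<close> stands for \<open>x \<cdot> a\<close>.\<close>

definition right_module :: "('r, 'k) ring_scheme \<Rightarrow> ('r, 'a) module \<Rightarrow> bool" where
  "right_module R M \<longleftrightarrow> ring R \<and> abelian_group M \<and>
     (\<forall>a\<in>carrier R. \<forall>x\<in>carrier M. a \<odot>\<^bsub>M\<^esub> x \<in> carrier M) \<and>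
     (\<forall>a\<in>carrier R. \<forall>b\<in>carrier R. \<forall>x\<in>carrier M.
        (a \<oplus>\<^bsub>R\<^esub> b) \<odot>\<^bsub>M\<^esub> x = a \<odot>\<^bsub>M\<^esub> x \<oplus>\<^bsub>M\<^esub> b \<odot>\<^bsub>M\<^esub> x) \<and>
     (\<forall>a\<in>carrier R. \<forall>x\<in>carrier M. \<forall>y\<in>carrier M.
        a \<odot>\<^bsub>M\<^esub> (x \<oplus>\<^bsub>M\<^esub> y) = a \<odot>\<^bsub>M\<^esub> x \<oplus>\<^bsub>M\<^esub> a \<odot>\<^bsub>M\<^esub> y) \<and>
     (\<forall>a\<in>carrier R. \<forall>b\<in>carrier R. \<forall>x\<in>carrier M.
        (a \<otimes>\<^bsub>R\<^esub> b) \<odot>\<^bsub>M\<^esub> x = b \<odot>\<^bsub>M\<^esub> (a \<odot>\<^bsub>M\<^esub> x)) \<and>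
     (\<forall>x\<in>carrier M. \<one>\<^bsub>R\<^esub> \<odot>\<^bsub>M\<^esub> x = x)"

text \<open>
  Linear maps are extensional (\<open>undefined\<close> outside the carrier), so that equality of morphisms is
  equality of functions.
\<close>

definition linear_maps ::
  "('r, 'k) ring_scheme \<Rightarrow> ('r, 'a) module \<Rightarrow> ('r, 'a) module \<Rightarrow> ('a \<Rightarrow> 'a) set" where
  "linear_maps R S T = {f \<in> carrier S \<rightarrow>\<^sub>E carrier T.
     (\<forall>x\<in>carrier S. \<forall>y\<in>carrier S. f (x \<oplus>\<^bsub>S\<^esub> y) = f x \<oplus>\<^bsub>T\<^esub> f y) \<and>
     (\<forall>a\<in>carrier R. \<forall>x\<in>carrier S. f (a \<odot>\<^bsub>S\<^esub> x) = a \<odot>\<^bsub>T\<^esub> f x)}"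

definition linear_id :: "('r, 'a) module \<Rightarrow> 'a \<Rightarrow> 'a" where
  "linear_id S = restrict (\<lambda>x. x) (carrier S)"

definition linear_add ::
  "('r, 'a) module \<Rightarrow> ('r, 'a) module \<Rightarrow> ('a \<Rightarrow> 'a) \<Rightarrow> ('a \<Rightarrow> 'a) \<Rightarrow> 'a \<Rightarrow> 'a" where
  "linear_add S T f g = restrict (\<lambda>x. f x \<oplus>\<^bsub>T\<^esub> g x) (carrier S)"

definition additive_group :: "('r, 'a) module \<Rightarrow> 'a monoid" where
  "additive_group S = \<lparr>carrier = carrier S, monoid.mult = (\<oplus>\<^bsub>S\<^esub>), one = \<zero>\<^bsub>S\<^esub>\<rparr>"


section \<open>Additive functors from left modules to abelian groups\<close>

text \<open>
  \<open>farr F S T f\<close> is the value of \<open>F\<close> at the morphism \<open>f : S \<rightarrow> T\<close>. Abelian groups are written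
  multiplicatively, as objects of the library locale \<open>comm_group\<close>. The type \<open>'b\<close> of the values is
  \<open>'u\<close> for the objects of the category of functors, and another type in some constructions.
\<close>

record ('r, 'u, 'b) functr =
  fobj :: "('r, 'u) module \<Rightarrow> 'b monoid"
  farr :: "('r, 'u) module \<Rightarrow> ('r, 'u) module \<Rightarrow> ('u \<Rightarrow> 'u) \<Rightarrow> 'b \<Rightarrow> 'b"

definition functor_module :: "('r, 'k) ring_scheme \<Rightarrow> ('r, 'u, 'b) functr \<Rightarrow> bool" where
  "functor_module R F \<longleftrightarrow>
     (\<forall>S. left_module R S \<longrightarrow> comm_group (fobj F S)) \<and>
     (\<forall>S T f. left_module R S \<longrightarrow> left_module R T \<longrightarrow> f \<in> linear_maps R S T \<longrightarrow>
        farr F S T f \<in> hom (fobj F S) (fobj F T)) \<and>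
     (\<forall>S. left_module R S \<longrightarrow> (\<forall>x\<in>carrier (fobj F S). farr F S S (linear_id S) x = x)) \<and>
     (\<forall>S T U f g. left_module R S \<longrightarrow> left_module R T \<longrightarrow> left_module R U \<longrightarrow>
        f \<in> linear_maps R S T \<longrightarrow> g \<in> linear_maps R T U \<longrightarrow>
        (\<forall>x\<in>carrier (fobj F S).
           farr F S U (compose (carrier S) g f) x = farr F T U g (farr F S T f x))) \<and>
     (\<forall>S T f g. left_module R S \<longrightarrow> left_module R T \<longrightarrow>
        f \<in> linear_maps R S T \<longrightarrow> g \<in> linear_maps R S T \<longrightarrow>
        (\<forall>x\<in>carrier (fobj F S).
           farr F S T (linear_add S T f g) x = farr F S T f x \<otimes>\<^bsub>fobj F T\<^esub> farr F S T g x))"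

definition nat_trans ::
  "('r, 'k) ring_scheme \<Rightarrow> ('r, 'u, 'b) functr \<Rightarrow> ('r, 'u, 'c) functr \<Rightarrow>
   (('r, 'u) module \<Rightarrow> 'b \<Rightarrow> 'c) \<Rightarrow> bool" where
  "nat_trans R F G \<eta> \<longleftrightarrow>
     (\<forall>S. left_module R S \<longrightarrow> \<eta> S \<in> hom (fobj F S) (fobj G S)) \<and>
     (\<forall>S T f. left_module R S \<longrightarrow> left_module R T \<longrightarrow> f \<in> linear_maps R S T \<longrightarrow>
        (\<forall>x\<in>carrier (fobj F S). \<eta> T (farr F S T f x) = farr G S T f (\<eta> S x)))"

definition functor_iso ::
  "('r, 'k) ring_scheme \<Rightarrow> ('r, 'u, 'b) functr \<Rightarrow> ('r, 'u, 'c) functr \<Rightarrow> bool" where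
  "functor_iso R F G \<longleftrightarrow>
     (\<exists>\<eta>. nat_trans R F G \<eta> \<and> (\<forall>S. left_module R S \<longrightarrow> \<eta> S \<in> iso (fobj F S) (fobj G S)))"


section \<open>Objectwise kernels, cokernels and finite direct sums\<close>

definition kernel_functor ::
  "('r, 'u, 'b) functr \<Rightarrow> ('r, 'u, 'c) functr \<Rightarrow> (('r, 'u) module \<Rightarrow> 'b \<Rightarrow> 'c) \<Rightarrow>
   ('r, 'u, 'b) functr" where
  "kernel_functor F G \<eta> =
     \<lparr>fobj = (\<lambda>S. (fobj F S)\<lparr>carrier := kernel (fobj F S) (fobj G S) (\<eta> S)\<rparr>),
      farr = farr F\<rparr>"

text \<open>
  If \<open>h : G' \<rightarrow> G\<close> is a homomorphism with \<open>h ` N' \<subseteq> N\<close>, then \<open>quotient_map G N h\<close> is the induced map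
  \<open>G' / N' \<rightarrow> G / N\<close>, as it sends the coset \<open>N' x\<close> to \<open>N \<cdot> h (N' x) = N h(x)\<close>.
\<close>

definition quotient_map :: "'b monoid \<Rightarrow> 'b set \<Rightarrow> ('a \<Rightarrow> 'b) \<Rightarrow> 'a set \<Rightarrow> 'b set" where
  "quotient_map G N h K = N <#>\<^bsub>G\<^esub> (h ` K)"

definition cokernel_functor ::
  "('r, 'u, 'b) functr \<Rightarrow> ('r, 'u, 'c) functr \<Rightarrow> (('r, 'u) module \<Rightarrow> 'b \<Rightarrow> 'c) \<Rightarrow>
   ('r, 'u, 'c set) functr" where
  "cokernel_functor F G \<eta> =
     \<lparr>fobj = (\<lambda>S. fobj G S Mod (\<eta> S ` carrier (fobj F S))),
      farr = (\<lambda>S T f. quotient_map (fobj G T) (\<eta> T ` carrier (fobj F T)) (farr G S T f))\<rparr>"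

definition direct_sum_functor ::
  "('r, 'u, 'b) functr \<Rightarrow> ('r, 'u, 'c) functr \<Rightarrow> ('r, 'u, 'b \<times> 'c) functr" where
  "direct_sum_functor F G =
     \<lparr>fobj = (\<lambda>S. fobj F S \<times>\<times> fobj G S),
      farr = (\<lambda>S T f. map_prod (farr F S T f) (farr G S T f))\<rparr>"


section \<open>Direct limits\<close>

definition directed_set :: "'i set \<Rightarrow> 'i rel \<Rightarrow> bool" where
  "directed_set I r \<longleftrightarrow> I \<noteq> {} \<and> preorder_on I r \<and>
     (\<forall>i\<in>I. \<forall>j\<in>I. \<exists>k\<in>I. (i, k) \<in> r \<and> (j, k) \<in> r)"

text \<open>
  The direct limit of a system of groups \<open>A i\<close> with transition maps \<open>\<phi> i j\<close>, for \<open>(i, j) \<in> r\<close>, is the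
  quotient of the disjoint union of the \<open>A i\<close> by the relation of becoming equal at a later stage.
\<close>

definition lim_rel ::
  "'i set \<Rightarrow> 'i rel \<Rightarrow> ('i \<Rightarrow> 'a monoid) \<Rightarrow> ('i \<Rightarrow> 'i \<Rightarrow> 'a \<Rightarrow> 'a) \<Rightarrow> ('i \<times> 'a) rel" where
  "lim_rel I r A \<phi> = {((i, x), (j, y)). i \<in> I \<and> x \<in> carrier (A i) \<and> j \<in> I \<and> y \<in> carrier (A j) \<and>
     (\<exists>k\<in>I. (i, k) \<in> r \<and> (j, k) \<in> r \<and> \<phi> i k x = \<phi> j k y)}"

definition lim_group ::
  "'i set \<Rightarrow> 'i rel \<Rightarrow> ('i \<Rightarrow> 'a monoid) \<Rightarrow> ('i \<Rightarrow> 'i \<Rightarrow> 'a \<Rightarrow> 'a) \<Rightarrow> ('i \<times> 'a) set monoid" where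
  "lim_group I r A \<phi> =
     \<lparr>carrier = (SIGMA i:I. carrier (A i)) // lim_rel I r A \<phi>,
      monoid.mult = (\<lambda>K L. lim_rel I r A \<phi> ``
        {(k, \<phi> i k x \<otimes>\<^bsub>A k\<^esub> \<phi> j k y) | i x j y k.
           (i, x) \<in> K \<and> (j, y) \<in> L \<and> (i, k) \<in> r \<and> (j, k) \<in> r}),
      one = lim_rel I r A \<phi> `` {(i, \<one>\<^bsub>A i\<^esub>) | i. i \<in> I}\<rparr>"

text \<open>
  The natural map from the direct limit induced by a compatible family \<open>c i\<close>: it sends the class of
  \<open>(i, x)\<close> to \<open>c i x\<close>.
\<close>

definition lim_map :: "('i \<Rightarrow> 'a \<Rightarrow> 'b) \<Rightarrow> ('i \<times> 'a) set \<Rightarrow> 'b" where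
  "lim_map c K = the_elem ((\<lambda>(i, x). c i x) ` K)"

definition module_system ::
  "('r, 'k) ring_scheme \<Rightarrow> 'i set \<Rightarrow> 'i rel \<Rightarrow> ('i \<Rightarrow> ('r, 'u) module) \<Rightarrow>
   ('i \<Rightarrow> 'i \<Rightarrow> 'u \<Rightarrow> 'u) \<Rightarrow> bool" where
  "module_system R I r S s \<longleftrightarrow>
     (\<forall>i\<in>I. left_module R (S i)) \<and>
     (\<forall>i j. (i, j) \<in> r \<longrightarrow> s i j \<in> linear_maps R (S i) (S j)) \<and>
     (\<forall>i\<in>I. s i i = linear_id (S i)) \<and>
     (\<forall>i j k. (i, j) \<in> r \<longrightarrow> (j, k) \<in> r \<longrightarrow> s i k = compose (carrier (S i)) (s j k) (s i j))"

text \<open>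
  The direct limit of modules is computed on the underlying additive groups, so a compatible family
  of linear maps \<open>c i : S i \<rightarrow> L\<close> exhibits the module \<open>L\<close> as the direct limit if and only if the
  natural map is an isomorphism of groups.
\<close>

definition module_limit ::
  "('r, 'k) ring_scheme \<Rightarrow> 'i set \<Rightarrow> 'i rel \<Rightarrow> ('i \<Rightarrow> ('r, 'u) module) \<Rightarrow>
   ('i \<Rightarrow> 'i \<Rightarrow> 'u \<Rightarrow> 'u) \<Rightarrow> ('r, 'u) module \<Rightarrow> ('i \<Rightarrow> 'u \<Rightarrow> 'u) \<Rightarrow> bool" where
  "module_limit R I r S s L c \<longleftrightarrow>
     left_module R L \<and>
     (\<forall>i\<in>I. c i \<in> linear_maps R (S i) L) \<and>
     (\<forall>i j. (i, j) \<in> r \<longrightarrow> c i = compose (carrier (S i)) (c j) (s i j)) \<and>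
     lim_map c \<in> iso (lim_group I r (\<lambda>i. additive_group (S i)) s) (additive_group L)"

definition preserves_direct_limits ::
  "('r, 'k) ring_scheme \<Rightarrow> ('r, 'u, 'b) functr \<Rightarrow> bool" where
  "preserves_direct_limits R F \<longleftrightarrow>
     (\<forall>(I :: 'u set) r S s L c.
        directed_set I r \<longrightarrow> module_system R I r S s \<longrightarrow> module_limit R I r S s L c \<longrightarrow>
        lim_map (\<lambda>i. farr F (S i) L (c i))
          \<in> iso (lim_group I r (\<lambda>i. fobj F (S i)) (\<lambda>i j. farr F (S i) (S j) (s i j))) (fobj F L))"

definition functor_system ::
  "('r, 'k) ring_scheme \<Rightarrow> 'i set \<Rightarrow> 'i rel \<Rightarrow> ('i \<Rightarrow> ('r, 'u, 'b) functr) \<Rightarrow>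
   ('i \<Rightarrow> 'i \<Rightarrow> ('r, 'u) module \<Rightarrow> 'b \<Rightarrow> 'b) \<Rightarrow> bool" where
  "functor_system R I r F \<tau> \<longleftrightarrow>
     (\<forall>i\<in>I. functor_module R (F i)) \<and>
     (\<forall>i j. (i, j) \<in> r \<longrightarrow> nat_trans R (F i) (F j) (\<tau> i j)) \<and>
     (\<forall>i\<in>I. \<forall>S. left_module R S \<longrightarrow> (\<forall>x\<in>carrier (fobj (F i) S). \<tau> i i S x = x)) \<and>
     (\<forall>i j k. (i, j) \<in> r \<longrightarrow> (j, k) \<in> r \<longrightarrow>
        (\<forall>S. left_module R S \<longrightarrow> (\<forall>x\<in>carrier (fobj (F i) S). \<tau> i k S x = \<tau> j k S (\<tau> i j S x))))"

definition limit_functor ::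
  "'i set \<Rightarrow> 'i rel \<Rightarrow> ('i \<Rightarrow> ('r, 'u, 'b) functr) \<Rightarrow>
   ('i \<Rightarrow> 'i \<Rightarrow> ('r, 'u) module \<Rightarrow> 'b \<Rightarrow> 'b) \<Rightarrow> ('r, 'u, ('i \<times> 'b) set) functr" where
  "limit_functor I r F \<tau> =
     \<lparr>fobj = (\<lambda>S. lim_group I r (\<lambda>i. fobj (F i) S) (\<lambda>i j. \<tau> i j S)),
      farr = (\<lambda>S T f K. lim_rel I r (\<lambda>i. fobj (F i) T) (\<lambda>i j. \<tau> i j T) ``
        ((\<lambda>(i, x). (i, farr (F i) S T f x)) ` K))\<rparr>"


section \<open>Quasi-coherent modules\<close>

definition tensor_relations ::
  "('r, 'k) ring_scheme \<Rightarrow> ('r, 'a) module \<Rightarrow> ('r, 'b) module \<Rightarrow> ('a \<times> 'b \<Rightarrow>\<^sub>0 int) set" where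
  "tensor_relations R M S =
     {frag_of (m \<oplus>\<^bsub>M\<^esub> m', s) - frag_of (m, s) - frag_of (m', s) | m m' s.
        m \<in> carrier M \<and> m' \<in> carrier M \<and> s \<in> carrier S} \<union>
     {frag_of (m, s \<oplus>\<^bsub>S\<^esub> s') - frag_of (m, s) - frag_of (m, s') | m s s'.
        m \<in> carrier M \<and> s \<in> carrier S \<and> s' \<in> carrier S} \<union>
     {frag_of (a \<odot>\<^bsub>M\<^esub> m, s) - frag_of (m, a \<odot>\<^bsub>S\<^esub> s) | a m s.
        a \<in> carrier R \<and> m \<in> carrier M \<and> s \<in> carrier S}"

definition tensor_subgroup ::
  "('r, 'k) ring_scheme \<Rightarrow> ('r, 'a) module \<Rightarrow> ('r, 'b) module \<Rightarrow> ('a \<times> 'b \<Rightarrow>\<^sub>0 int) set" where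
  "tensor_subgroup R M S =
     generate (free_Abelian_group (carrier M \<times> carrier S)) (tensor_relations R M S)"

text \<open>The functor \<open>S \<mapsto> M \<otimes>\<^sub>R S\<close>, for a right module \<open>M\<close>.\<close>

definition quasi_coherent ::
  "('r, 'k) ring_scheme \<Rightarrow> ('r, 'a) module \<Rightarrow> ('r, 'u, ('a \<times> 'u \<Rightarrow>\<^sub>0 int) set) functr" where
  "quasi_coherent R M =
     \<lparr>fobj = (\<lambda>S. free_Abelian_group (carrier M \<times> carrier S) Mod tensor_subgroup R M S),
      farr = (\<lambda>S T f. quotient_map (free_Abelian_group (carrier M \<times> carrier T))
        (tensor_subgroup R M T) (frag_extend (\<lambda>(m, s). frag_of (m, f s))))\<rparr>"

text \<open>The functor \<open>S \<mapsto> S\<close>, identified with \<open>S \<mapsto> R \<otimes>\<^sub>R S\<close>.\<close>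

definition ring_functor :: "('r, 'u, 'u) functr" where
  "ring_functor = \<lparr>fobj = additive_group, farr = (\<lambda>S T f. f)\<rparr>"


section \<open>Full subcategories\<close>

text \<open>
  Containing \<open>R\<close> alone does not produce finite direct sums: if \<open>R\<close> is a field, the functors
  isomorphic to \<open>0\<close> or to \<open>S \<mapsto> S\<close> are stable by kernels, cokernels, direct limits over directed
  sets and isomorphisms, and \<open>S \<mapsto> S \<oplus> S\<close> is not among them. A subcategory generated by \<open>R\<close> is
  therefore understood to be an additive one, that is, stable by finite direct sums
  (\<open>stable_finite_sums\<close>). This is not required of subcategories that contain all
  quasi-coherent modules.
\<close>

text \<open>A full subcategory is given by its class \<open>\<D>\<close> of objects.\<close>

definition full_subcategory :: "('r, 'k) ring_scheme \<Rightarrow> ('r, 'u, 'u) functr set \<Rightarrow> bool" where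
  "full_subcategory R \<D> \<longleftrightarrow> (\<forall>F\<in>\<D>. functor_module R F)"

definition contains_copies ::
  "('r, 'k) ring_scheme \<Rightarrow> ('r, 'u, 'u) functr set \<Rightarrow> ('r, 'u, 'b) functr \<Rightarrow> bool" where
  "contains_copies R \<D> K \<longleftrightarrow> (\<forall>F. functor_module R F \<longrightarrow> functor_iso R F K \<longrightarrow> F \<in> \<D>)"

definition stable_isos :: "('r, 'k) ring_scheme \<Rightarrow> ('r, 'u, 'u) functr set \<Rightarrow> bool" where
  "stable_isos R \<D> \<longleftrightarrow> (\<forall>F\<in>\<D>. contains_copies R \<D> F)"

definition stable_kernels :: "('r, 'k) ring_scheme \<Rightarrow> ('r, 'u, 'u) functr set \<Rightarrow> bool" where
  "stable_kernels R \<D> \<longleftrightarrow>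
     (\<forall>F\<in>\<D>. \<forall>G\<in>\<D>. \<forall>\<eta>. nat_trans R F G \<eta> \<longrightarrow> contains_copies R \<D> (kernel_functor F G \<eta>))"

definition stable_cokernels :: "('r, 'k) ring_scheme \<Rightarrow> ('r, 'u, 'u) functr set \<Rightarrow> bool" where
  "stable_cokernels R \<D> \<longleftrightarrow>
     (\<forall>F\<in>\<D>. \<forall>G\<in>\<D>. \<forall>\<eta>. nat_trans R F G \<eta> \<longrightarrow> contains_copies R \<D> (cokernel_functor F G \<eta>))"

definition stable_direct_limits :: "('r, 'k) ring_scheme \<Rightarrow> ('r, 'u, 'u) functr set \<Rightarrow> bool" where
  "stable_direct_limits R \<D> \<longleftrightarrow>
     (\<forall>(I :: 'u set) r F \<tau>. directed_set I r \<longrightarrow> functor_system R I r F \<tau> \<longrightarrow>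
        (\<forall>i\<in>I. F i \<in> \<D>) \<longrightarrow> contains_copies R \<D> (limit_functor I r F \<tau>))"

definition stable_finite_sums :: "('r, 'k) ring_scheme \<Rightarrow> ('r, 'u, 'u) functr set \<Rightarrow> bool" where
  "stable_finite_sums R \<D> \<longleftrightarrow>
     (\<forall>F\<in>\<D>. \<forall>G\<in>\<D>. contains_copies R \<D> (direct_sum_functor F G))"

definition stable_subcategory :: "('r, 'k) ring_scheme \<Rightarrow> ('r, 'u, 'u) functr set \<Rightarrow> bool" where
  "stable_subcategory R \<D> \<longleftrightarrow> full_subcategory R \<D> \<and> stable_kernels R \<D> \<and>
     stable_cokernels R \<D> \<and> stable_direct_limits R \<D> \<and> stable_isos R \<D>"

definition contains_quasi_coherents ::
  "('r, 'k) ring_scheme \<Rightarrow> ('r, 'u, 'u) functr set \<Rightarrow> bool" where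
  "contains_quasi_coherents R \<D> \<longleftrightarrow>
     (\<forall>M :: ('r, 'u) module. right_module R M \<longrightarrow> contains_copies R \<D> (quasi_coherent R M))"

definition smallest_such :: "('a set \<Rightarrow> bool) \<Rightarrow> 'a set \<Rightarrow> bool" where
  "smallest_such P \<C> \<longleftrightarrow> P \<C> \<and> (\<forall>\<D>. P \<D> \<longrightarrow> \<C> \<subseteq> \<D>)"

definition Qs_ch :: "('r, 'k) ring_scheme \<Rightarrow> ('r, 'u, 'u) functr set" where
  "Qs_ch R = {F. functor_module R F \<and> preserves_direct_limits R F}"

end

theory Submission
  imports Defs
begin

text \<open>
  Direct limits of abelian groups are exact, and they commute with one another and with tensor
  products. Hence the functors that preserve direct limits are stable under all the operations in
  question, and the functors \<open>S \<mapsto> M \<otimes> S\<close> are among them. Since a direct limit is described by its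
  elements -- each of them comes from some stage, and an element of a stage that vanishes in the limit
  vanishes at a later stage (\<open>lim_map_iso_iff\<close>) -- these facts are diagram chases: \<open>preserved_kernel\<close>,
  \<open>preserved_cokernel\<close>, \<open>preserved_limit\<close>, \<open>preserved_tensor\<close>.

  Conversely, a functor \<open>F\<close> that preserves direct limits is determined by its values at the finitely
  presented modules, because each module \<open>S\<close> is the direct limit of the modules that are presented by
  finitely many elements of \<open>S\<close> and finitely many relations between them (\<open>limit_of_presentations\<close>).
  The module \<open>P\<close> with generators \<open>Y\<close> and relations \<open>N\<close> represents the functor of the solutions in \<open>S^Y\<close>
  of the linear equations \<open>N\<close>, so that, by Yoneda's lemma, an element of \<open>F(P)\<close> is a natural
  transformation from this functor to \<open>F\<close>. Together, all elements of all the groups \<open>F(P)\<close> give a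
  natural epimorphism \<open>H \<rightarrow> F\<close> from a direct sum of such functors (\<open>cover\<close>). As the equations may be
  put into one block matrix, \<open>H\<close> is the kernel of a single transformation \<open>S^(B) \<rightarrow> S^(B')\<close>, and it
  belongs to each stable subcategory that contains the functors \<open>S \<mapsto> S^(B)\<close>. The kernel of \<open>H \<rightarrow> F\<close>
  preserves direct limits by the first part. It is therefore covered by some \<open>H'\<close> of the same kind,
  and \<open>F\<close> is the cokernel of \<open>H' \<rightarrow> H\<close> (\<open>Qs_ch_minimal\<close>).

  It remains to find \<open>S \<mapsto> S^(B)\<close> in the subcategory. If it contains the quasi-coherent modules, this
  is the isomorphism \<open>R^(B) \<otimes> S \<cong> S^(B)\<close> (\<open>contains_free_functor_of_quasi_coherents\<close>). If it contains
  \<open>S \<mapsto> S\<close> and is stable by finite sums, then \<open>S^(B)\<close> is the direct limit of the finite powers \<open>S^A\<close>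
  (\<open>contains_free_functor_of_sums\<close>).

  All this has to take place in the universe \<open>'u\<close>. An infinite set has as many finite subsets as
  elements, whence there are at most as many finite presentations as elements of \<open>'u\<close>; this bounds the
  index sets of the direct limits and the bases \<open>B\<close> and \<open>B'\<close>. What is constructed on another type is
  then moved to \<open>'u\<close> along an injection (\<open>copy_functor\<close>, \<open>quotient_module_exists\<close>).
\<close>


section \<open>Direct limits of groups, element by element\<close>

locale group_system =
  fixes I :: "'i set" and r :: "'i rel" and A :: "'i \<Rightarrow> 'a monoid" and \<phi> :: "'i \<Rightarrow> 'i \<Rightarrow> 'a \<Rightarrow> 'a"
  assumes directed: "directed_set I r"
    and grp: "\<And>i. i \<in> I \<Longrightarrow> group (A i)"
    and hom: "\<And>i j. (i, j) \<in> r \<Longrightarrow> \<phi> i j \<in> hom (A i) (A j)"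
    and ident: "\<And>i x. i \<in> I \<Longrightarrow> x \<in> carrier (A i) \<Longrightarrow> \<phi> i i x = x"
    and comp: "\<And>i j k x. (i, j) \<in> r \<Longrightarrow> (j, k) \<in> r \<Longrightarrow> x \<in> carrier (A i) \<Longrightarrow>
                 \<phi> i k x = \<phi> j k (\<phi> i j x)"
begin

definition cls :: "'i \<Rightarrow> 'a \<Rightarrow> ('i \<times> 'a) set" where
  "cls i x = lim_rel I r A \<phi> `` {(i, x)}"

lemma index: "(i, j) \<in> r \<Longrightarrow> i \<in> I" "(i, j) \<in> r \<Longrightarrow> j \<in> I"
  using directed unfolding directed_set_def preorder_on_def by auto

lemma refl: "i \<in> I \<Longrightarrow> (i, i) \<in> r"
  using directed unfolding directed_set_def preorder_on_def refl_on_def by auto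

lemma trans: "(i, j) \<in> r \<Longrightarrow> (j, k) \<in> r \<Longrightarrow> (i, k) \<in> r"
  using directed unfolding directed_set_def preorder_on_def by (meson transD)

lemma upper: assumes "i \<in> I" "j \<in> I" obtains k where "(i, k) \<in> r" "(j, k) \<in> r"
  using directed assms unfolding directed_set_def by blast

lemma closed: "(i, j) \<in> r \<Longrightarrow> x \<in> carrier (A i) \<Longrightarrow> \<phi> i j x \<in> carrier (A j)"
  using hom by (auto simp: hom_def)

lemma mult: "(i, j) \<in> r \<Longrightarrow> x \<in> carrier (A i) \<Longrightarrow> y \<in> carrier (A i) \<Longrightarrow>
    \<phi> i j (x \<otimes>\<^bsub>A i\<^esub> y) = \<phi> i j x \<otimes>\<^bsub>A j\<^esub> \<phi> i j y"
  using hom by (auto simp: hom_def)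

lemma mult_closed: "i \<in> I \<Longrightarrow> x \<in> carrier (A i) \<Longrightarrow> y \<in> carrier (A i) \<Longrightarrow> x \<otimes>\<^bsub>A i\<^esub> y \<in> carrier (A i)"
  using grp by (simp add: group.is_monoid monoid.m_closed)

lemma one: "(i, j) \<in> r \<Longrightarrow> \<phi> i j \<one>\<^bsub>A i\<^esub> = \<one>\<^bsub>A j\<^esub>"
  using hom_one[OF hom] grp index by blast

lemma lim_relI:
  "(i, k) \<in> r \<Longrightarrow> (j, k) \<in> r \<Longrightarrow> x \<in> carrier (A i) \<Longrightarrow> y \<in> carrier (A j) \<Longrightarrow> \<phi> i k x = \<phi> j k y \<Longrightarrow>
   ((i, x), (j, y)) \<in> lim_rel I r A \<phi>"
  unfolding lim_rel_def using index by blast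

lemma lim_relE:
  assumes "((i, x), (j, y)) \<in> lim_rel I r A \<phi>"
  obtains k where "(i, k) \<in> r" "(j, k) \<in> r" "x \<in> carrier (A i)" "y \<in> carrier (A j)" "\<phi> i k x = \<phi> j k y"
  using assms unfolding lim_rel_def by blast

lemma equiv_lim_rel: "equiv (SIGMA i:I. carrier (A i)) (lim_rel I r A \<phi>)"
proof (rule equivI)
  show "lim_rel I r A \<phi> \<subseteq> (SIGMA i:I. carrier (A i)) \<times> (SIGMA i:I. carrier (A i))"
    unfolding lim_rel_def by auto
  show "refl_on (SIGMA i:I. carrier (A i)) (lim_rel I r A \<phi>)"
    unfolding refl_on_def by (auto intro: lim_relI refl)
  show "sym (lim_rel I r A \<phi>)"
    by (rule symI) (auto elim!: lim_relE intro: lim_relI)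
  show "Relation.trans (lim_rel I r A \<phi>)"
  proof (rule transI, clarify)
    fix i x j y k z
    assume "((i, x), (j, y)) \<in> lim_rel I r A \<phi>" "((j, y), (k, z)) \<in> lim_rel I r A \<phi>"
    then obtain a b where a: "(i, a) \<in> r" "(j, a) \<in> r" "x \<in> carrier (A i)" "\<phi> i a x = \<phi> j a y"
      and b: "(j, b) \<in> r" "(k, b) \<in> r" "y \<in> carrier (A j)" "z \<in> carrier (A k)" "\<phi> j b y = \<phi> k b z"
      by (metis lim_relE)
    obtain d where d: "(a, d) \<in> r" "(b, d) \<in> r"
      using upper index a b by metis
    have "\<phi> i d x = \<phi> k d z"
      using a b d comp by metis
    then show "((i, x), (k, z)) \<in> lim_rel I r A \<phi>"
      using a b d trans lim_relI by metis
  qed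
qed

lemma cls_eq_iff:
  "i \<in> I \<Longrightarrow> x \<in> carrier (A i) \<Longrightarrow> j \<in> I \<Longrightarrow> y \<in> carrier (A j) \<Longrightarrow>
   cls i x = cls j y \<longleftrightarrow> ((i, x), (j, y)) \<in> lim_rel I r A \<phi>"
  unfolding cls_def using eq_equiv_class_iff[OF equiv_lim_rel] by auto

lemma mem_cls_iff: "(j, y) \<in> cls i x \<longleftrightarrow> ((i, x), (j, y)) \<in> lim_rel I r A \<phi>"
  unfolding cls_def by simp

lemma self_mem_cls: "i \<in> I \<Longrightarrow> x \<in> carrier (A i) \<Longrightarrow> (i, x) \<in> cls i x"
  unfolding mem_cls_iff by (auto intro: lim_relI refl)

lemma cls_push: "(i, k) \<in> r \<Longrightarrow> x \<in> carrier (A i) \<Longrightarrow> cls i x = cls k (\<phi> i k x)"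
  using cls_eq_iff lim_relI[OF _ refl] closed ident index by metis

lemma carrier_lim_group: "carrier (lim_group I r A \<phi>) = {cls i x | i x. i \<in> I \<and> x \<in> carrier (A i)}"
  unfolding lim_group_def cls_def quotient_def by auto

lemma cls_in_carrier: "i \<in> I \<Longrightarrow> x \<in> carrier (A i) \<Longrightarrow> cls i x \<in> carrier (lim_group I r A \<phi>)"
  unfolding carrier_lim_group by blast

text \<open>
  The definition multiplies representatives at all their common stages. These products become equal
  later, so that they form a single class, and one stage suffices.
\<close>

lemma mult_cls:
  assumes k: "k \<in> I" and u: "u \<in> carrier (A k)" and v: "v \<in> carrier (A k)"
  shows "cls k u \<otimes>\<^bsub>lim_group I r A \<phi>\<^esub> cls k v = cls k (u \<otimes>\<^bsub>A k\<^esub> v)"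
proof -
  let ?Z = "{(d, \<phi> i d x \<otimes>\<^bsub>A d\<^esub> \<phi> j d y) | i x j y d.
           (i, x) \<in> cls k u \<and> (j, y) \<in> cls k v \<and> (i, d) \<in> r \<and> (j, d) \<in> r}"
  interpret k: group "A k" using grp[OF k] .
  have "?Z \<subseteq> cls k (u \<otimes>\<^bsub>A k\<^esub> v)"
  proof clarify
    fix i x j y d
    assume *: "(i, x) \<in> cls k u" "(j, y) \<in> cls k v" "(i, d) \<in> r" "(j, d) \<in> r"
    obtain a where a: "(i, a) \<in> r" "(k, a) \<in> r" "x \<in> carrier (A i)" "\<phi> k a u = \<phi> i a x"
      using *(1) unfolding mem_cls_iff by (metis lim_relE)
    obtain b where b: "(j, b) \<in> r" "(k, b) \<in> r" "y \<in> carrier (A j)" "\<phi> k b v = \<phi> j b y"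
      using *(2) unfolding mem_cls_iff by (metis lim_relE)
    obtain e where e: "(a, e) \<in> r" "(b, e) \<in> r"
      using upper index a b by metis
    obtain f where f: "(e, f) \<in> r" "(d, f) \<in> r"
      using upper index e * by metis
    have af: "(a, f) \<in> r" "(b, f) \<in> r" using e f trans by blast+
    have "\<phi> d f (\<phi> i d x \<otimes>\<^bsub>A d\<^esub> \<phi> j d y) = \<phi> d f (\<phi> i d x) \<otimes>\<^bsub>A f\<^esub> \<phi> d f (\<phi> j d y)"
      using mult[OF f(2) closed closed] * a b by blast
    also have "\<dots> = \<phi> i f x \<otimes>\<^bsub>A f\<^esub> \<phi> j f y"
      using * a b f comp by metis
    also have "\<dots> = \<phi> k f u \<otimes>\<^bsub>A f\<^esub> \<phi> k f v"
      using a b af u v comp by metis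
    also have "\<dots> = \<phi> k f (u \<otimes>\<^bsub>A k\<^esub> v)"
      using u v a af trans by (metis mult)
    finally have eq: "\<phi> k f (u \<otimes>\<^bsub>A k\<^esub> v) = \<phi> d f (\<phi> i d x \<otimes>\<^bsub>A d\<^esub> \<phi> j d y)" by simp
    have "\<phi> i d x \<in> carrier (A d)" "\<phi> j d y \<in> carrier (A d)"
      using * a b closed by blast+
    then have "\<phi> i d x \<otimes>\<^bsub>A d\<^esub> \<phi> j d y \<in> carrier (A d)"
      using mult_closed index(2)[OF *(3)] by blast
    moreover have "(k, f) \<in> r" using a af trans by blast
    ultimately show "(d, \<phi> i d x \<otimes>\<^bsub>A d\<^esub> \<phi> j d y) \<in> cls k (u \<otimes>\<^bsub>A k\<^esub> v)"
      unfolding mem_cls_iff using lim_relI f(2) eq mult_closed k u v by blast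
  qed
  moreover have "(k, u \<otimes>\<^bsub>A k\<^esub> v) \<in> ?Z"
  proof -
    have "u \<otimes>\<^bsub>A k\<^esub> v = \<phi> k k u \<otimes>\<^bsub>A k\<^esub> \<phi> k k v" using k u v by (simp add: ident)
    then show ?thesis using self_mem_cls[OF k u] self_mem_cls[OF k v] refl[OF k] by blast
  qed
  ultimately have "lim_rel I r A \<phi> `` ?Z = cls k (u \<otimes>\<^bsub>A k\<^esub> v)"
  proof -
    assume sub: "?Z \<subseteq> cls k (u \<otimes>\<^bsub>A k\<^esub> v)" and mem: "(k, u \<otimes>\<^bsub>A k\<^esub> v) \<in> ?Z"
    have "lim_rel I r A \<phi> `` ?Z \<subseteq> cls k (u \<otimes>\<^bsub>A k\<^esub> v)"
    proof
      fix q assume "q \<in> lim_rel I r A \<phi> `` ?Z"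
      then obtain p where "p \<in> cls k (u \<otimes>\<^bsub>A k\<^esub> v)" "(p, q) \<in> lim_rel I r A \<phi>"
        using sub by blast
      then show "q \<in> cls k (u \<otimes>\<^bsub>A k\<^esub> v)"
        unfolding cls_def using equiv_lim_rel unfolding equiv_def by (meson Image_singleton_iff transD)
    qed
    moreover have "cls k (u \<otimes>\<^bsub>A k\<^esub> v) \<subseteq> lim_rel I r A \<phi> `` ?Z"
      using mem unfolding cls_def by blast
    ultimately show ?thesis by blast
  qed
  then show ?thesis unfolding lim_group_def by simp
qed

lemma common_stage:
  assumes "K \<in> carrier (lim_group I r A \<phi>)" "L \<in> carrier (lim_group I r A \<phi>)"
  obtains k u v where "k \<in> I" "u \<in> carrier (A k)" "v \<in> carrier (A k)" "K = cls k u" "L = cls k v"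
proof -
  obtain i x j y where "i \<in> I" "x \<in> carrier (A i)" "K = cls i x" "j \<in> I" "y \<in> carrier (A j)" "L = cls j y"
    using assms unfolding carrier_lim_group by blast
  moreover obtain k where "(i, k) \<in> r" "(j, k) \<in> r" using upper calculation by metis
  ultimately show thesis using that[of k "\<phi> i k x" "\<phi> j k y"] cls_push closed index by metis
qed

lemma lim_group_mult_closed:
  assumes "K \<in> carrier (lim_group I r A \<phi>)" "L \<in> carrier (lim_group I r A \<phi>)"
  shows "K \<otimes>\<^bsub>lim_group I r A \<phi>\<^esub> L \<in> carrier (lim_group I r A \<phi>)"
proof -
  obtain k u v where k: "k \<in> I" "u \<in> carrier (A k)" "v \<in> carrier (A k)" "K = cls k u" "L = cls k v"
    using common_stage[OF assms] .
  show ?thesis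
    unfolding k(4,5) mult_cls[OF k(1,2,3)] by (rule cls_in_carrier[OF k(1) mult_closed[OF k(1,2,3)]])
qed

end

locale group_cocone = group_system I r A \<phi>
  for I :: "'i set" and r and A :: "'i \<Rightarrow> 'a monoid" and \<phi> +
  fixes G :: "'b monoid" and c :: "'i \<Rightarrow> 'a \<Rightarrow> 'b"
  assumes target: "group G"
    and leg: "\<And>i. i \<in> I \<Longrightarrow> c i \<in> hom (A i) G"
    and compat: "\<And>i j x. (i, j) \<in> r \<Longrightarrow> x \<in> carrier (A i) \<Longrightarrow> c j (\<phi> i j x) = c i x"
begin

lemma lim_map_cls:
  assumes "i \<in> I" "x \<in> carrier (A i)"
  shows "lim_map c (cls i x) = c i x"
proof -
  have "(\<lambda>(i, x). c i x) ` cls i x = {c i x}"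
  proof -
    have "c j y = c i x" if mem: "(j, y) \<in> cls i x" for j y
    proof -
      obtain k where "(i, k) \<in> r" "(j, k) \<in> r" "y \<in> carrier (A j)" "\<phi> i k x = \<phi> j k y"
        using mem unfolding mem_cls_iff by (rule lim_relE) auto
      then show ?thesis using compat assms by metis
    qed
    then have "(\<lambda>(i, x). c i x) p = c i x" if "p \<in> cls i x" for p
      using that by (cases p) auto
    then show ?thesis using self_mem_cls[OF assms] by blast
  qed
  then show ?thesis unfolding lim_map_def by simp
qed

lemma lim_map_hom: "lim_map c \<in> hom (lim_group I r A \<phi>) G"
proof (rule homI)
  fix K assume "K \<in> carrier (lim_group I r A \<phi>)"
  then obtain i x where "i \<in> I" "x \<in> carrier (A i)" "K = cls i x"
    unfolding carrier_lim_group by blast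
  then show "lim_map c K \<in> carrier G"
    using lim_map_cls leg hom_in_carrier by metis
next
  fix K L assume "K \<in> carrier (lim_group I r A \<phi>)" "L \<in> carrier (lim_group I r A \<phi>)"
  then obtain k u v where k: "k \<in> I" "u \<in> carrier (A k)" "v \<in> carrier (A k)" "K = cls k u" "L = cls k v"
    by (rule common_stage)
  show "lim_map c (K \<otimes>\<^bsub>lim_group I r A \<phi>\<^esub> L) = lim_map c K \<otimes>\<^bsub>G\<^esub> lim_map c L"
    unfolding k mult_cls[OF k(1,2,3)] lim_map_cls[OF k(1,2)] lim_map_cls[OF k(1,3)]
      lim_map_cls[OF k(1) mult_closed[OF k(1,2,3)]]
    by (rule hom_mult[OF leg[OF k(1)] k(2,3)])
qed

text \<open>
  Two elements of the limit can be compared at a common stage, where their quotient is an element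
  that vanishes in the limit. This turns bijectivity into a statement about elements of the groups
  \<open>A i\<close>, in which the classes that make up the limit do not occur.
\<close>

lemma lim_map_iso_iff:
  "lim_map c \<in> iso (lim_group I r A \<phi>) G \<longleftrightarrow>
     (\<forall>g\<in>carrier G. \<exists>i\<in>I. \<exists>x\<in>carrier (A i). c i x = g) \<and>
     (\<forall>i\<in>I. \<forall>x\<in>carrier (A i). c i x = \<one>\<^bsub>G\<^esub> \<longrightarrow> (\<exists>k. (i, k) \<in> r \<and> \<phi> i k x = \<one>\<^bsub>A k\<^esub>))"
  (is "?iso \<longleftrightarrow> ?surj \<and> ?inj")
proof (intro iffI conjI)
  assume ?iso
  then have bij: "bij_betw (lim_map c) (carrier (lim_group I r A \<phi>)) (carrier G)"
    by (simp add: iso_def)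
  show ?surj
  proof
    fix g assume "g \<in> carrier G"
    then obtain K where "K \<in> carrier (lim_group I r A \<phi>)" "lim_map c K = g"
      using bij unfolding bij_betw_def by (metis imageE)
    then show "\<exists>i\<in>I. \<exists>x\<in>carrier (A i). c i x = g"
      unfolding carrier_lim_group using lim_map_cls by fastforce
  qed
  show ?inj
  proof (intro ballI impI)
    fix i x assume i: "i \<in> I" and x: "x \<in> carrier (A i)" and c: "c i x = \<one>\<^bsub>G\<^esub>"
    interpret i: group "A i" using grp[OF i] .
    have "lim_map c (cls i x) = lim_map c (cls i \<one>\<^bsub>A i\<^esub>)"
      using i x c leg[OF i] target by (simp add: lim_map_cls hom_one i.is_group)
    then have "cls i x = cls i \<one>\<^bsub>A i\<^esub>"
      using bij i x cls_in_carrier unfolding bij_betw_def by (meson i.one_closed inj_onD)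
    then obtain k where "(i, k) \<in> r" "\<phi> i k x = \<phi> i k \<one>\<^bsub>A i\<^esub>"
      using i x cls_eq_iff by (metis i.one_closed lim_relE)
    then show "\<exists>k. (i, k) \<in> r \<and> \<phi> i k x = \<one>\<^bsub>A k\<^esub>" using one by auto
  qed
next
  assume "?surj \<and> ?inj"
  then have surj: ?surj and inj: ?inj by auto
  have "inj_on (lim_map c) (carrier (lim_group I r A \<phi>))"
  proof (rule inj_onI)
    fix K L assume "K \<in> carrier (lim_group I r A \<phi>)" "L \<in> carrier (lim_group I r A \<phi>)"
      and eq: "lim_map c K = lim_map c L"
    then obtain k u v where k: "k \<in> I" "u \<in> carrier (A k)" "v \<in> carrier (A k)" "K = cls k u" "L = cls k v"
      using common_stage by metis
    interpret k: group_hom "A k" G "c k"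
      using k grp target leg by (simp add: group_hom_def group_hom_axioms_def)
    have "c k (u \<otimes>\<^bsub>A k\<^esub> inv\<^bsub>A k\<^esub> v) = \<one>\<^bsub>G\<^esub>"
      using eq k by (simp add: lim_map_cls)
    then obtain l where l: "(k, l) \<in> r" "\<phi> k l (u \<otimes>\<^bsub>A k\<^esub> inv\<^bsub>A k\<^esub> v) = \<one>\<^bsub>A l\<^esub>"
      using inj k by (meson k.G.inv_closed k.G.m_closed)
    interpret l: group_hom "A k" "A l" "\<phi> k l"
      using l index grp hom by (simp add: group_hom_def group_hom_axioms_def)
    have "\<phi> k l u = \<phi> k l v"
      using l(2) k by (simp add: l.H.inv_solve_right' )
    then have "cls k u = cls k v"
      using k l cls_eq_iff lim_relI by metis
    then show "K = L" using k by simp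
  qed
  moreover have "lim_map c ` carrier (lim_group I r A \<phi>) = carrier G"
  proof
    show "lim_map c ` carrier (lim_group I r A \<phi>) \<subseteq> carrier G"
      using hom_carrier[OF lim_map_hom] .
    show "carrier G \<subseteq> lim_map c ` carrier (lim_group I r A \<phi>)"
    proof
      fix g assume "g \<in> carrier G"
      then obtain i x where "i \<in> I" "x \<in> carrier (A i)" "c i x = g"
        using surj by blast
      then show "g \<in> lim_map c ` carrier (lim_group I r A \<phi>)"
        using lim_map_cls cls_in_carrier by (intro image_eqI[of _ _ "cls i x"]) auto
    qed
  qed
  ultimately show ?iso
    using lim_map_hom by (simp add: iso_def bij_betw_def)
qed

end

section \<open>Preservation of direct limits, element by element\<close>

lemma left_moduleD:
  assumes "left_module R M"
  shows "ring R" "abelian_group M"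
    "\<And>a x. a \<in> carrier R \<Longrightarrow> x \<in> carrier M \<Longrightarrow> a \<odot>\<^bsub>M\<^esub> x \<in> carrier M"
    "\<And>a b x. a \<in> carrier R \<Longrightarrow> b \<in> carrier R \<Longrightarrow> x \<in> carrier M \<Longrightarrow>
       (a \<oplus>\<^bsub>R\<^esub> b) \<odot>\<^bsub>M\<^esub> x = a \<odot>\<^bsub>M\<^esub> x \<oplus>\<^bsub>M\<^esub> b \<odot>\<^bsub>M\<^esub> x"
    "\<And>a x y. a \<in> carrier R \<Longrightarrow> x \<in> carrier M \<Longrightarrow> y \<in> carrier M \<Longrightarrow>
       a \<odot>\<^bsub>M\<^esub> (x \<oplus>\<^bsub>M\<^esub> y) = a \<odot>\<^bsub>M\<^esub> x \<oplus>\<^bsub>M\<^esub> a \<odot>\<^bsub>M\<^esub> y"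
    "\<And>a b x. a \<in> carrier R \<Longrightarrow> b \<in> carrier R \<Longrightarrow> x \<in> carrier M \<Longrightarrow>
       (a \<otimes>\<^bsub>R\<^esub> b) \<odot>\<^bsub>M\<^esub> x = a \<odot>\<^bsub>M\<^esub> (b \<odot>\<^bsub>M\<^esub> x)"
    "\<And>x. x \<in> carrier M \<Longrightarrow> \<one>\<^bsub>R\<^esub> \<odot>\<^bsub>M\<^esub> x = x"
  using assms unfolding left_module_def by auto

lemma additive_group_sel [simp]:
  "carrier (additive_group S) = carrier S" "monoid.mult (additive_group S) = (\<oplus>\<^bsub>S\<^esub>)"
  "one (additive_group S) = \<zero>\<^bsub>S\<^esub>"
  by (auto simp: additive_group_def)

lemma comm_group_additive_group: "abelian_group S \<Longrightarrow> comm_group (additive_group S)"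
proof -
  assume "abelian_group S"
  then interpret S: abelian_group S .
  show ?thesis
    by (rule comm_groupI) (auto simp: S.a_ac intro: S.l_neg)
qed

lemma linear_mapsD:
  assumes "f \<in> linear_maps R S T"
  shows "\<And>x. x \<in> carrier S \<Longrightarrow> f x \<in> carrier T"
    "\<And>x y. x \<in> carrier S \<Longrightarrow> y \<in> carrier S \<Longrightarrow> f (x \<oplus>\<^bsub>S\<^esub> y) = f x \<oplus>\<^bsub>T\<^esub> f y"
    "\<And>a x. a \<in> carrier R \<Longrightarrow> x \<in> carrier S \<Longrightarrow> f (a \<odot>\<^bsub>S\<^esub> x) = a \<odot>\<^bsub>T\<^esub> f x"
    "f \<in> extensional (carrier S)"
  using assms unfolding linear_maps_def PiE_def by auto

lemma linear_maps_hom: "f \<in> linear_maps R S T \<Longrightarrow> f \<in> hom (additive_group S) (additive_group T)"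
  unfolding linear_maps_def by (auto simp: hom_def)

lemma linear_maps_zero:
  assumes "left_module R S" "left_module R T" "f \<in> linear_maps R S T"
  shows "f \<zero>\<^bsub>S\<^esub> = \<zero>\<^bsub>T\<^esub>"
  using hom_one[OF linear_maps_hom[OF assms(3)]] assms comm_group_additive_group left_moduleD(2)
  by (metis additive_group_sel(3) comm_group_def)

lemma linear_compose:
  "f \<in> linear_maps R S T \<Longrightarrow> g \<in> linear_maps R T U \<Longrightarrow> left_module R S \<Longrightarrow>
   compose (carrier S) g f \<in> linear_maps R S U"
proof -
  assume f: "f \<in> linear_maps R S T" and g: "g \<in> linear_maps R T U" and S: "left_module R S"
  interpret S: abelian_group S using left_moduleD(2)[OF S] .
  have "f x \<in> carrier T" if "x \<in> carrier S" for x using linear_mapsD(1)[OF f that] .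
  moreover have "g y \<in> carrier U" if "y \<in> carrier T" for y using linear_mapsD(1)[OF g that] .
  ultimately show ?thesis
    using linear_mapsD(2,3)[OF f] linear_mapsD(2,3)[OF g] left_moduleD(3)[OF S]
    unfolding linear_maps_def by (simp add: compose_def)
qed

lemma functor_moduleD:
  assumes "functor_module R F"
  shows "\<And>S. left_module R S \<Longrightarrow> comm_group (fobj F S)"
    "\<And>S T f. left_module R S \<Longrightarrow> left_module R T \<Longrightarrow> f \<in> linear_maps R S T \<Longrightarrow>
        farr F S T f \<in> hom (fobj F S) (fobj F T)"
    "\<And>S x. left_module R S \<Longrightarrow> x \<in> carrier (fobj F S) \<Longrightarrow> farr F S S (linear_id S) x = x"
    "\<And>S T U f g x. left_module R S \<Longrightarrow> left_module R T \<Longrightarrow> left_module R U \<Longrightarrow>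
        f \<in> linear_maps R S T \<Longrightarrow> g \<in> linear_maps R T U \<Longrightarrow> x \<in> carrier (fobj F S) \<Longrightarrow>
        farr F S U (compose (carrier S) g f) x = farr F T U g (farr F S T f x)"
    "\<And>S T f g x. left_module R S \<Longrightarrow> left_module R T \<Longrightarrow>
        f \<in> linear_maps R S T \<Longrightarrow> g \<in> linear_maps R S T \<Longrightarrow> x \<in> carrier (fobj F S) \<Longrightarrow>
        farr F S T (linear_add S T f g) x = farr F S T f x \<otimes>\<^bsub>fobj F T\<^esub> farr F S T g x"
  using assms unfolding functor_module_def by blast+

lemma functor_module_group: "functor_module R F \<Longrightarrow> left_module R S \<Longrightarrow> group (fobj F S)"
  using functor_moduleD(1) comm_group.axioms(2) by blast

lemma farr_closed:
  "functor_module R F \<Longrightarrow> left_module R S \<Longrightarrow> left_module R T \<Longrightarrow> f \<in> linear_maps R S T \<Longrightarrow>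
   x \<in> carrier (fobj F S) \<Longrightarrow> farr F S T f x \<in> carrier (fobj F T)"
  using hom_in_carrier[OF functor_moduleD(2)] .

lemma farr_mult:
  "functor_module R F \<Longrightarrow> left_module R S \<Longrightarrow> left_module R T \<Longrightarrow> f \<in> linear_maps R S T \<Longrightarrow>
   x \<in> carrier (fobj F S) \<Longrightarrow> y \<in> carrier (fobj F S) \<Longrightarrow>
   farr F S T f (x \<otimes>\<^bsub>fobj F S\<^esub> y) = farr F S T f x \<otimes>\<^bsub>fobj F T\<^esub> farr F S T f y"
  using hom_mult[OF functor_moduleD(2)] .

lemma farr_group_hom:
  "functor_module R F \<Longrightarrow> left_module R S \<Longrightarrow> left_module R T \<Longrightarrow> f \<in> linear_maps R S T \<Longrightarrow>
   group_hom (fobj F S) (fobj F T) (farr F S T f)"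
  using functor_moduleD(2) functor_module_group by (metis group_hom.intro group_hom_axioms.intro)

lemma module_group_cocone:
  fixes R :: "('r, 'k) ring_scheme" and S :: "'i \<Rightarrow> ('r, 'u) module" and L :: "('r, 'u) module"
  assumes directed: "directed_set I r" and system: "module_system R I r S s" and L: "left_module R L"
    and c_linear: "\<And>i. i \<in> I \<Longrightarrow> c i \<in> linear_maps R (S i) L"
    and c_comp: "\<And>i j. (i, j) \<in> r \<Longrightarrow> c i = compose (carrier (S i)) (c j) (s i j)"
  shows "group_cocone I r (\<lambda>i. additive_group (S i)) s (additive_group L) c"
proof (intro group_cocone.intro group_system.intro group_cocone_axioms.intro)
  have grp: "group (additive_group T)" if "left_module R T" for T :: "('r, 'u) module"
    by (rule comm_group.axioms(2)[OF comm_group_additive_group[OF left_moduleD(2)[OF that]]])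
  show "directed_set I r" by (rule directed)
  show "group (additive_group L)" by (rule grp[OF L])
  show "group (additive_group (S i))" if "i \<in> I" for i
    using system that unfolding module_system_def by (blast intro: grp)
  show "s i j \<in> hom (additive_group (S i)) (additive_group (S j))" if "(i, j) \<in> r" for i j
    using system that unfolding module_system_def by (blast intro: linear_maps_hom)
  show "c i \<in> hom (additive_group (S i)) (additive_group L)" if "i \<in> I" for i
    by (rule linear_maps_hom[OF c_linear[OF that]])
  show "s i i x = x" if "i \<in> I" "x \<in> carrier (additive_group (S i))" for i x
    using system that unfolding module_system_def by (simp add: linear_id_def)
  show "s i k x = s j k (s i j x)"
    if "(i, j) \<in> r" "(j, k) \<in> r" "x \<in> carrier (additive_group (S i))" for i j k x
  proof -
    have "s i k = compose (carrier (S i)) (s j k) (s i j)"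
      using system that(1,2) unfolding module_system_def by blast
    then show ?thesis using that(3) by (simp add: compose_def)
  qed
  show "c j (s i j x) = c i x" if "(i, j) \<in> r" "x \<in> carrier (additive_group (S i))" for i j x
    using that by (simp add: c_comp[OF that(1)] compose_def)
qed

locale limit_diagram =
  fixes R :: "('r, 'k) ring_scheme" and I :: "'i set" and r S s and L :: "('r, 'u) module" and c
  assumes directed: "directed_set I r" and system: "module_system R I r S s"
    and limit: "module_limit R I r S s L c"
begin

lemma module_S: "i \<in> I \<Longrightarrow> left_module R (S i)"
  using system unfolding module_system_def by blast

lemma module_L: "left_module R L"
  using limit unfolding module_limit_def by blast

lemma index: "(i, j) \<in> r \<Longrightarrow> i \<in> I" "(i, j) \<in> r \<Longrightarrow> j \<in> I"
  using directed unfolding directed_set_def preorder_on_def by auto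

lemma refl: "i \<in> I \<Longrightarrow> (i, i) \<in> r"
  using directed unfolding directed_set_def preorder_on_def refl_on_def by auto

lemma trans: "(i, j) \<in> r \<Longrightarrow> (j, k) \<in> r \<Longrightarrow> (i, k) \<in> r"
  using directed unfolding directed_set_def preorder_on_def by (meson transD)

lemma upper: assumes "i \<in> I" "j \<in> I" obtains k where "(i, k) \<in> r" "(j, k) \<in> r"
  using directed assms unfolding directed_set_def by blast

lemma nonempty: obtains i where "i \<in> I"
  using directed unfolding directed_set_def by blast

lemma s_linear: "(i, j) \<in> r \<Longrightarrow> s i j \<in> linear_maps R (S i) (S j)"
  using system unfolding module_system_def by blast

lemma c_linear: "i \<in> I \<Longrightarrow> c i \<in> linear_maps R (S i) L"
  using limit unfolding module_limit_def by blast

lemma s_id: "i \<in> I \<Longrightarrow> s i i = linear_id (S i)"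
  using system unfolding module_system_def by blast

lemma s_comp: "(i, j) \<in> r \<Longrightarrow> (j, k) \<in> r \<Longrightarrow> s i k = compose (carrier (S i)) (s j k) (s i j)"
  using system unfolding module_system_def by blast

lemma c_comp: "(i, j) \<in> r \<Longrightarrow> c i = compose (carrier (S i)) (c j) (s i j)"
  using limit unfolding module_limit_def by blast

lemma functor_cocone:
  assumes F: "functor_module R F"
  shows "group_cocone I r (\<lambda>i. fobj F (S i)) (\<lambda>i j. farr F (S i) (S j) (s i j)) (fobj F L)
           (\<lambda>i. farr F (S i) L (c i))"
proof (intro group_cocone.intro group_system.intro group_cocone_axioms.intro)
  fix i j k x
  assume *: "(i, j) \<in> r" "(j, k) \<in> r" "x \<in> carrier (fobj F (S i))"
  show "farr F (S i) (S k) (s i k) x = farr F (S j) (S k) (s j k) (farr F (S i) (S j) (s i j) x)"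
    unfolding s_comp[OF *(1,2)]
    by (rule functor_moduleD(4)[OF F module_S module_S module_S s_linear s_linear])
       (fact * index[OF *(1)] index[OF *(2)])+
next
  fix i j x
  assume *: "(i, j) \<in> r" "x \<in> carrier (fobj F (S i))"
  show "farr F (S j) L (c j) (farr F (S i) (S j) (s i j) x) = farr F (S i) L (c i) x"
    unfolding c_comp[OF *(1)]
    by (rule functor_moduleD(4)[OF F module_S module_S module_L s_linear c_linear, symmetric])
       (fact * index[OF *(1)])+
next
  show "directed_set I r" by (rule directed)
  show "group (fobj F L)" by (rule functor_module_group[OF F module_L])
  show "group (fobj F (S i))" if "i \<in> I" for i
    by (rule functor_module_group[OF F module_S[OF that]])
  show "farr F (S i) (S j) (s i j) \<in> hom (fobj F (S i)) (fobj F (S j))" if "(i, j) \<in> r" for i j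
    by (rule functor_moduleD(2)[OF F module_S module_S s_linear]) (fact that index[OF that])+
  show "farr F (S i) L (c i) \<in> hom (fobj F (S i)) (fobj F L)" if "i \<in> I" for i
    by (rule functor_moduleD(2)[OF F module_S module_L c_linear]) (fact that)+
  show "farr F (S i) (S i) (s i i) x = x" if "i \<in> I" "x \<in> carrier (fobj F (S i))" for i x
    unfolding s_id[OF that(1)] by (rule functor_moduleD(3)[OF F module_S]) (fact that)+
qed

lemma preserved_iff:
  assumes F: "functor_module R F"
  shows "lim_map (\<lambda>i. farr F (S i) L (c i))
          \<in> iso (lim_group I r (\<lambda>i. fobj F (S i)) (\<lambda>i j. farr F (S i) (S j) (s i j))) (fobj F L) \<longleftrightarrow>
     (\<forall>y\<in>carrier (fobj F L). \<exists>i\<in>I. \<exists>x\<in>carrier (fobj F (S i)). farr F (S i) L (c i) x = y) \<and>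
     (\<forall>i\<in>I. \<forall>x\<in>carrier (fobj F (S i)). farr F (S i) L (c i) x = \<one>\<^bsub>fobj F L\<^esub> \<longrightarrow>
        (\<exists>k. (i, k) \<in> r \<and> farr F (S i) (S k) (s i k) x = \<one>\<^bsub>fobj F (S k)\<^esub>))"
  by (rule group_cocone.lim_map_iso_iff[OF functor_cocone[OF F]])

lemma group_cocone_modules:
  "group_cocone I r (\<lambda>i. additive_group (S i)) s (additive_group L) c"
  by (rule module_group_cocone[OF directed system module_L c_linear c_comp])

lemma lim_surj:
  assumes "y \<in> carrier L"
  obtains i x where "i \<in> I" "x \<in> carrier (S i)" "c i x = y"
proof -
  have "lim_map c \<in> iso (lim_group I r (\<lambda>i. additive_group (S i)) s) (additive_group L)"
    using limit unfolding module_limit_def by blast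
  then show thesis
    using group_cocone.lim_map_iso_iff[OF group_cocone_modules] assms that by auto
qed

lemma lim_inj:
  assumes "i \<in> I" "x \<in> carrier (S i)" "c i x = \<zero>\<^bsub>L\<^esub>"
  obtains k where "(i, k) \<in> r" "s i k x = \<zero>\<^bsub>S k\<^esub>"
proof -
  have "lim_map c \<in> iso (lim_group I r (\<lambda>i. additive_group (S i)) s) (additive_group L)"
    using limit unfolding module_limit_def by blast
  then have "\<exists>k. (i, k) \<in> r \<and> s i k x = \<zero>\<^bsub>S k\<^esub>"
    using group_cocone.lim_map_iso_iff[OF group_cocone_modules] assms by auto
  then show thesis using that by blast
qed

end

text \<open>
  The two halves of \<open>lim_map_iso_iff\<close>. They make sense before \<open>F\<close> is known to be a functor, and so can
  be checked directly for kernels, cokernels and limits of functors.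
\<close>

definition preserves_limit_elements ::
  "('r, 'k) ring_scheme \<Rightarrow> 'i set \<Rightarrow> 'i rel \<Rightarrow> ('i \<Rightarrow> ('r, 'u) module) \<Rightarrow> ('i \<Rightarrow> 'i \<Rightarrow> 'u \<Rightarrow> 'u) \<Rightarrow>
   ('r, 'u) module \<Rightarrow> ('i \<Rightarrow> 'u \<Rightarrow> 'u) \<Rightarrow> ('r, 'u, 'b) functr \<Rightarrow> bool" where
  "preserves_limit_elements R I r S s L c F \<longleftrightarrow>
     (\<forall>y\<in>carrier (fobj F L). \<exists>i\<in>I. \<exists>x\<in>carrier (fobj F (S i)). farr F (S i) L (c i) x = y) \<and>
     (\<forall>i\<in>I. \<forall>x\<in>carrier (fobj F (S i)). farr F (S i) L (c i) x = \<one>\<^bsub>fobj F L\<^esub> \<longrightarrow>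
        (\<exists>k. (i, k) \<in> r \<and> farr F (S i) (S k) (s i k) x = \<one>\<^bsub>fobj F (S k)\<^esub>))"

lemma preserves_direct_limits_iff:
  fixes F :: "('r, 'u, 'b) functr"
  assumes "functor_module R F"
  shows "preserves_direct_limits R F \<longleftrightarrow>
    (\<forall>(I :: 'u set) r S s L c. limit_diagram R I r S s L c \<longrightarrow> preserves_limit_elements R I r S s L c F)"
proof -
  have "preserves_direct_limits R F \<longleftrightarrow> (\<forall>(I :: 'u set) r S s L c. limit_diagram R I r S s L c \<longrightarrow>
        lim_map (\<lambda>i. farr F (S i) L (c i))
          \<in> iso (lim_group I r (\<lambda>i. fobj F (S i)) (\<lambda>i j. farr F (S i) (S j) (s i j))) (fobj F L))"
    unfolding preserves_direct_limits_def limit_diagram_def by blast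
  then show ?thesis
    unfolding preserves_limit_elements_def
    by (simp add: limit_diagram.preserved_iff[OF _ assms] cong: imp_cong)
qed

context group_system
begin

lemma one_closed: "i \<in> I \<Longrightarrow> \<one>\<^bsub>A i\<^esub> \<in> carrier (A i)"
  using grp by (simp add: group.is_monoid monoid.one_closed)

lemma group_lim_group: "group (lim_group I r A \<phi>)"
proof -
  let ?L = "lim_group I r A \<phi>"
  have one: "\<one>\<^bsub>?L\<^esub> = cls i \<one>\<^bsub>A i\<^esub>" if i: "i \<in> I" for i
  proof -
    have "(j, \<one>\<^bsub>A j\<^esub>) \<in> cls i \<one>\<^bsub>A i\<^esub>" if j: "j \<in> I" for j
    proof -
      obtain k where k: "(i, k) \<in> r" "(j, k) \<in> r" using upper[OF i j] .
      have "\<phi> i k \<one>\<^bsub>A i\<^esub> = \<phi> j k \<one>\<^bsub>A j\<^esub>" using one[OF k(1)] one[OF k(2)] by simp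
      then show ?thesis
        unfolding mem_cls_iff by (rule lim_relI[OF k one_closed[OF i] one_closed[OF j]])
    qed
    then have "cls j \<one>\<^bsub>A j\<^esub> = cls i \<one>\<^bsub>A i\<^esub>" if "j \<in> I" for j
      using that cls_eq_iff[OF i one_closed[OF i] that one_closed[OF that]] mem_cls_iff by simp
    moreover have "\<one>\<^bsub>?L\<^esub> = (\<Union>j\<in>I. cls j \<one>\<^bsub>A j\<^esub>)"
      unfolding lim_group_def cls_def monoid.simps by blast
    ultimately show ?thesis using i by blast
  qed
  show ?thesis
  proof (rule groupI)
    show "K \<otimes>\<^bsub>?L\<^esub> L \<in> carrier ?L" if "K \<in> carrier ?L" "L \<in> carrier ?L" for K L
      using lim_group_mult_closed[OF that] .
    obtain i where i: "i \<in> I" using directed unfolding directed_set_def by blast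
    then interpret i: group "A i" by (rule grp)
    show "\<one>\<^bsub>?L\<^esub> \<in> carrier ?L" unfolding one[OF i] by (rule cls_in_carrier[OF i i.one_closed])
    show "K \<otimes>\<^bsub>?L\<^esub> L \<otimes>\<^bsub>?L\<^esub> M = K \<otimes>\<^bsub>?L\<^esub> (L \<otimes>\<^bsub>?L\<^esub> M)"
      if KLM: "K \<in> carrier ?L" "L \<in> carrier ?L" "M \<in> carrier ?L" for K L M
    proof -
      obtain k u v where k: "k \<in> I" "u \<in> carrier (A k)" "v \<in> carrier (A k)" "K = cls k u" "L = cls k v"
        using KLM(1,2) by (rule common_stage)
      obtain j w where j: "j \<in> I" "w \<in> carrier (A j)" "M = cls j w"
        using KLM(3) unfolding carrier_lim_group by blast
      obtain l where l: "(k, l) \<in> r" "(j, l) \<in> r" using upper[OF k(1) j(1)] .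
      have lI: "l \<in> I" using index l by blast
      interpret l: group "A l" using grp[OF lI] .
      let ?u = "\<phi> k l u" and ?v = "\<phi> k l v" and ?w = "\<phi> j l w"
      have c: "?u \<in> carrier (A l)" "?v \<in> carrier (A l)" "?w \<in> carrier (A l)"
        using closed l k j by blast+
      have e: "K = cls l ?u" "L = cls l ?v" "M = cls l ?w"
        using k j l cls_push by blast+
      show ?thesis
        unfolding e mult_cls[OF lI c(1,2)] mult_cls[OF lI c(2,3)]
          mult_cls[OF lI c(1) l.m_closed[OF c(2,3)]] mult_cls[OF lI l.m_closed[OF c(1,2)] c(3)]
        using c by (simp add: l.m_assoc)
    qed
    fix K assume "K \<in> carrier ?L"
    then obtain k u where k: "k \<in> I" "u \<in> carrier (A k)" and K: "K = cls k u"
      unfolding carrier_lim_group by blast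
    interpret k: group "A k" using grp[OF k(1)] .
    show "\<one>\<^bsub>?L\<^esub> \<otimes>\<^bsub>?L\<^esub> K = K"
      unfolding one[OF k(1)] K mult_cls[OF k(1) k.one_closed k(2)] using k by simp
    have "cls k (inv\<^bsub>A k\<^esub> u) \<otimes>\<^bsub>?L\<^esub> K = \<one>\<^bsub>?L\<^esub>"
      unfolding one[OF k(1)] K mult_cls[OF k(1) k.inv_closed[OF k(2)] k(2)] using k by simp
    then show "\<exists>J\<in>carrier ?L. J \<otimes>\<^bsub>?L\<^esub> K = \<one>\<^bsub>?L\<^esub>"
      using cls_in_carrier[OF k(1) k.inv_closed[OF k(2)]] by blast
  qed
qed

lemma one_lim_group: "i \<in> I \<Longrightarrow> \<one>\<^bsub>lim_group I r A \<phi>\<^esub> = cls i \<one>\<^bsub>A i\<^esub>"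
proof -
  assume i: "i \<in> I"
  interpret i: group "A i" using grp[OF i] .
  interpret L: group "lim_group I r A \<phi>" by (rule group_lim_group)
  have "cls i \<one>\<^bsub>A i\<^esub> \<otimes>\<^bsub>lim_group I r A \<phi>\<^esub> cls i \<one>\<^bsub>A i\<^esub> = cls i \<one>\<^bsub>A i\<^esub>"
    using mult_cls[OF i i.one_closed i.one_closed] by simp
  then show ?thesis
    using L.l_cancel_one[OF cls_in_carrier[OF i i.one_closed] cls_in_carrier[OF i i.one_closed]] by simp
qed

lemma cls_eq_one_iff:
  assumes "i \<in> I" "x \<in> carrier (A i)"
  shows "cls i x = \<one>\<^bsub>lim_group I r A \<phi>\<^esub> \<longleftrightarrow> (\<exists>k. (i, k) \<in> r \<and> \<phi> i k x = \<one>\<^bsub>A k\<^esub>)"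
proof
  interpret i: group "A i" using grp[OF assms(1)] .
  show "\<exists>k. (i, k) \<in> r \<and> \<phi> i k x = \<one>\<^bsub>A k\<^esub>" if "cls i x = \<one>\<^bsub>lim_group I r A \<phi>\<^esub>"
  proof -
    have "((i, x), (i, \<one>\<^bsub>A i\<^esub>)) \<in> lim_rel I r A \<phi>"
      using that one_lim_group[OF assms(1)] cls_eq_iff[OF assms assms(1) i.one_closed] by simp
    then obtain k where "(i, k) \<in> r" "\<phi> i k x = \<phi> i k \<one>\<^bsub>A i\<^esub>" by (rule lim_relE) auto
    then show ?thesis using one by auto
  qed
  show "cls i x = \<one>\<^bsub>lim_group I r A \<phi>\<^esub>" if e: "\<exists>k. (i, k) \<in> r \<and> \<phi> i k x = \<one>\<^bsub>A k\<^esub>"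
  proof -
    obtain k where k: "(i, k) \<in> r" "\<phi> i k x = \<one>\<^bsub>A k\<^esub>" using e by blast
    show ?thesis
      unfolding cls_push[OF k(1) assms(2)] k(2) by (rule one_lim_group[OF index(2)[OF k(1)], symmetric])
  qed
qed

end

section \<open>Natural transformations and isomorphisms\<close>

lemma nat_transD:
  assumes "nat_trans R F G \<eta>"
  shows "\<And>S. left_module R S \<Longrightarrow> \<eta> S \<in> hom (fobj F S) (fobj G S)"
    "\<And>S x. left_module R S \<Longrightarrow> x \<in> carrier (fobj F S) \<Longrightarrow> \<eta> S x \<in> carrier (fobj G S)"
    "\<And>S x y. left_module R S \<Longrightarrow> x \<in> carrier (fobj F S) \<Longrightarrow> y \<in> carrier (fobj F S) \<Longrightarrow>
       \<eta> S (x \<otimes>\<^bsub>fobj F S\<^esub> y) = \<eta> S x \<otimes>\<^bsub>fobj G S\<^esub> \<eta> S y"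
    "\<And>S T f x. left_module R S \<Longrightarrow> left_module R T \<Longrightarrow> f \<in> linear_maps R S T \<Longrightarrow>
       x \<in> carrier (fobj F S) \<Longrightarrow> \<eta> T (farr F S T f x) = farr G S T f (\<eta> S x)"
proof -
  show hom: "\<eta> S \<in> hom (fobj F S) (fobj G S)" if "left_module R S" for S
    using assms that unfolding nat_trans_def by blast
  show "\<eta> S x \<in> carrier (fobj G S)" if "left_module R S" "x \<in> carrier (fobj F S)" for S x
    by (rule hom_in_carrier[OF hom[OF that(1)] that(2)])
  show "\<eta> S (x \<otimes>\<^bsub>fobj F S\<^esub> y) = \<eta> S x \<otimes>\<^bsub>fobj G S\<^esub> \<eta> S y"
    if "left_module R S" "x \<in> carrier (fobj F S)" "y \<in> carrier (fobj F S)" for S x y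
    by (rule hom_mult[OF hom[OF that(1)] that(2,3)])
qed (use assms in \<open>unfold nat_trans_def, blast\<close>)

lemma nat_transI:
  assumes "\<And>S x. left_module R S \<Longrightarrow> x \<in> carrier (fobj F S) \<Longrightarrow> \<eta> S x \<in> carrier (fobj G S)"
    "\<And>S x y. left_module R S \<Longrightarrow> x \<in> carrier (fobj F S) \<Longrightarrow> y \<in> carrier (fobj F S) \<Longrightarrow>
       \<eta> S (x \<otimes>\<^bsub>fobj F S\<^esub> y) = \<eta> S x \<otimes>\<^bsub>fobj G S\<^esub> \<eta> S y"
    "\<And>S T f x. left_module R S \<Longrightarrow> left_module R T \<Longrightarrow> f \<in> linear_maps R S T \<Longrightarrow>
       x \<in> carrier (fobj F S) \<Longrightarrow> \<eta> T (farr F S T f x) = farr G S T f (\<eta> S x)"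
  shows "nat_trans R F G \<eta>"
  unfolding nat_trans_def using assms by (blast intro: homI)

lemma nat_trans_one:
  assumes "nat_trans R F G \<eta>" "left_module R S" "group (fobj F S)" "group (fobj G S)"
  shows "\<eta> S \<one>\<^bsub>fobj F S\<^esub> = \<one>\<^bsub>fobj G S\<^esub>"
  using hom_one[OF nat_transD(1)[OF assms(1,2)] assms(3,4)] .

lemma nat_trans_comp:
  assumes "nat_trans R F G \<eta>" "nat_trans R G H \<theta>"
  shows "nat_trans R F H (\<lambda>S. \<theta> S \<circ> \<eta> S)"
  by (rule nat_transI) (simp_all add: nat_transD[OF assms(1)] nat_transD[OF assms(2)])

lemma functor_isoI:
  "nat_trans R F G \<eta> \<Longrightarrow> (\<And>S. left_module R S \<Longrightarrow> bij_betw (\<eta> S) (carrier (fobj F S)) (carrier (fobj G S))) \<Longrightarrow>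
   functor_iso R F G"
  unfolding functor_iso_def iso_def using nat_transD(1) by blast

lemma functor_isoE:
  assumes "functor_iso R F G"
  obtains \<eta> where "nat_trans R F G \<eta>"
    "\<And>S. left_module R S \<Longrightarrow> bij_betw (\<eta> S) (carrier (fobj F S)) (carrier (fobj G S))"
proof -
  obtain \<eta> where "nat_trans R F G \<eta>" "\<forall>S. left_module R S \<longrightarrow> \<eta> S \<in> iso (fobj F S) (fobj G S)"
    using assms unfolding functor_iso_def by blast
  then show thesis using that[of \<eta>] by (simp add: iso_def)
qed

lemma functor_iso_refl: "functor_iso R F F"
  by (rule functor_isoI[of _ _ _ "\<lambda>_ x. x"]) (auto intro: nat_transI simp: bij_betw_def)

lemma functor_iso_trans:
  assumes "functor_iso R F G" "functor_iso R G H"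
  shows "functor_iso R F H"
proof -
  obtain \<eta> where \<eta>: "nat_trans R F G \<eta>"
    "\<And>S. left_module R S \<Longrightarrow> bij_betw (\<eta> S) (carrier (fobj F S)) (carrier (fobj G S))"
    using functor_isoE[OF assms(1)] by blast
  obtain \<theta> where \<theta>: "nat_trans R G H \<theta>"
    "\<And>S. left_module R S \<Longrightarrow> bij_betw (\<theta> S) (carrier (fobj G S)) (carrier (fobj H S))"
    using functor_isoE[OF assms(2)] by blast
  show ?thesis
    by (rule functor_isoI[OF nat_trans_comp[OF \<eta>(1) \<theta>(1)]]) (rule bij_betw_trans[OF \<eta>(2) \<theta>(2)])
qed

text \<open>
  Of \<open>F\<close>, the inverse transformation uses only that the values are groups and that the arrows
  respect carriers. In this form the lemma applies to cokernels and to limits of functors.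
\<close>

lemma functor_iso_sym:
  assumes "functor_iso R F G"
    and grp: "\<And>S. left_module R S \<Longrightarrow> group (fobj F S)"
    and arr: "\<And>S T f x. left_module R S \<Longrightarrow> left_module R T \<Longrightarrow> f \<in> linear_maps R S T \<Longrightarrow>
       x \<in> carrier (fobj F S) \<Longrightarrow> farr F S T f x \<in> carrier (fobj F T)"
  shows "functor_iso R G F"
proof -
  obtain \<eta> where \<eta>: "nat_trans R F G \<eta>"
    and bij: "\<And>S. left_module R S \<Longrightarrow> bij_betw (\<eta> S) (carrier (fobj F S)) (carrier (fobj G S))"
    using functor_isoE[OF assms(1)] by blast
  define \<theta> where "\<theta> S = inv_into (carrier (fobj F S)) (\<eta> S)" for S
  have \<theta>_in: "\<theta> S y \<in> carrier (fobj F S)" if "left_module R S" "y \<in> carrier (fobj G S)" for S y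
    unfolding \<theta>_def using bij[OF that(1)] that(2) by (metis bij_betw_def inv_into_into)
  have \<eta>\<theta>: "\<eta> S (\<theta> S y) = y" if "left_module R S" "y \<in> carrier (fobj G S)" for S y
    unfolding \<theta>_def using bij[OF that(1)] that(2) by (metis bij_betw_inv_into_right)
  have \<theta>_eq: "\<theta> S y = x" if "left_module R S" "x \<in> carrier (fobj F S)" "\<eta> S x = y" for S x y
    unfolding \<theta>_def using bij[OF that(1)] that(2,3) by (metis bij_betw_inv_into_left)
  have "nat_trans R G F \<theta>"
  proof (rule nat_transI)
    fix S y z assume *: "left_module R S" "y \<in> carrier (fobj G S)" "z \<in> carrier (fobj G S)"
    interpret F: group "fobj F S" by (rule grp[OF *(1)])
    show "\<theta> S (y \<otimes>\<^bsub>fobj G S\<^esub> z) = \<theta> S y \<otimes>\<^bsub>fobj F S\<^esub> \<theta> S z"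
      using * \<theta>_in \<eta>\<theta> by (intro \<theta>_eq) (auto simp: nat_transD(3)[OF \<eta>])
  next
    fix S T f y assume *: "left_module R S" "left_module R T" "f \<in> linear_maps R S T" "y \<in> carrier (fobj G S)"
    show "\<theta> T (farr G S T f y) = farr F S T f (\<theta> S y)"
      using * \<theta>_in \<eta>\<theta> arr by (intro \<theta>_eq) (auto simp: nat_transD(4)[OF \<eta>])
  qed (rule \<theta>_in)
  then show ?thesis
    by (rule functor_isoI) (auto simp: \<theta>_def intro: bij_betw_inv_into bij)
qed

lemma functor_iso_sym_functor:
  "functor_iso R F G \<Longrightarrow> functor_module R F \<Longrightarrow> functor_iso R G F"
  by (erule functor_iso_sym) (rule functor_module_group farr_closed; assumption)+

section \<open>Stability of the functors that preserve direct limits\<close>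

context limit_diagram
begin

abbreviation preserved :: "('r, 'u, 'b) functr \<Rightarrow> bool" where
  "preserved \<equiv> preserves_limit_elements R I r S s L c"

lemma preservedI:
  assumes "\<And>y. y \<in> carrier (fobj F L) \<Longrightarrow> \<exists>i\<in>I. \<exists>x\<in>carrier (fobj F (S i)). farr F (S i) L (c i) x = y"
    and "\<And>i x. i \<in> I \<Longrightarrow> x \<in> carrier (fobj F (S i)) \<Longrightarrow> farr F (S i) L (c i) x = \<one>\<^bsub>fobj F L\<^esub> \<Longrightarrow>
        \<exists>k. (i, k) \<in> r \<and> farr F (S i) (S k) (s i k) x = \<one>\<^bsub>fobj F (S k)\<^esub>"
  shows "preserved F"
  unfolding preserves_limit_elements_def using assms by blast

lemma preserved_surj:
  assumes "preserved F" "y \<in> carrier (fobj F L)"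
  obtains i x where "i \<in> I" "x \<in> carrier (fobj F (S i))" "farr F (S i) L (c i) x = y"
  using assms unfolding preserves_limit_elements_def by blast

lemma preserved_inj:
  assumes "preserved F" "i \<in> I" "x \<in> carrier (fobj F (S i))" "farr F (S i) L (c i) x = \<one>\<^bsub>fobj F L\<^esub>"
  obtains k where "(i, k) \<in> r" "farr F (S i) (S k) (s i k) x = \<one>\<^bsub>fobj F (S k)\<^esub>"
  using assms unfolding preserves_limit_elements_def by blast

lemma farr_c_closed:
  assumes "functor_module R F" "i \<in> I" "x \<in> carrier (fobj F (S i))"
  shows "farr F (S i) L (c i) x \<in> carrier (fobj F L)"
  by (rule farr_closed[OF assms(1) module_S[OF assms(2)] module_L c_linear[OF assms(2)] assms(3)])

lemma farr_s_closed:
  assumes "functor_module R F" "(i, k) \<in> r" "x \<in> carrier (fobj F (S i))"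
  shows "farr F (S i) (S k) (s i k) x \<in> carrier (fobj F (S k))"
  using farr_closed[OF assms(1) module_S module_S s_linear assms(3)] index assms(2) by blast

lemma farr_s_comp:
  assumes "functor_module R F" "(i, j) \<in> r" "(j, k) \<in> r" "x \<in> carrier (fobj F (S i))"
  shows "farr F (S i) (S k) (s i k) x = farr F (S j) (S k) (s j k) (farr F (S i) (S j) (s i j) x)"
  using group_system.comp[OF group_cocone.axioms(1)[OF functor_cocone[OF assms(1)]] assms(2-4)] .

lemma farr_c_comp:
  assumes "functor_module R F" "(i, j) \<in> r" "x \<in> carrier (fobj F (S i))"
  shows "farr F (S j) L (c j) (farr F (S i) (S j) (s i j) x) = farr F (S i) L (c i) x"
  using group_cocone.compat[OF functor_cocone[OF assms(1)] assms(2-3)] .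

lemma preserved_iso:
  assumes F: "functor_module R F" and iso: "functor_iso R F K"
    and grp: "\<And>S. left_module R S \<Longrightarrow> group (fobj K S)" and K: "preserved K"
  shows "preserved F"
proof -
  obtain \<eta> where \<eta>: "nat_trans R F K \<eta>"
    and bij: "\<And>S. left_module R S \<Longrightarrow> bij_betw (\<eta> S) (carrier (fobj F S)) (carrier (fobj K S))"
    using functor_isoE[OF iso] by blast
  have inj: "x = y" if "left_module R T" "x \<in> carrier (fobj F T)" "y \<in> carrier (fobj F T)" "\<eta> T x = \<eta> T y" for T x y
    using bij[OF that(1)] that(2-) unfolding bij_betw_def by (meson inj_onD)
  have one: "\<eta> T \<one>\<^bsub>fobj F T\<^esub> = \<one>\<^bsub>fobj K T\<^esub>" if "left_module R T" for T
    by (rule nat_trans_one[OF \<eta> that functor_module_group[OF F that] grp[OF that]])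
  show ?thesis
  proof (rule preservedI)
    fix y assume y: "y \<in> carrier (fobj F L)"
    then obtain i x' where i: "i \<in> I" and x': "x' \<in> carrier (fobj K (S i))" "farr K (S i) L (c i) x' = \<eta> L y"
      using preserved_surj[OF K nat_transD(2)[OF \<eta> module_L y]] by blast
    have "x' \<in> \<eta> (S i) ` carrier (fobj F (S i))"
      using x'(1) bij_betw_imp_surj_on[OF bij[OF module_S[OF i]]] by simp
    then obtain x where x: "x \<in> carrier (fobj F (S i))" "\<eta> (S i) x = x'" by blast
    have "\<eta> L (farr F (S i) L (c i) x) = \<eta> L y"
      using nat_transD(4)[OF \<eta> module_S[OF i] module_L c_linear[OF i] x(1)] x x' by simp
    then show "\<exists>i\<in>I. \<exists>x\<in>carrier (fobj F (S i)). farr F (S i) L (c i) x = y"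
      using inj[OF module_L] y farr_c_closed[OF F i x(1)] i x(1) by blast
  next
    fix i x assume i: "i \<in> I" and x: "x \<in> carrier (fobj F (S i))" and 1: "farr F (S i) L (c i) x = \<one>\<^bsub>fobj F L\<^esub>"
    have "farr K (S i) L (c i) (\<eta> (S i) x) = \<one>\<^bsub>fobj K L\<^esub>"
      using nat_transD(4)[OF \<eta> module_S[OF i] module_L c_linear[OF i] x] 1 one[OF module_L] by simp
    then obtain k where k: "(i, k) \<in> r" "farr K (S i) (S k) (s i k) (\<eta> (S i) x) = \<one>\<^bsub>fobj K (S k)\<^esub>"
      using preserved_inj[OF K i nat_transD(2)[OF \<eta> module_S[OF i] x]] by blast
    have mk: "left_module R (S k)" by (rule module_S[OF index(2)[OF k(1)]])
    interpret k: group "fobj F (S k)" by (rule functor_module_group[OF F mk])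
    have "\<eta> (S k) (farr F (S i) (S k) (s i k) x) = \<eta> (S k) \<one>\<^bsub>fobj F (S k)\<^esub>"
      using nat_transD(4)[OF \<eta> module_S[OF i] mk s_linear[OF k(1)] x] k(2) one[OF mk] by simp
    then show "\<exists>k. (i, k) \<in> r \<and> farr F (S i) (S k) (s i k) x = \<one>\<^bsub>fobj F (S k)\<^esub>"
      using inj[OF mk farr_s_closed[OF F k(1) x] k.one_closed] k(1) by blast
  qed
qed

text \<open>
  Surjectivity is the point where a later stage is needed: a preimage \<open>x\<close> of an element of the kernel
  need not lie in the kernel, but \<open>\<eta> x\<close> vanishes in the limit, hence at a later stage.
\<close>

lemma preserved_kernel:
  assumes F: "functor_module R F" "preserved F" and G: "functor_module R G" "preserved G"
    and \<eta>: "nat_trans R F G \<eta>"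
  shows "preserved (kernel_functor F G \<eta>)"
proof (rule preservedI)
  fix y assume "y \<in> carrier (fobj (kernel_functor F G \<eta>) L)"
  then have y: "y \<in> carrier (fobj F L)" "\<eta> L y = \<one>\<^bsub>fobj G L\<^esub>"
    by (auto simp: kernel_functor_def kernel_def)
  then obtain i x where i: "i \<in> I" and x: "x \<in> carrier (fobj F (S i))" "farr F (S i) L (c i) x = y"
    using preserved_surj[OF F(2)] y(1) by blast
  have "farr G (S i) L (c i) (\<eta> (S i) x) = \<one>\<^bsub>fobj G L\<^esub>"
    using nat_transD(4)[OF \<eta> module_S[OF i] module_L c_linear[OF i] x(1)] x y by simp
  then obtain k where k: "(i, k) \<in> r" "farr G (S i) (S k) (s i k) (\<eta> (S i) x) = \<one>\<^bsub>fobj G (S k)\<^esub>"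
    using preserved_inj[OF G(2) i nat_transD(2)[OF \<eta> module_S[OF i] x(1)]] by blast
  have kI: "k \<in> I" by (rule index(2)[OF k(1)])
  have "\<eta> (S k) (farr F (S i) (S k) (s i k) x) = \<one>\<^bsub>fobj G (S k)\<^esub>"
    using nat_transD(4)[OF \<eta> module_S[OF i] module_S[OF kI] s_linear[OF k(1)] x(1)] k(2) by simp
  then have "farr F (S i) (S k) (s i k) x \<in> carrier (fobj (kernel_functor F G \<eta>) (S k))"
    using farr_s_closed[OF F(1) k(1) x(1)] by (simp add: kernel_functor_def kernel_def)
  moreover have "farr (kernel_functor F G \<eta>) (S k) L (c k) (farr F (S i) (S k) (s i k) x) = y"
    using farr_c_comp[OF F(1) k(1) x(1)] x(2) by (simp add: kernel_functor_def)
  ultimately show "\<exists>i\<in>I. \<exists>x\<in>carrier (fobj (kernel_functor F G \<eta>) (S i)).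
      farr (kernel_functor F G \<eta>) (S i) L (c i) x = y"
    using kI by blast
next
  fix i x assume "i \<in> I" "x \<in> carrier (fobj (kernel_functor F G \<eta>) (S i))"
    "farr (kernel_functor F G \<eta>) (S i) L (c i) x = \<one>\<^bsub>fobj (kernel_functor F G \<eta>) L\<^esub>"
  then show "\<exists>k. (i, k) \<in> r \<and> farr (kernel_functor F G \<eta>) (S i) (S k) (s i k) x
      = \<one>\<^bsub>fobj (kernel_functor F G \<eta>) (S k)\<^esub>"
    using preserved_inj[OF F(2), of i x] by (auto simp: kernel_functor_def kernel_def)
qed

end

text \<open>
  With the cosets written as \<open>N #> g\<close>, the maps between quotients are computed on representatives.
\<close>

lemma quotient_map_coset:
  assumes G: "group G" and N: "subgroup N G" and G': "comm_group G'" and N': "subgroup N' G'"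
    and h: "h \<in> hom G G'" and sub: "h ` N \<subseteq> N'" and g: "g \<in> carrier G"
  shows "quotient_map G' N' h (N #>\<^bsub>G\<^esub> g) = N' #>\<^bsub>G'\<^esub> h g"
proof -
  interpret G: group G by (rule G)
  interpret G': comm_group G' by (rule G')
  interpret N: subgroup N G by (rule N)
  interpret N': subgroup N' G' by (rule N')
  interpret h: group_hom G G' h by (simp add: group_hom_def group_hom_axioms_def G.is_group G'.is_group h)
  have "n' \<otimes>\<^bsub>G'\<^esub> h (n \<otimes>\<^bsub>G\<^esub> g) \<in> N' #>\<^bsub>G'\<^esub> h g" if "n' \<in> N'" "n \<in> N" for n n'
  proof -
    have "n' \<otimes>\<^bsub>G'\<^esub> h n \<in> N'" using that sub by blast
    moreover have "n' \<otimes>\<^bsub>G'\<^esub> h (n \<otimes>\<^bsub>G\<^esub> g) = (n' \<otimes>\<^bsub>G'\<^esub> h n) \<otimes>\<^bsub>G'\<^esub> h g"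
      using that g by (simp add: G'.m_assoc N'.mem_carrier)
    ultimately show ?thesis unfolding r_coset_def by blast
  qed
  moreover have "n' \<otimes>\<^bsub>G'\<^esub> h g \<in> N' <#>\<^bsub>G'\<^esub> (h ` (N #>\<^bsub>G\<^esub> g))" if "n' \<in> N'" for n'
  proof -
    have "g \<in> N #>\<^bsub>G\<^esub> g" using g N by (rule G.rcos_self)
    then show ?thesis using that unfolding set_mult_def by blast
  qed
  ultimately show ?thesis
    unfolding quotient_map_def by (auto simp: set_mult_def r_coset_def)
qed

lemma (in group) coset_eq_iff:
  assumes "subgroup N G" "x \<in> carrier G" "y \<in> carrier G"
  shows "N #> x = N #> y \<longleftrightarrow> x \<otimes> inv y \<in> N"
  using assms by (metis rcos_self repr_independence subgroup.rcos_module is_group)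

lemma (in group) coset_eq_subgroup_iff:
  assumes "subgroup N G" "x \<in> carrier G"
  shows "N #> x = N \<longleftrightarrow> x \<in> N"
  using assms coset_join1 coset_join2 by (metis rcos_self)

lemma image_subgroup:
  assumes "nat_trans R F G \<eta>" "functor_module R F" "functor_module R G" "left_module R S"
  shows "subgroup (\<eta> S ` carrier (fobj F S)) (fobj G S)"
proof -
  interpret group_hom "fobj F S" "fobj G S" "\<eta> S"
    using assms by (simp add: group_hom_def group_hom_axioms_def functor_module_group nat_transD(1))
  show ?thesis by (rule img_is_subgroup)
qed

lemma cokernel_functor_fobj:
  "fobj (cokernel_functor F G \<eta>) S = fobj G S Mod (\<eta> S ` carrier (fobj F S))"
  by (simp add: cokernel_functor_def)

lemma cokernel_functor_farr:
  assumes "nat_trans R F G \<eta>" "functor_module R F" "functor_module R G"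
    "left_module R S" "left_module R T" "f \<in> linear_maps R S T" "x \<in> carrier (fobj G S)"
  shows "farr (cokernel_functor F G \<eta>) S T f (\<eta> S ` carrier (fobj F S) #>\<^bsub>fobj G S\<^esub> x) =
    \<eta> T ` carrier (fobj F T) #>\<^bsub>fobj G T\<^esub> farr G S T f x"
proof -
  have "farr G S T f ` (\<eta> S ` carrier (fobj F S)) \<subseteq> \<eta> T ` carrier (fobj F T)"
    using nat_transD(4)[OF assms(1,4,5,6), symmetric] farr_closed[OF assms(2,4,5,6)] by auto
  then have "quotient_map (fobj G T) (\<eta> T ` carrier (fobj F T)) (farr G S T f)
      (\<eta> S ` carrier (fobj F S) #>\<^bsub>fobj G S\<^esub> x) = \<eta> T ` carrier (fobj F T) #>\<^bsub>fobj G T\<^esub> farr G S T f x"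
    by (rule quotient_map_coset[OF functor_module_group[OF assms(3,4)] image_subgroup[OF assms(1-4)]
          functor_moduleD(1)[OF assms(3,5)] image_subgroup[OF assms(1-3,5)]
          functor_moduleD(2)[OF assms(3-6)] _ assms(7)])
  then show ?thesis by (simp add: cokernel_functor_def)
qed

context limit_diagram
begin

text \<open>
  If \<open>x\<close> becomes \<open>\<eta> f\<close> in the limit, then \<open>f\<close> comes from an element \<open>f'\<close> of some stage, and the quotient
  of \<open>x\<close> by \<open>\<eta> f'\<close> at a common stage vanishes in the limit, hence later. From then on \<open>x\<close> lies in the
  image of \<open>\<eta>\<close>.
\<close>

lemma preserved_cokernel:
  assumes F: "functor_module R F" "preserved F" and G: "functor_module R G" "preserved G"
    and \<eta>: "nat_trans R F G \<eta>"
  shows "preserved (cokernel_functor F G \<eta>)"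
proof (rule preservedI)
  let ?N = "\<lambda>T. \<eta> T ` carrier (fobj F T)"
  note farr_coker = cokernel_functor_farr[OF \<eta> F(1) G(1)]
  fix y assume "y \<in> carrier (fobj (cokernel_functor F G \<eta>) L)"
  then obtain g where g: "g \<in> carrier (fobj G L)" "y = ?N L #>\<^bsub>fobj G L\<^esub> g"
    by (auto simp: cokernel_functor_fobj carrier_FactGroup)
  then obtain i x where i: "i \<in> I" and x: "x \<in> carrier (fobj G (S i))" "farr G (S i) L (c i) x = g"
    using G(2) preserved_surj by metis
  have "farr (cokernel_functor F G \<eta>) (S i) L (c i) (?N (S i) #>\<^bsub>fobj G (S i)\<^esub> x) = y"
    using farr_coker[OF module_S[OF i] module_L c_linear[OF i] x(1)] x g by simp
  moreover have "?N (S i) #>\<^bsub>fobj G (S i)\<^esub> x \<in> carrier (fobj (cokernel_functor F G \<eta>) (S i))"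
    using x(1) by (auto simp: cokernel_functor_fobj carrier_FactGroup)
  ultimately show "\<exists>i\<in>I. \<exists>x\<in>carrier (fobj (cokernel_functor F G \<eta>) (S i)).
      farr (cokernel_functor F G \<eta>) (S i) L (c i) x = y"
    using i by blast
next
  let ?N = "\<lambda>T. \<eta> T ` carrier (fobj F T)"
  note farr_coker = cokernel_functor_farr[OF \<eta> F(1) G(1)]
  fix i z assume i: "i \<in> I" and "z \<in> carrier (fobj (cokernel_functor F G \<eta>) (S i))"
    and 1: "farr (cokernel_functor F G \<eta>) (S i) L (c i) z = \<one>\<^bsub>fobj (cokernel_functor F G \<eta>) L\<^esub>"
  then obtain x where x: "x \<in> carrier (fobj G (S i))" and z: "z = ?N (S i) #>\<^bsub>fobj G (S i)\<^esub> x"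
    by (auto simp: cokernel_functor_fobj carrier_FactGroup)
  note mi = module_S[OF i]
  interpret GL: group "fobj G L" by (rule functor_module_group[OF G(1) module_L])
  have "?N L #>\<^bsub>fobj G L\<^esub> farr G (S i) L (c i) x = ?N L"
    using 1 farr_coker[OF mi module_L c_linear[OF i] x] z by (simp add: cokernel_functor_fobj)
  then have "farr G (S i) L (c i) x \<in> ?N L"
    using GL.coset_eq_subgroup_iff[OF image_subgroup[OF \<eta> F(1) G(1) module_L] farr_c_closed[OF G(1) i x]] by simp
  then obtain f where f: "f \<in> carrier (fobj F L)" "farr G (S i) L (c i) x = \<eta> L f" by blast
  then obtain j x' where j: "j \<in> I" and x': "x' \<in> carrier (fobj F (S j))" "farr F (S j) L (c j) x' = f"
    using F(2) preserved_surj by metis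
  obtain k where k: "(i, k) \<in> r" "(j, k) \<in> r" using upper[OF i j] .
  have kI: "k \<in> I" by (rule index(2)[OF k(1)])
  note mk = module_S[OF kI]
  let ?x = "farr G (S i) (S k) (s i k) x" and ?x' = "farr F (S j) (S k) (s j k) x'"
  have xk: "?x \<in> carrier (fobj G (S k))" by (rule farr_s_closed[OF G(1) k(1) x])
  have xk': "?x' \<in> carrier (fobj F (S k))" by (rule farr_s_closed[OF F(1) k(2) x'(1)])
  have \<eta>k: "\<eta> (S k) ?x' \<in> carrier (fobj G (S k))" by (rule nat_transD(2)[OF \<eta> mk xk'])
  interpret Gk: group_hom "fobj G (S k)" "fobj G L" "farr G (S k) L (c k)"
    by (rule farr_group_hom[OF G(1) mk module_L c_linear[OF kI]])
  let ?d = "?x \<otimes>\<^bsub>fobj G (S k)\<^esub> inv\<^bsub>fobj G (S k)\<^esub> \<eta> (S k) ?x'"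
  have d: "?d \<in> carrier (fobj G (S k))" using xk \<eta>k by simp
  have "farr G (S k) L (c k) ?x = \<eta> L f"
    using farr_c_comp[OF G(1) k(1) x] f by simp
  moreover have "farr G (S k) L (c k) (\<eta> (S k) ?x') = \<eta> L f"
    using nat_transD(4)[OF \<eta> mk module_L c_linear[OF kI] xk'] farr_c_comp[OF F(1) k(2) x'(1)] x' by simp
  ultimately have "farr G (S k) L (c k) ?d = \<one>\<^bsub>fobj G L\<^esub>"
    using xk \<eta>k nat_transD(2)[OF \<eta> module_L f(1)] by simp
  then obtain l where l: "(k, l) \<in> r" "farr G (S k) (S l) (s k l) ?d = \<one>\<^bsub>fobj G (S l)\<^esub>"
    using preserved_inj[OF G(2) kI d] by blast
  have lI: "l \<in> I" by (rule index(2)[OF l(1)])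
  note ml = module_S[OF lI]
  interpret Gl: group_hom "fobj G (S k)" "fobj G (S l)" "farr G (S k) (S l) (s k l)"
    by (rule farr_group_hom[OF G(1) mk ml s_linear[OF l(1)]])
  let ?x'' = "farr F (S k) (S l) (s k l) ?x'"
  have xl: "?x'' \<in> carrier (fobj F (S l))" by (rule farr_s_closed[OF F(1) l(1) xk'])
  have "farr G (S k) (S l) (s k l) ?x = farr G (S k) (S l) (s k l) (\<eta> (S k) ?x')"
    using l(2) xk \<eta>k by (simp add: Gl.H.inv_solve_right')
  then have "farr G (S i) (S l) (s i l) x = \<eta> (S l) ?x''"
    using farr_s_comp[OF G(1) k(1) l(1) x] nat_transD(4)[OF \<eta> mk ml s_linear[OF l(1)] xk'] by simp
  then have mem: "farr G (S i) (S l) (s i l) x \<in> ?N (S l)" using xl by blast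
  have il: "(i, l) \<in> r" using trans[OF k(1) l(1)] .
  have "farr (cokernel_functor F G \<eta>) (S i) (S l) (s i l) z = ?N (S l)"
    unfolding z farr_coker[OF mi ml s_linear[OF il] x]
    using Gl.H.coset_eq_subgroup_iff[OF image_subgroup[OF \<eta> F(1) G(1) ml] farr_s_closed[OF G(1) il x]] mem by simp
  then show "\<exists>k. (i, k) \<in> r \<and> farr (cokernel_functor F G \<eta>) (S i) (S k) (s i k) z
      = \<one>\<^bsub>fobj (cokernel_functor F G \<eta>) (S k)\<^esub>"
    using il by (auto simp: cokernel_functor_fobj)
qed

lemma preserved_direct_sum:
  assumes F: "functor_module R F" "preserved F" and G: "functor_module R G" "preserved G"
  shows "preserved (direct_sum_functor F G)"
proof (rule preservedI)
  fix y assume "y \<in> carrier (fobj (direct_sum_functor F G) L)"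
  then obtain u v where y: "y = (u, v)" "u \<in> carrier (fobj F L)" "v \<in> carrier (fobj G L)"
    by (auto simp: direct_sum_functor_def DirProd_def)
  obtain i x where i: "i \<in> I" and x: "x \<in> carrier (fobj F (S i))" "farr F (S i) L (c i) x = u"
    using preserved_surj[OF F(2) y(2)] .
  obtain j z where j: "j \<in> I" and z: "z \<in> carrier (fobj G (S j))" "farr G (S j) L (c j) z = v"
    using preserved_surj[OF G(2) y(3)] .
  obtain k where k: "(i, k) \<in> r" "(j, k) \<in> r" using upper[OF i j] .
  let ?p = "(farr F (S i) (S k) (s i k) x, farr G (S j) (S k) (s j k) z)"
  have "?p \<in> carrier (fobj (direct_sum_functor F G) (S k))"
    using farr_s_closed[OF F(1) k(1) x(1)] farr_s_closed[OF G(1) k(2) z(1)]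
    by (simp add: direct_sum_functor_def DirProd_def)
  moreover have "farr (direct_sum_functor F G) (S k) L (c k) ?p = y"
    using farr_c_comp[OF F(1) k(1) x(1)] farr_c_comp[OF G(1) k(2) z(1)] x z y
    by (simp add: direct_sum_functor_def)
  ultimately show "\<exists>i\<in>I. \<exists>x\<in>carrier (fobj (direct_sum_functor F G) (S i)).
      farr (direct_sum_functor F G) (S i) L (c i) x = y"
    using index(2)[OF k(1)] by blast
next
  fix i y assume i: "i \<in> I" and y: "y \<in> carrier (fobj (direct_sum_functor F G) (S i))"
    and 1: "farr (direct_sum_functor F G) (S i) L (c i) y = \<one>\<^bsub>fobj (direct_sum_functor F G) L\<^esub>"
  obtain u v where uv: "y = (u, v)" "u \<in> carrier (fobj F (S i))" "v \<in> carrier (fobj G (S i))"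
    using y by (auto simp: direct_sum_functor_def DirProd_def)
  have "farr F (S i) L (c i) u = \<one>\<^bsub>fobj F L\<^esub>" "farr G (S i) L (c i) v = \<one>\<^bsub>fobj G L\<^esub>"
    using 1 uv by (auto simp: direct_sum_functor_def DirProd_def)
  then obtain k l where k: "(i, k) \<in> r" "farr F (S i) (S k) (s i k) u = \<one>\<^bsub>fobj F (S k)\<^esub>"
    and l: "(i, l) \<in> r" "farr G (S i) (S l) (s i l) v = \<one>\<^bsub>fobj G (S l)\<^esub>"
    using preserved_inj[OF F(2) i uv(2)] preserved_inj[OF G(2) i uv(3)] by metis
  obtain m where m: "(k, m) \<in> r" "(l, m) \<in> r" using upper[OF index(2)[OF k(1)] index(2)[OF l(1)]] .
  interpret Fm: group_hom "fobj F (S k)" "fobj F (S m)" "farr F (S k) (S m) (s k m)"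
    by (rule farr_group_hom[OF F(1) module_S[OF index(1)[OF m(1)]] module_S[OF index(2)[OF m(1)]] s_linear[OF m(1)]])
  interpret Gm: group_hom "fobj G (S l)" "fobj G (S m)" "farr G (S l) (S m) (s l m)"
    by (rule farr_group_hom[OF G(1) module_S[OF index(1)[OF m(2)]] module_S[OF index(2)[OF m(2)]] s_linear[OF m(2)]])
  have "farr F (S i) (S m) (s i m) u = \<one>\<^bsub>fobj F (S m)\<^esub>"
    using farr_s_comp[OF F(1) k(1) m(1) uv(2)] k(2) by simp
  moreover have "farr G (S i) (S m) (s i m) v = \<one>\<^bsub>fobj G (S m)\<^esub>"
    using farr_s_comp[OF G(1) l(1) m(2) uv(3)] l(2) by simp
  ultimately show "\<exists>k. (i, k) \<in> r \<and> farr (direct_sum_functor F G) (S i) (S k) (s i k) y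
      = \<one>\<^bsub>fobj (direct_sum_functor F G) (S k)\<^esub>"
    using trans[OF k(1) m(1)] uv by (auto simp: direct_sum_functor_def DirProd_def)
qed

lemma preserved_ring_functor: "preserved ring_functor"
proof (rule preservedI)
  fix y assume "y \<in> carrier (fobj ring_functor L)"
  then have "y \<in> carrier L" by (simp add: ring_functor_def)
  then obtain i x where "i \<in> I" "x \<in> carrier (S i)" "c i x = y" by (rule lim_surj)
  then show "\<exists>i\<in>I. \<exists>x\<in>carrier (fobj ring_functor (S i)). farr ring_functor (S i) L (c i) x = y"
    by (auto simp: ring_functor_def)
next
  fix i x assume "i \<in> I" "x \<in> carrier (fobj ring_functor (S i))"
    "farr ring_functor (S i) L (c i) x = \<one>\<^bsub>fobj ring_functor L\<^esub>"
  then have "i \<in> I" "x \<in> carrier (S i)" "c i x = \<zero>\<^bsub>L\<^esub>" by (simp_all add: ring_functor_def)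
  then obtain k where "(i, k) \<in> r" "s i k x = \<zero>\<^bsub>S k\<^esub>" by (rule lim_inj)
  then show "\<exists>k. (i, k) \<in> r \<and> farr ring_functor (S i) (S k) (s i k) x = \<one>\<^bsub>fobj ring_functor (S k)\<^esub>"
    by (auto simp: ring_functor_def)
qed

end

lemma functor_module_ring_functor: "functor_module R ring_functor"
  unfolding functor_module_def ring_functor_def functr.simps additive_group_sel
  by (intro conjI allI impI ballI comm_group_additive_group[OF left_moduleD(2)] linear_maps_hom)
     (assumption | simp add: linear_id_def compose_def linear_add_def)+

subsection \<open>Direct limits of functors\<close>

locale functor_diagram =
  fixes R :: "('r, 'k) ring_scheme" and I :: "'i set" and r and F :: "'i \<Rightarrow> ('r, 'u, 'b) functr" and \<tau>
  assumes directed: "directed_set I r" and system: "functor_system R I r F \<tau>"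
begin

lemma index: "(i, j) \<in> r \<Longrightarrow> i \<in> I" "(i, j) \<in> r \<Longrightarrow> j \<in> I"
  using directed unfolding directed_set_def preorder_on_def by auto

lemma functors: "i \<in> I \<Longrightarrow> functor_module R (F i)"
  using system unfolding functor_system_def by blast

lemma transitions: "(i, j) \<in> r \<Longrightarrow> nat_trans R (F i) (F j) (\<tau> i j)"
  using system unfolding functor_system_def by blast

lemma group_system_at:
  assumes S: "left_module R S"
  shows "group_system I r (\<lambda>i. fobj (F i) S) (\<lambda>i j. \<tau> i j S)"
proof (rule group_system.intro)
  show "group (fobj (F i) S)" if "i \<in> I" for i by (rule functor_module_group[OF functors[OF that] S])
  show "\<tau> i j S \<in> hom (fobj (F i) S) (fobj (F j) S)" if "(i, j) \<in> r" for i j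
    by (rule nat_transD(1)[OF transitions[OF that] S])
  show "\<tau> i i S x = x" if "i \<in> I" "x \<in> carrier (fobj (F i) S)" for i x
    using system S that unfolding functor_system_def by blast
  show "\<tau> i k S x = \<tau> j k S (\<tau> i j S x)"
    if "(i, j) \<in> r" "(j, k) \<in> r" "x \<in> carrier (fobj (F i) S)" for i j k x
    using system S that unfolding functor_system_def by blast
qed (rule directed)

lemma fobj_limit: "fobj (limit_functor I r F \<tau>) S = lim_group I r (\<lambda>i. fobj (F i) S) (\<lambda>i j. \<tau> i j S)"
  by (simp add: limit_functor_def)

definition lcls :: "('r, 'u) module \<Rightarrow> 'i \<Rightarrow> 'b \<Rightarrow> ('i \<times> 'b) set" where
  "lcls S = group_system.cls I r (\<lambda>i. fobj (F i) S) (\<lambda>i j. \<tau> i j S)"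

lemma limit_elem:
  assumes "left_module R S" "y \<in> carrier (fobj (limit_functor I r F \<tau>) S)"
  obtains i x where "i \<in> I" "x \<in> carrier (fobj (F i) S)" "y = lcls S i x"
  using assms(2) that
  unfolding fobj_limit group_system.carrier_lim_group[OF group_system_at[OF assms(1)]] lcls_def by blast

lemma lcls_closed:
  assumes "left_module R S" "i \<in> I" "x \<in> carrier (fobj (F i) S)"
  shows "lcls S i x \<in> carrier (fobj (limit_functor I r F \<tau>) S)"
  unfolding fobj_limit lcls_def
  by (rule group_system.cls_in_carrier[OF group_system_at[OF assms(1)] assms(2,3)])

lemma farr_limit:
  assumes S: "left_module R S" and T: "left_module R T" and f: "f \<in> linear_maps R S T"
    and i: "i \<in> I" and x: "x \<in> carrier (fobj (F i) S)"
  shows "farr (limit_functor I r F \<tau>) S T f (lcls S i x) = lcls T i (farr (F i) S T f x)"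
proof -
  interpret S: group_system I r "\<lambda>i. fobj (F i) S" "\<lambda>i j. \<tau> i j S" by (rule group_system_at[OF S])
  interpret T: group_system I r "\<lambda>i. fobj (F i) T" "\<lambda>i j. \<tau> i j T" by (rule group_system_at[OF T])
  note fc = farr_closed[OF functors S T f]
  have "T.cls j (farr (F j) S T f y) = T.cls i (farr (F i) S T f x)" if m: "(j, y) \<in> S.cls i x" for j y
  proof -
    obtain k where k: "(i, k) \<in> r" "(j, k) \<in> r" "y \<in> carrier (fobj (F j) S)" "\<tau> i k S x = \<tau> j k S y"
      using m unfolding S.mem_cls_iff by (rule S.lim_relE) auto
    have "T.cls j (farr (F j) S T f y) = T.cls k (farr (F k) S T f (\<tau> j k S y))"
      using T.cls_push[OF k(2) fc[OF index(1)[OF k(2)] k(3)]] nat_transD(4)[OF transitions[OF k(2)] S T f k(3)] by simp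
    also have "\<dots> = T.cls i (farr (F i) S T f x)"
      using T.cls_push[OF k(1) fc[OF i x]] nat_transD(4)[OF transitions[OF k(1)] S T f x] k(4) by simp
    finally show ?thesis .
  qed
  then have sub: "T.cls j z = T.cls i (farr (F i) S T f x)"
    if "(j, z) \<in> (\<lambda>(i, x). (i, farr (F i) S T f x)) ` S.cls i x" for j z
    using that by auto
  have mem: "(i, farr (F i) S T f x) \<in> (\<lambda>(i, x). (i, farr (F i) S T f x)) ` S.cls i x"
    using S.self_mem_cls[OF i x] by force
  have "lim_rel I r (\<lambda>i. fobj (F i) T) (\<lambda>i j. \<tau> i j T) `` ((\<lambda>(i, x). (i, farr (F i) S T f x)) ` S.cls i x)
      = (\<Union>(j, z)\<in>(\<lambda>(i, x). (i, farr (F i) S T f x)) ` S.cls i x. T.cls j z)"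
    unfolding T.cls_def by auto
  also have "\<dots> = T.cls i (farr (F i) S T f x)"
  proof
    show "(\<Union>(j, z)\<in>(\<lambda>(i, x). (i, farr (F i) S T f x)) ` S.cls i x. T.cls j z) \<subseteq> T.cls i (farr (F i) S T f x)"
      using sub by fast
    show "T.cls i (farr (F i) S T f x) \<subseteq> (\<Union>(j, z)\<in>(\<lambda>(i, x). (i, farr (F i) S T f x)) ` S.cls i x. T.cls j z)"
      using mem by (intro UN_upper[THEN order_trans[rotated]]) auto
  qed
  finally show ?thesis unfolding lcls_def by (simp add: limit_functor_def)
qed

lemma lcls_eq_one_iff:
  "left_module R S \<Longrightarrow> i \<in> I \<Longrightarrow> x \<in> carrier (fobj (F i) S) \<Longrightarrow>
   lcls S i x = \<one>\<^bsub>fobj (limit_functor I r F \<tau>) S\<^esub> \<longleftrightarrow> (\<exists>k. (i, k) \<in> r \<and> \<tau> i k S x = \<one>\<^bsub>fobj (F k) S\<^esub>)"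
  unfolding lcls_def fobj_limit by (rule group_system.cls_eq_one_iff[OF group_system_at])

lemma group_limit: "left_module R S \<Longrightarrow> group (fobj (limit_functor I r F \<tau>) S)"
  unfolding fobj_limit by (rule group_system.group_lim_group[OF group_system_at])

lemma farr_limit_closed:
  assumes "left_module R S" "left_module R T" "f \<in> linear_maps R S T"
    "y \<in> carrier (fobj (limit_functor I r F \<tau>) S)"
  shows "farr (limit_functor I r F \<tau>) S T f y \<in> carrier (fobj (limit_functor I r F \<tau>) T)"
proof -
  obtain i x where i: "i \<in> I" "x \<in> carrier (fobj (F i) S)" "y = lcls S i x"
    using assms(1,4) by (rule limit_elem)
  show ?thesis
    unfolding i(3) farr_limit[OF assms(1-3) i(1,2)]
    by (rule lcls_closed[OF assms(2) i(1) farr_closed[OF functors[OF i(1)] assms(1-3) i(2)]])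
qed

text \<open>
  A cocone of natural transformations is a direct limit as soon as it is one at each module, element
  by element.
\<close>

lemma limit_functor_iso:
  assumes G: "functor_module R G"
    and legs: "\<And>i. i \<in> I \<Longrightarrow> nat_trans R (F i) G (c i)"
    and compat: "\<And>i j S x. (i, j) \<in> r \<Longrightarrow> left_module R S \<Longrightarrow> x \<in> carrier (fobj (F i) S) \<Longrightarrow>
      c j S (\<tau> i j S x) = c i S x"
    and surj: "\<And>S y. left_module R S \<Longrightarrow> y \<in> carrier (fobj G S) \<Longrightarrow>
      \<exists>i\<in>I. \<exists>x\<in>carrier (fobj (F i) S). c i S x = y"
    and inj: "\<And>S i x. left_module R S \<Longrightarrow> i \<in> I \<Longrightarrow> x \<in> carrier (fobj (F i) S) \<Longrightarrow>
      c i S x = \<one>\<^bsub>fobj G S\<^esub> \<Longrightarrow> \<exists>k. (i, k) \<in> r \<and> \<tau> i k S x = \<one>\<^bsub>fobj (F k) S\<^esub>"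
  shows "functor_iso R (limit_functor I r F \<tau>) G"
proof -
  have cocone: "group_cocone I r (\<lambda>i. fobj (F i) S) (\<lambda>i j. \<tau> i j S) (fobj G S) (\<lambda>i. c i S)"
    if S: "left_module R S" for S
    by (intro group_cocone.intro group_cocone_axioms.intro group_system_at[OF S] functor_module_group[OF G S]
        nat_transD(1)[OF legs S] compat[OF _ S])
  define \<eta> where "\<eta> S = lim_map (\<lambda>i. c i S)" for S
  have \<eta>_iso: "\<eta> S \<in> iso (fobj (limit_functor I r F \<tau>) S) (fobj G S)" if S: "left_module R S" for S
    unfolding \<eta>_def fobj_limit group_cocone.lim_map_iso_iff[OF cocone[OF S]] using surj[OF S] inj[OF S] by blast
  have \<eta>_cls: "\<eta> S (lcls S i x) = c i S x" if "left_module R S" "i \<in> I" "x \<in> carrier (fobj (F i) S)" for S i x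
    unfolding \<eta>_def lcls_def by (rule group_cocone.lim_map_cls[OF cocone[OF that(1)] that(2,3)])
  have "nat_trans R (limit_functor I r F \<tau>) G \<eta>"
    unfolding nat_trans_def
  proof (intro conjI allI impI ballI)
    show "\<eta> S \<in> hom (fobj (limit_functor I r F \<tau>) S) (fobj G S)" if "left_module R S" for S
      using \<eta>_iso[OF that] by (simp add: iso_def)
    fix S T f y assume S: "left_module R S" and T: "left_module R T" and f: "f \<in> linear_maps R S T"
      and "y \<in> carrier (fobj (limit_functor I r F \<tau>) S)"
    then obtain i x where i: "i \<in> I" "x \<in> carrier (fobj (F i) S)" "y = lcls S i x"
      using limit_elem by metis
    show "\<eta> T (farr (limit_functor I r F \<tau>) S T f y) = farr G S T f (\<eta> S y)"
      unfolding i(3) farr_limit[OF S T f i(1,2)] \<eta>_cls[OF S i(1,2)]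
        \<eta>_cls[OF T i(1) farr_closed[OF functors[OF i(1)] S T f i(2)]]
      by (rule nat_transD(4)[OF legs[OF i(1)] S T f i(2)])
  qed
  then show ?thesis unfolding functor_iso_def using \<eta>_iso by blast
qed

end

text \<open>
  An element of \<open>F j (S i)\<close> that vanishes in the limit over both indices first vanishes in \<open>F k L\<close> for a
  later \<open>k\<close>, and then, as \<open>F k\<close> preserves the limit \<open>L\<close>, in \<open>F k (S l)\<close> for a later \<open>l\<close>.
\<close>

lemma (in limit_diagram) preserved_limit:
  assumes "functor_diagram R J q F \<tau>" and pres: "\<And>j. j \<in> J \<Longrightarrow> preserved (F j)"
  shows "preserved (limit_functor J q F \<tau>)"
proof -
  interpret D: functor_diagram R J q F \<tau> by (rule assms(1))
  show ?thesis
  proof (rule preservedI)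
    fix y assume "y \<in> carrier (fobj (limit_functor J q F \<tau>) L)"
    with module_L obtain j z where j: "j \<in> J" "z \<in> carrier (fobj (F j) L)" "y = D.lcls L j z"
      by (rule D.limit_elem)
    obtain i x where i: "i \<in> I" and x: "x \<in> carrier (fobj (F j) (S i))" "farr (F j) (S i) L (c i) x = z"
      using preserved_surj[OF pres[OF j(1)] j(2)] .
    have "farr (limit_functor J q F \<tau>) (S i) L (c i) (D.lcls (S i) j x) = y"
      using D.farr_limit[OF module_S[OF i] module_L c_linear[OF i] j(1) x(1)] x(2) j(3) by simp
    then show "\<exists>i\<in>I. \<exists>x\<in>carrier (fobj (limit_functor J q F \<tau>) (S i)).
        farr (limit_functor J q F \<tau>) (S i) L (c i) x = y"
      using i D.lcls_closed[OF module_S[OF i] j(1) x(1)] by blast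
  next
    fix i y assume i: "i \<in> I" and y: "y \<in> carrier (fobj (limit_functor J q F \<tau>) (S i))"
      and 1: "farr (limit_functor J q F \<tau>) (S i) L (c i) y = \<one>\<^bsub>fobj (limit_functor J q F \<tau>) L\<^esub>"
    note mi = module_S[OF i]
    obtain j x where j: "j \<in> J" and x: "x \<in> carrier (fobj (F j) (S i))" and y: "y = D.lcls (S i) j x"
      using mi y by (rule D.limit_elem)
    have "D.lcls L j (farr (F j) (S i) L (c i) x) = \<one>\<^bsub>fobj (limit_functor J q F \<tau>) L\<^esub>"
      using 1 D.farr_limit[OF mi module_L c_linear[OF i] j x] y by simp
    then obtain k where k: "(j, k) \<in> q" "\<tau> j k L (farr (F j) (S i) L (c i) x) = \<one>\<^bsub>fobj (F k) L\<^esub>"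
      using D.lcls_eq_one_iff[OF module_L j farr_c_closed[OF D.functors[OF j] i x]] by blast
    have kJ: "k \<in> J" by (rule D.index(2)[OF k(1)])
    have x': "\<tau> j k (S i) x \<in> carrier (fobj (F k) (S i))"
      by (rule nat_transD(2)[OF D.transitions[OF k(1)] mi x])
    have "farr (F k) (S i) L (c i) (\<tau> j k (S i) x) = \<one>\<^bsub>fobj (F k) L\<^esub>"
      using k(2) nat_transD(4)[OF D.transitions[OF k(1)] mi module_L c_linear[OF i] x] by simp
    then obtain l where l: "(i, l) \<in> r" "farr (F k) (S i) (S l) (s i l) (\<tau> j k (S i) x) = \<one>\<^bsub>fobj (F k) (S l)\<^esub>"
      using preserved_inj[OF pres[OF kJ] i x'] by blast
    note ml = module_S[OF index(2)[OF l(1)]]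
    have "\<tau> j k (S l) (farr (F j) (S i) (S l) (s i l) x) = \<one>\<^bsub>fobj (F k) (S l)\<^esub>"
      using l(2) nat_transD(4)[OF D.transitions[OF k(1)] mi ml s_linear[OF l(1)] x] by simp
    then have "D.lcls (S l) j (farr (F j) (S i) (S l) (s i l) x) = \<one>\<^bsub>fobj (limit_functor J q F \<tau>) (S l)\<^esub>"
      using D.lcls_eq_one_iff[OF ml j farr_s_closed[OF D.functors[OF j] l(1) x]] k(1) by blast
    then show "\<exists>k. (i, k) \<in> r \<and> farr (limit_functor J q F \<tau>) (S i) (S k) (s i k) y
        = \<one>\<^bsub>fobj (limit_functor J q F \<tau>) (S k)\<^esub>"
      using D.farr_limit[OF mi ml s_linear[OF l(1)] j x] y l(1) by auto
  qed
qed

section \<open>Copies in the universe\<close>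

lemma comm_group_image:
  assumes A: "comm_group A" and car: "carrier B = \<pi> ` carrier A"
    and mult: "\<And>x y. x \<in> carrier A \<Longrightarrow> y \<in> carrier A \<Longrightarrow> \<pi> x \<otimes>\<^bsub>B\<^esub> \<pi> y = \<pi> (x \<otimes>\<^bsub>A\<^esub> y)"
    and one: "\<one>\<^bsub>B\<^esub> = \<pi> \<one>\<^bsub>A\<^esub>"
  shows "comm_group B"
proof -
  interpret A: comm_group A by (rule A)
  show ?thesis
  proof (rule comm_groupI, unfold car one)
    show "\<exists>y\<in>\<pi> ` carrier A. y \<otimes>\<^bsub>B\<^esub> x = \<pi> \<one>\<^bsub>A\<^esub>" if x: "x \<in> \<pi> ` carrier A" for x
    proof -
      obtain a where a: "a \<in> carrier A" "x = \<pi> a" using x by blast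
      then have "\<pi> (inv\<^bsub>A\<^esub> a) \<otimes>\<^bsub>B\<^esub> x = \<pi> \<one>\<^bsub>A\<^esub>"
        using mult[OF A.inv_closed a(1)] by simp
      then show ?thesis using a by blast
    qed
    show "x \<otimes>\<^bsub>B\<^esub> y = y \<otimes>\<^bsub>B\<^esub> x" if xy: "x \<in> \<pi> ` carrier A" "y \<in> \<pi> ` carrier A" for x y
    proof -
      obtain a b where "a \<in> carrier A" "b \<in> carrier A" "x = \<pi> a" "y = \<pi> b" using xy by blast
      then show ?thesis by (simp add: mult A.m_comm)
    qed
    show "x \<otimes>\<^bsub>B\<^esub> y \<otimes>\<^bsub>B\<^esub> z = x \<otimes>\<^bsub>B\<^esub> (y \<otimes>\<^bsub>B\<^esub> z)"
      if "x \<in> \<pi> ` carrier A" "y \<in> \<pi> ` carrier A" "z \<in> \<pi> ` carrier A" for x y z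
      using that by (auto simp: mult A.m_assoc)
  qed (auto simp: mult)
qed

lemma comm_group_add_monoid_iff: "comm_group (additive_group M) \<longleftrightarrow> abelian_group M"
proof
  assume "comm_group (additive_group M)"
  then interpret comm_group "additive_group M" .
  show "abelian_group M"
    by (rule abelian_groupI)
       (rule m_closed[simplified] one_closed[simplified] m_assoc[simplified] m_comm[simplified]
          l_one[simplified] l_inv_ex[simplified]; assumption)+
qed (rule comm_group_additive_group)

lemma left_module_image:
  assumes A: "left_module R A" and car: "carrier B = \<pi> ` carrier A"
    and add: "\<And>x y. x \<in> carrier A \<Longrightarrow> y \<in> carrier A \<Longrightarrow> \<pi> x \<oplus>\<^bsub>B\<^esub> \<pi> y = \<pi> (x \<oplus>\<^bsub>A\<^esub> y)"
    and smult: "\<And>a x. a \<in> carrier R \<Longrightarrow> x \<in> carrier A \<Longrightarrow> a \<odot>\<^bsub>B\<^esub> \<pi> x = \<pi> (a \<odot>\<^bsub>A\<^esub> x)"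
    and zero: "\<zero>\<^bsub>B\<^esub> = \<pi> \<zero>\<^bsub>A\<^esub>"
  shows "left_module R B"
proof -
  interpret R: ring R using left_moduleD(1)[OF A] .
  interpret A: abelian_group A using left_moduleD(2)[OF A] .
  have "comm_group (additive_group B)"
    by (rule comm_group_image[OF comm_group_additive_group[OF left_moduleD(2)[OF A]], of _ \<pi>])
       (simp_all add: car add zero)
  then have "abelian_group B" by (simp add: comm_group_add_monoid_iff)
  then show ?thesis
    unfolding left_module_def car
    by (auto simp: add smult left_moduleD[OF A] R.ring_axioms)
qed

lemma right_module_image:
  assumes A: "right_module R A" and car: "carrier B = \<pi> ` carrier A"
    and add: "\<And>x y. x \<in> carrier A \<Longrightarrow> y \<in> carrier A \<Longrightarrow> \<pi> x \<oplus>\<^bsub>B\<^esub> \<pi> y = \<pi> (x \<oplus>\<^bsub>A\<^esub> y)"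
    and smult: "\<And>a x. a \<in> carrier R \<Longrightarrow> x \<in> carrier A \<Longrightarrow> a \<odot>\<^bsub>B\<^esub> \<pi> x = \<pi> (a \<odot>\<^bsub>A\<^esub> x)"
    and zero: "\<zero>\<^bsub>B\<^esub> = \<pi> \<zero>\<^bsub>A\<^esub>"
  shows "right_module R B"
proof -
  have A2: "ring R" "abelian_group A" using A unfolding right_module_def by auto
  interpret R: ring R using A2 by simp
  interpret A: abelian_group A using A2 by simp
  have "comm_group (additive_group B)"
    by (rule comm_group_image[OF comm_group_additive_group[OF A2(2)], of _ \<pi>])
       (simp_all add: car add zero)
  then have "abelian_group B" by (simp add: comm_group_add_monoid_iff)
  then show ?thesis
    using A unfolding right_module_def car
    by (auto simp: add smult R.ring_axioms)
qed

text \<open>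
  The map \<open>e S\<close> encodes the elements of \<open>K S\<close> in the type \<open>'c\<close>, and \<open>d S\<close> decodes them. Both are
  parameters, since one encoding will serve a family of functors, whose copies then have inclusions
  as transition maps.
\<close>

definition copy_functor ::
  "(('r, 'u) module \<Rightarrow> 'b \<Rightarrow> 'c) \<Rightarrow> (('r, 'u) module \<Rightarrow> 'c \<Rightarrow> 'b) \<Rightarrow> ('r, 'u, 'b) functr \<Rightarrow>
   ('r, 'u, 'c) functr" where
  "copy_functor e d K =
     \<lparr>fobj = (\<lambda>S. \<lparr>carrier = e S ` carrier (fobj K S),
        monoid.mult = (\<lambda>x y. e S (d S x \<otimes>\<^bsub>fobj K S\<^esub> d S y)), one = e S \<one>\<^bsub>fobj K S\<^esub>\<rparr>),
      farr = (\<lambda>S T f x. e T (farr K S T f (d S x)))\<rparr>"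

lemma copy_functor_sel:
  "carrier (fobj (copy_functor e d K) S) = e S ` carrier (fobj K S)"
  "x \<otimes>\<^bsub>fobj (copy_functor e d K) S\<^esub> y = e S (d S x \<otimes>\<^bsub>fobj K S\<^esub> d S y)"
  "\<one>\<^bsub>fobj (copy_functor e d K) S\<^esub> = e S \<one>\<^bsub>fobj K S\<^esub>"
  "farr (copy_functor e d K) S T f x = e T (farr K S T f (d S x))"
  by (simp_all add: copy_functor_def)

lemma functor_module_copy:
  fixes K :: "('r, 'u, 'b) functr"
  assumes K: "functor_module R K"
    and de: "\<And>S x. left_module R S \<Longrightarrow> x \<in> carrier (fobj K S) \<Longrightarrow> d S (e S x) = x"
  shows "functor_module R (copy_functor e d K)"
proof -
  have closed: "x \<otimes>\<^bsub>fobj K S\<^esub> y \<in> carrier (fobj K S)"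
    if "left_module R S" "x \<in> carrier (fobj K S)" "y \<in> carrier (fobj K S)" for S x y
    using functor_module_group[OF K that(1)] that(2,3) by (simp add: group.is_monoid monoid.m_closed)
  show ?thesis
    unfolding functor_module_def
  proof (intro conjI allI impI ballI)
    fix S :: "('r, 'u) module" assume S: "left_module R S"
    show "comm_group (fobj (copy_functor e d K) S)"
      by (rule comm_group_image[OF functor_moduleD(1)[OF K S], of _ "e S"])
         (simp_all add: copy_functor_sel de[OF S])
    fix x assume "x \<in> carrier (fobj (copy_functor e d K) S)"
    then obtain x' where x': "x' \<in> carrier (fobj K S)" "x = e S x'" by (auto simp: copy_functor_sel)
    show "farr (copy_functor e d K) S S (linear_id S) x = x"
      unfolding copy_functor_sel x'(2) de[OF S x'(1)] functor_moduleD(3)[OF K S x'(1)] ..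
  next
    fix S T :: "('r, 'u) module" and f assume S: "left_module R S" and T: "left_module R T" and f: "f \<in> linear_maps R S T"
    show "farr (copy_functor e d K) S T f \<in> hom (fobj (copy_functor e d K) S) (fobj (copy_functor e d K) T)"
    proof (rule homI)
      fix x y assume "x \<in> carrier (fobj (copy_functor e d K) S)" "y \<in> carrier (fobj (copy_functor e d K) S)"
      then obtain x' y' where x': "x' \<in> carrier (fobj K S)" "x = e S x'"
        and y': "y' \<in> carrier (fobj K S)" "y = e S y'" by (auto simp: copy_functor_sel)
      show "farr (copy_functor e d K) S T f (x \<otimes>\<^bsub>fobj (copy_functor e d K) S\<^esub> y) =
          farr (copy_functor e d K) S T f x \<otimes>\<^bsub>fobj (copy_functor e d K) T\<^esub> farr (copy_functor e d K) S T f y"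
        unfolding copy_functor_sel x'(2) y'(2) de[OF S x'(1)] de[OF S y'(1)]
          de[OF S closed[OF S x'(1) y'(1)]] farr_mult[OF K S T f x'(1) y'(1)]
          de[OF T farr_closed[OF K S T f x'(1)]] de[OF T farr_closed[OF K S T f y'(1)]] ..
    next
      fix x assume "x \<in> carrier (fobj (copy_functor e d K) S)"
      then show "farr (copy_functor e d K) S T f x \<in> carrier (fobj (copy_functor e d K) T)"
        using farr_closed[OF K S T f] by (auto simp: copy_functor_sel de[OF S])
    qed
    fix g x assume g: "g \<in> linear_maps R S T" and "x \<in> carrier (fobj (copy_functor e d K) S)"
    then obtain x' where x': "x' \<in> carrier (fobj K S)" "x = e S x'" by (auto simp: copy_functor_sel)
    show "farr (copy_functor e d K) S T (linear_add S T f g) x =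
        farr (copy_functor e d K) S T f x \<otimes>\<^bsub>fobj (copy_functor e d K) T\<^esub> farr (copy_functor e d K) S T g x"
      unfolding copy_functor_sel x'(2) de[OF S x'(1)] functor_moduleD(5)[OF K S T f g x'(1)]
        de[OF T farr_closed[OF K S T f x'(1)]] de[OF T farr_closed[OF K S T g x'(1)]] ..
  next
    fix S T U :: "('r, 'u) module" and f g x assume S: "left_module R S" and T: "left_module R T" and U: "left_module R U"
      and f: "f \<in> linear_maps R S T" and g: "g \<in> linear_maps R T U"
      and "x \<in> carrier (fobj (copy_functor e d K) S)"
    then obtain x' where x': "x' \<in> carrier (fobj K S)" "x = e S x'" by (auto simp: copy_functor_sel)
    show "farr (copy_functor e d K) S U (compose (carrier S) g f) x =
        farr (copy_functor e d K) T U g (farr (copy_functor e d K) S T f x)"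
      unfolding copy_functor_sel x'(2) de[OF S x'(1)] functor_moduleD(4)[OF K S T U f g x'(1)]
        de[OF T farr_closed[OF K S T f x'(1)]] ..
  qed
qed

lemma copy_functor_decode:
  assumes K: "functor_module R K"
    and de: "\<And>S x. left_module R S \<Longrightarrow> x \<in> carrier (fobj K S) \<Longrightarrow> d S (e S x) = x"
  shows "nat_trans R (copy_functor e d K) K d"
    "\<And>S. left_module R S \<Longrightarrow> bij_betw (d S) (carrier (fobj (copy_functor e d K) S)) (carrier (fobj K S))"
proof -
  have closed: "x \<otimes>\<^bsub>fobj K S\<^esub> y \<in> carrier (fobj K S)"
    if "left_module R S" "x \<in> carrier (fobj K S)" "y \<in> carrier (fobj K S)" for S x y
    using functor_module_group[OF K that(1)] that(2,3) by (simp add: group.is_monoid monoid.m_closed)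
  show "nat_trans R (copy_functor e d K) K d"
    by (rule nat_transI) (auto simp: copy_functor_sel de closed farr_closed[OF K])
  show "bij_betw (d S) (carrier (fobj (copy_functor e d K) S)) (carrier (fobj K S))" if "left_module R S" for S
    unfolding copy_functor_sel by (rule bij_betw_byWitness[where f' = "e S"]) (auto simp: de[OF that])
qed

lemma functor_iso_copy:
  assumes "functor_module R K"
    and "\<And>S x. left_module R S \<Longrightarrow> x \<in> carrier (fobj K S) \<Longrightarrow> d S (e S x) = x"
  shows "functor_iso R (copy_functor e d K) K"
  using copy_functor_decode[where d=d and e=e, OF assms] by (rule functor_isoI)

section \<open>Finitely supported functions\<close>

text \<open>
  The functions are zero, and not \<open>undefined\<close>, outside \<open>B\<close>. Thus \<open>S^(A)\<close> is a subset of \<open>S^(B)\<close> for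
  \<open>A \<subseteq> B\<close>, with the same operations.
\<close>

definition fin_fun :: "'x set \<Rightarrow> ('a, 'm) ring_scheme \<Rightarrow> ('x \<Rightarrow> 'a) set" where
  "fin_fun B S = {\<sigma>. (\<forall>x. \<sigma> x \<in> carrier S) \<and> (\<forall>x. x \<notin> B \<longrightarrow> \<sigma> x = \<zero>\<^bsub>S\<^esub>) \<and> finite {x. \<sigma> x \<noteq> \<zero>\<^bsub>S\<^esub>}}"

definition single :: "('a, 'm) ring_scheme \<Rightarrow> 'x \<Rightarrow> 'a \<Rightarrow> 'x \<Rightarrow> 'a" where
  "single S x a = (\<lambda>y. if y = x then a else \<zero>\<^bsub>S\<^esub>)"

definition fin_fun_group :: "'x set \<Rightarrow> ('a, 'm) ring_scheme \<Rightarrow> ('x \<Rightarrow> 'a) monoid" where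
  "fin_fun_group B S =
     \<lparr>carrier = fin_fun B S, monoid.mult = (\<lambda>\<sigma> \<tau> x. \<sigma> x \<oplus>\<^bsub>S\<^esub> \<tau> x), one = (\<lambda>_. \<zero>\<^bsub>S\<^esub>)\<rparr>"

lemma fin_fun_group_sel [simp]:
  "carrier (fin_fun_group B S) = fin_fun B S"
  "\<sigma> \<otimes>\<^bsub>fin_fun_group B S\<^esub> \<tau> = (\<lambda>x. \<sigma> x \<oplus>\<^bsub>S\<^esub> \<tau> x)"
  "\<one>\<^bsub>fin_fun_group B S\<^esub> = (\<lambda>_. \<zero>\<^bsub>S\<^esub>)"
  by (simp_all add: fin_fun_group_def)

lemma fin_funD:
  assumes "\<sigma> \<in> fin_fun B S"
  shows "\<sigma> x \<in> carrier S" "x \<notin> B \<Longrightarrow> \<sigma> x = \<zero>\<^bsub>S\<^esub>" "finite {x. \<sigma> x \<noteq> \<zero>\<^bsub>S\<^esub>}"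
  using assms unfolding fin_fun_def by auto

lemma fin_fun_mono: "B \<subseteq> Y \<Longrightarrow> fin_fun B S \<subseteq> fin_fun Y S"
  unfolding fin_fun_def by auto

context abelian_group
begin

lemma fin_fun_zero: "(\<lambda>_. \<zero>) \<in> fin_fun B G"
  unfolding fin_fun_def by simp

lemma fin_fun_single: "x \<in> B \<Longrightarrow> a \<in> carrier G \<Longrightarrow> single G x a \<in> fin_fun B G"
  unfolding fin_fun_def single_def by (auto intro: finite_subset[of _ "{x}"])

lemma fin_fun_add:
  assumes "\<sigma> \<in> fin_fun B G" "\<tau> \<in> fin_fun B G"
  shows "(\<lambda>x. \<sigma> x \<oplus> \<tau> x) \<in> fin_fun B G"
proof -
  have "{x. \<sigma> x \<oplus> \<tau> x \<noteq> \<zero>} \<subseteq> {x. \<sigma> x \<noteq> \<zero>} \<union> {x. \<tau> x \<noteq> \<zero>}"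
    by auto
  then have "finite {x. \<sigma> x \<oplus> \<tau> x \<noteq> \<zero>}"
    using fin_funD(3)[OF assms(1)] fin_funD(3)[OF assms(2)] finite_subset by blast
  then show ?thesis
    using fin_funD(1,2)[OF assms(1)] fin_funD(1,2)[OF assms(2)] unfolding fin_fun_def by simp
qed

lemma comm_group_fin_fun: "comm_group (fin_fun_group B G)"
proof (rule comm_groupI)
  fix \<sigma> assume "\<sigma> \<in> carrier (fin_fun_group B G)"
  then have \<sigma>: "\<sigma> \<in> fin_fun B G" by simp
  have "(\<lambda>x. \<ominus> \<sigma> x) \<in> fin_fun B G"
  proof -
    have "{x. \<ominus> \<sigma> x \<noteq> \<zero>} \<subseteq> {x. \<sigma> x \<noteq> \<zero>}" by auto
    then show ?thesis using fin_funD[OF \<sigma>] finite_subset unfolding fin_fun_def by auto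
  qed
  then show "\<exists>\<tau>\<in>carrier (fin_fun_group B G). \<tau> \<otimes>\<^bsub>fin_fun_group B G\<^esub> \<sigma> = \<one>\<^bsub>fin_fun_group B G\<^esub>"
    using fin_funD(1)[OF \<sigma>] l_neg by (intro bexI[of _ "\<lambda>x. \<ominus> \<sigma> x"]) simp_all
next
  show "\<sigma> \<otimes>\<^bsub>fin_fun_group B G\<^esub> \<tau> = \<tau> \<otimes>\<^bsub>fin_fun_group B G\<^esub> \<sigma>"
    if "\<sigma> \<in> carrier (fin_fun_group B G)" "\<tau> \<in> carrier (fin_fun_group B G)" for \<sigma> \<tau>
    using that a_comm by (auto simp: fin_funD(1))
qed (auto simp: fin_fun_add fin_fun_zero fin_funD(1) a_assoc)

lemma fin_fun_induct [consumes 1, case_names zero single add]: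
  assumes "\<sigma> \<in> fin_fun B G"
    and zero: "P (\<lambda>_. \<zero>)"
    and single: "\<And>x a. x \<in> B \<Longrightarrow> a \<in> carrier G \<Longrightarrow> P (single G x a)"
    and add: "\<And>\<sigma> \<tau>. \<sigma> \<in> fin_fun B G \<Longrightarrow> \<tau> \<in> fin_fun B G \<Longrightarrow> P \<sigma> \<Longrightarrow> P \<tau> \<Longrightarrow> P (\<lambda>x. \<sigma> x \<oplus> \<tau> x)"
  shows "P \<sigma>"
proof -
  have "\<forall>\<sigma>. \<sigma> \<in> fin_fun B G \<longrightarrow> {x. \<sigma> x \<noteq> \<zero>} \<subseteq> A \<longrightarrow> P \<sigma>" if "finite A" for A
    using that
  proof (induction A)
    case empty
    have "\<sigma> = (\<lambda>_. \<zero>)" if "{x. \<sigma> x \<noteq> \<zero>} \<subseteq> {}" for \<sigma> :: "'b \<Rightarrow> 'a" using that by auto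
    then show ?case using zero by auto
  next
    case (insert y A)
    show ?case
    proof (intro allI impI)
      fix \<sigma> assume \<sigma>: "\<sigma> \<in> fin_fun B G" and sub: "{x. \<sigma> x \<noteq> \<zero>} \<subseteq> insert y A"
      show "P \<sigma>"
      proof (cases "y \<in> B")
        case False
        then have "{x. \<sigma> x \<noteq> \<zero>} \<subseteq> A" using sub fin_funD(2)[OF \<sigma> False] by auto
        then show ?thesis using insert.IH \<sigma> by blast
      next
        case True
        let ?\<tau> = "\<sigma>(y := \<zero>)"
        have "finite {x. ?\<tau> x \<noteq> \<zero>}"
          by (rule finite_subset[OF _ fin_funD(3)[OF \<sigma>]]) auto
        then have \<tau>: "?\<tau> \<in> fin_fun B G"
          using fin_funD(1,2)[OF \<sigma>] unfolding fin_fun_def by simp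
        have "{x. ?\<tau> x \<noteq> \<zero>} \<subseteq> A" using sub by auto
        then have "P ?\<tau>" using insert.IH \<tau> by blast
        then have "P (\<lambda>x. single G y (\<sigma> y) x \<oplus> ?\<tau> x)"
          by (intro add \<tau> fin_fun_single single True fin_funD(1)[OF \<sigma>])
        moreover have "(\<lambda>x. single G y (\<sigma> y) x \<oplus> ?\<tau> x) = \<sigma>"
          using fin_funD(1)[OF \<sigma>] by (auto simp: single_def)
        ultimately show ?thesis by simp
      qed
    qed
  qed
  then show ?thesis using fin_funD(3)[OF assms(1)] assms(1) by blast
qed

end

section \<open>Cardinalities\<close>

lemma times_lepoll_infinite:
  fixes A :: "'a set" and B :: "'b set" and U :: "'u set"
  assumes "infinite U" "A \<lesssim> U" "B \<lesssim> U"
  shows "A \<times> B \<lesssim> U"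
proof -
  have "U \<times> U \<approx> U"
    unfolding eqpoll_iff_card_of_ordIso by (rule card_of_Times_same_infinite[OF assms(1)])
  then show ?thesis
    using times_lepoll_mono[OF assms(2,3)] lepoll_trans2 by blast
qed

lemma Fpow_lepoll_infinite:
  fixes A :: "'a set" and U :: "'u set"
  assumes "infinite U" "A \<lesssim> U"
  shows "Fpow A \<lesssim> U"
proof -
  obtain f where f: "inj_on f A" "f ` A \<subseteq> U" using assms(2) unfolding lepoll_def by blast
  have "inj_on ((`) f) (Fpow A)"
    using inj_on_image_eq_iff[OF f(1)] unfolding inj_on_def Fpow_def by auto
  moreover have "((`) f) ` Fpow A \<subseteq> Fpow U" using f(2) unfolding Fpow_def by auto
  ultimately have "Fpow A \<lesssim> Fpow U" unfolding lepoll_def by blast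
  then show ?thesis using eqpoll_Fpow[OF assms(1)] lepoll_trans2 by blast
qed

text \<open>
  A finitely supported function is determined by the finite set of the pairs \<open>(x, \<sigma> x)\<close> with
  \<open>\<sigma> x \<noteq> 0\<close>.
\<close>

lemma fin_fun_lepoll_infinite:
  fixes B :: "'x set" and S :: "('a, 'm) ring_scheme" and U :: "'u set"
  assumes "infinite U" "B \<lesssim> U" "carrier S \<lesssim> U"
  shows "fin_fun B S \<lesssim> U"
proof -
  let ?g = "\<lambda>\<sigma>. (\<lambda>x. (x, \<sigma> x)) ` {x. \<sigma> x \<noteq> \<zero>\<^bsub>S\<^esub>}"
  have "inj_on ?g (fin_fun B S)"
  proof (rule inj_onI, rule ext)
    fix \<sigma> \<tau> :: "'x \<Rightarrow> 'a" and x assume eq: "?g \<sigma> = ?g \<tau>"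
    have "(x, y) \<in> ?g \<rho> \<longleftrightarrow> y = \<rho> x \<and> y \<noteq> \<zero>\<^bsub>S\<^esub>" for \<rho> :: "'x \<Rightarrow> 'a" and y by auto
    then have "(y = \<sigma> x \<and> y \<noteq> \<zero>\<^bsub>S\<^esub>) = (y = \<tau> x \<and> y \<noteq> \<zero>\<^bsub>S\<^esub>)" for y
      using eq by blast
    then show "\<sigma> x = \<tau> x" by metis
  qed
  moreover have "?g ` fin_fun B S \<subseteq> Fpow (B \<times> carrier S)"
    unfolding Fpow_def fin_fun_def by auto
  ultimately have "fin_fun B S \<lesssim> Fpow (B \<times> carrier S)" unfolding lepoll_def by blast
  then show ?thesis
    using Fpow_lepoll_infinite[OF assms(1) times_lepoll_infinite[OF assms]] lepoll_trans by blast
qed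

section \<open>The functors \<open>S \<mapsto> S^(B)\<close>\<close>

definition free_functor :: "'x set \<Rightarrow> ('r, 'u, 'x \<Rightarrow> 'u) functr" where
  "free_functor B = \<lparr>fobj = fin_fun_group B, farr = (\<lambda>S T f \<sigma>. f \<circ> \<sigma>)\<rparr>"

lemma free_functor_sel [simp]:
  "fobj (free_functor B) = fin_fun_group B" "farr (free_functor B) S T f \<sigma> = f \<circ> \<sigma>"
  by (simp_all add: free_functor_def)

lemma fin_fun_linear_image:
  assumes S: "left_module R S" and T: "left_module R T" and f: "f \<in> linear_maps R S T" and \<sigma>: "\<sigma> \<in> fin_fun B S"
  shows "f \<circ> \<sigma> \<in> fin_fun B T"
proof -
  have z: "f \<zero>\<^bsub>S\<^esub> = \<zero>\<^bsub>T\<^esub>" by (rule linear_maps_zero[OF S T f])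
  have "{x. (f \<circ> \<sigma>) x \<noteq> \<zero>\<^bsub>T\<^esub>} \<subseteq> {x. \<sigma> x \<noteq> \<zero>\<^bsub>S\<^esub>}" using z by auto
  then have "finite {x. (f \<circ> \<sigma>) x \<noteq> \<zero>\<^bsub>T\<^esub>}" using fin_funD(3)[OF \<sigma>] finite_subset by blast
  moreover have "(f \<circ> \<sigma>) x \<in> carrier T" for x using linear_mapsD(1)[OF f fin_funD(1)[OF \<sigma>]] by simp
  moreover have "(f \<circ> \<sigma>) x = \<zero>\<^bsub>T\<^esub>" if "x \<notin> B" for x using z fin_funD(2)[OF \<sigma> that] by simp
  ultimately show ?thesis unfolding fin_fun_def by blast
qed

lemma functor_module_free: "functor_module R (free_functor B :: ('r, 'u, 'x \<Rightarrow> 'u) functr)"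
  unfolding functor_module_def
proof (intro conjI allI impI ballI)
  fix S :: "('r, 'u) module" assume S: "left_module R S"
  interpret S: abelian_group S using left_moduleD(2)[OF S] .
  show "comm_group (fobj (free_functor B) S)" using S.comm_group_fin_fun by simp
  fix \<sigma> assume "\<sigma> \<in> carrier (fobj (free_functor B) S)"
  then show "farr (free_functor B) S S (linear_id S) \<sigma> = \<sigma>"
    using fin_funD(1)[of \<sigma> B S] by (auto simp: linear_id_def)
next
  fix S T :: "('r, 'u) module" and f assume S: "left_module R S" and T: "left_module R T" and f: "f \<in> linear_maps R S T"
  show "farr (free_functor B) S T f \<in> hom (fobj (free_functor B) S) (fobj (free_functor B) T)"
  proof (rule homI)
    show "farr (free_functor B) S T f \<sigma> \<in> carrier (fobj (free_functor B) T)"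
      if "\<sigma> \<in> carrier (fobj (free_functor B) S)" for \<sigma>
      using fin_fun_linear_image[OF S T f] that by simp
    show "farr (free_functor B) S T f (\<sigma> \<otimes>\<^bsub>fobj (free_functor B) S\<^esub> \<tau>) =
        farr (free_functor B) S T f \<sigma> \<otimes>\<^bsub>fobj (free_functor B) T\<^esub> farr (free_functor B) S T f \<tau>"
      if "\<sigma> \<in> carrier (fobj (free_functor B) S)" "\<tau> \<in> carrier (fobj (free_functor B) S)" for \<sigma> \<tau>
      using that linear_mapsD(2)[OF f] by (auto simp: fin_funD(1))
  qed
  fix g \<sigma> assume "\<sigma> \<in> carrier (fobj (free_functor B) S)"
  then show "farr (free_functor B) S T (linear_add S T f g) \<sigma> =
      farr (free_functor B) S T f \<sigma> \<otimes>\<^bsub>fobj (free_functor B) T\<^esub> farr (free_functor B) S T g \<sigma>"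
    by (auto simp: linear_add_def fin_funD(1))
next
  fix S T U :: "('r, 'u) module" and f g \<sigma> assume "\<sigma> \<in> carrier (fobj (free_functor B) S)"
  then show "farr (free_functor B) S U (compose (carrier S) g f) \<sigma> =
      farr (free_functor B) T U g (farr (free_functor B) S T f \<sigma>)"
    by (auto simp: compose_def fin_funD(1))
qed

section \<open>Tensor products\<close>

lemma right_moduleD:
  assumes "right_module R M"
  shows "ring R" "abelian_group M"
    "\<And>a x. a \<in> carrier R \<Longrightarrow> x \<in> carrier M \<Longrightarrow> a \<odot>\<^bsub>M\<^esub> x \<in> carrier M"
    "\<And>a b x. a \<in> carrier R \<Longrightarrow> b \<in> carrier R \<Longrightarrow> x \<in> carrier M \<Longrightarrow>
       (a \<oplus>\<^bsub>R\<^esub> b) \<odot>\<^bsub>M\<^esub> x = a \<odot>\<^bsub>M\<^esub> x \<oplus>\<^bsub>M\<^esub> b \<odot>\<^bsub>M\<^esub> x"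
    "\<And>a x y. a \<in> carrier R \<Longrightarrow> x \<in> carrier M \<Longrightarrow> y \<in> carrier M \<Longrightarrow>
       a \<odot>\<^bsub>M\<^esub> (x \<oplus>\<^bsub>M\<^esub> y) = a \<odot>\<^bsub>M\<^esub> x \<oplus>\<^bsub>M\<^esub> a \<odot>\<^bsub>M\<^esub> y"
    "\<And>a b x. a \<in> carrier R \<Longrightarrow> b \<in> carrier R \<Longrightarrow> x \<in> carrier M \<Longrightarrow>
       (a \<otimes>\<^bsub>R\<^esub> b) \<odot>\<^bsub>M\<^esub> x = b \<odot>\<^bsub>M\<^esub> (a \<odot>\<^bsub>M\<^esub> x)"
    "\<And>x. x \<in> carrier M \<Longrightarrow> \<one>\<^bsub>R\<^esub> \<odot>\<^bsub>M\<^esub> x = x"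
  using assms unfolding right_module_def by auto

lemma linear_add_closed:
  assumes S: "left_module R S" and T: "left_module R T" and f: "f \<in> linear_maps R S T" and g: "g \<in> linear_maps R S T"
  shows "linear_add S T f g \<in> linear_maps R S T"
proof -
  interpret S: abelian_group S using left_moduleD(2)[OF S] .
  interpret T: abelian_group T using left_moduleD(2)[OF T] .
  have "f x \<in> carrier T" "g x \<in> carrier T" if "x \<in> carrier S" for x
    using linear_mapsD(1)[OF f that] linear_mapsD(1)[OF g that] .
  then show ?thesis
    using linear_mapsD(2,3)[OF f] linear_mapsD(2,3)[OF g] left_moduleD(3)[OF S] left_moduleD(5)[OF T]
    unfolding linear_maps_def linear_add_def by (simp add: T.a_ac)
qed

locale tensor =
  fixes R :: "('r, 'k) ring_scheme" and M :: "('r, 'a) module"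
  assumes M: "right_module R M"
begin

sublocale M: abelian_group M
  using right_moduleD(2)[OF M] .

abbreviation pairs :: "('r, 'u) module \<Rightarrow> ('a \<times> 'u \<Rightarrow>\<^sub>0 int) monoid" where
  "pairs S \<equiv> free_Abelian_group (carrier M \<times> carrier S)"

abbreviation tgroup :: "('r, 'u) module \<Rightarrow> ('a \<times> 'u \<Rightarrow>\<^sub>0 int) set monoid" where
  "tgroup S \<equiv> fobj (quasi_coherent R M) S"

definition tens :: "('r, 'u) module \<Rightarrow> 'a \<Rightarrow> 'u \<Rightarrow> ('a \<times> 'u \<Rightarrow>\<^sub>0 int) set" where
  "tens S m s = tensor_subgroup R M S #>\<^bsub>pairs S\<^esub> frag_of (m, s)"

lemma tgroup: "tgroup S = pairs S Mod tensor_subgroup R M S"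
  by (simp add: quasi_coherent_def)

lemma diff_in_pairs: "x \<in> carrier (pairs S) \<Longrightarrow> y \<in> carrier (pairs S) \<Longrightarrow> x - y \<in> carrier (pairs S)"
  using keys_diff[of x y] by auto

lemma relationE:
  assumes "q \<in> tensor_relations R M S"
  obtains (left) m m' s where "m \<in> carrier M" "m' \<in> carrier M" "s \<in> carrier S"
      "q = frag_of (m \<oplus>\<^bsub>M\<^esub> m', s) - frag_of (m, s) - frag_of (m', s)"
    | (right) m s s' where "m \<in> carrier M" "s \<in> carrier S" "s' \<in> carrier S"
      "q = frag_of (m, s \<oplus>\<^bsub>S\<^esub> s') - frag_of (m, s) - frag_of (m, s')"
    | (balanced) a m s where "a \<in> carrier R" "m \<in> carrier M" "s \<in> carrier S"
      "q = frag_of (a \<odot>\<^bsub>M\<^esub> m, s) - frag_of (m, a \<odot>\<^bsub>S\<^esub> s)"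
  using assms unfolding tensor_relations_def
  by (elim UnE CollectE exE conjE) (rule left right balanced; assumption)+

lemma tensor_relations_sub:
  assumes S: "left_module R S"
  shows "tensor_relations R M S \<subseteq> carrier (pairs S)"
proof
  interpret S: abelian_group S using left_moduleD(2)[OF S] .
  note [simp del] = carrier_free_Abelian_group_iff
  have frag: "frag_of p \<in> carrier (pairs S)" if "p \<in> carrier M \<times> carrier S" for p
    using that by simp
  fix q assume "q \<in> tensor_relations R M S"
  then show "q \<in> carrier (pairs S)"
    by (cases rule: relationE)
       (simp_all add: diff_in_pairs frag right_moduleD(3)[OF M] left_moduleD(3)[OF S])
qed

lemma subgroup_T: "left_module R S \<Longrightarrow> subgroup (tensor_subgroup R M S) (pairs S)"
  unfolding tensor_subgroup_def
  by (rule group.generate_is_subgroup[OF group_free_Abelian_group tensor_relations_sub])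

lemma comm_group_tgroup: "left_module R S \<Longrightarrow> comm_group (tgroup S)"
  unfolding tgroup by (rule comm_group.abelian_FactGroup[OF abelian_free_Abelian_group subgroup_T])

lemma group_tgroup: "left_module R S \<Longrightarrow> group (tgroup S)"
  by (rule comm_group.axioms(2)[OF comm_group_tgroup])

lemma coset_hom:
  "left_module R S \<Longrightarrow> (\<lambda>w. tensor_subgroup R M S #>\<^bsub>pairs S\<^esub> w) \<in> hom (pairs S) (tgroup S)"
  unfolding tgroup
  by (rule normal.r_coset_hom_Mod[OF comm_group.subgroup_imp_normal[OF abelian_free_Abelian_group subgroup_T]])

lemma tgroup_elem: "carrier (tgroup S) = (\<lambda>w. tensor_subgroup R M S #>\<^bsub>pairs S\<^esub> w) ` carrier (pairs S)"
  unfolding tgroup by (auto simp: carrier_FactGroup)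

lemma frag_in_pairs: "m \<in> carrier M \<Longrightarrow> s \<in> carrier S \<Longrightarrow> frag_of (m, s) \<in> carrier (pairs S)"
  by simp

lemma tens_closed: "m \<in> carrier M \<Longrightarrow> s \<in> carrier S \<Longrightarrow> tens S m s \<in> carrier (tgroup S)"
  unfolding tens_def tgroup_elem by (intro imageI frag_in_pairs)

lemma coset_eqI:
  assumes S: "left_module R S" and "x \<in> carrier (pairs S)" "y \<in> carrier (pairs S)"
    and "x - y \<in> tensor_relations R M S"
  shows "tensor_subgroup R M S #>\<^bsub>pairs S\<^esub> x = tensor_subgroup R M S #>\<^bsub>pairs S\<^esub> y"
proof -
  have "x \<otimes>\<^bsub>pairs S\<^esub> inv\<^bsub>pairs S\<^esub> y = x - y"
    using assms(3) by simp
  moreover have "x - y \<in> tensor_subgroup R M S"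
    unfolding tensor_subgroup_def by (rule generate.incl[OF assms(4)])
  ultimately show ?thesis
    using group.coset_eq_iff[OF group_free_Abelian_group subgroup_T[OF S] assms(2,3)] by simp
qed

lemma tens_add_left:
  assumes S: "left_module R S" and "m \<in> carrier M" "m' \<in> carrier M" "s \<in> carrier S"
  shows "tens S (m \<oplus>\<^bsub>M\<^esub> m') s = tens S m s \<otimes>\<^bsub>tgroup S\<^esub> tens S m' s"
proof -
  note fr = frag_in_pairs[OF assms(2,4)] frag_in_pairs[OF assms(3,4)]
  have "tens S (m \<oplus>\<^bsub>M\<^esub> m') s =
      tensor_subgroup R M S #>\<^bsub>pairs S\<^esub> (frag_of (m, s) \<otimes>\<^bsub>pairs S\<^esub> frag_of (m', s))"
    unfolding tens_def
  proof (rule coset_eqI[OF S frag_in_pairs])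
    show "frag_of (m, s) \<otimes>\<^bsub>pairs S\<^esub> frag_of (m', s) \<in> carrier (pairs S)"
      by (rule monoid.m_closed[OF group.is_monoid[OF group_free_Abelian_group] fr])
    show "frag_of (m \<oplus>\<^bsub>M\<^esub> m', s) - frag_of (m, s) \<otimes>\<^bsub>pairs S\<^esub> frag_of (m', s) \<in> tensor_relations R M S"
      unfolding tensor_relations_def mult_free_Abelian_group diff_diff_eq[symmetric] using assms by blast
  qed (use assms in simp_all)
  then show ?thesis
    unfolding hom_mult[OF coset_hom[OF S] fr] tens_def .
qed

lemma tens_add_right:
  assumes S: "left_module R S" and "m \<in> carrier M" "s \<in> carrier S" "s' \<in> carrier S"
  shows "tens S m (s \<oplus>\<^bsub>S\<^esub> s') = tens S m s \<otimes>\<^bsub>tgroup S\<^esub> tens S m s'"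
proof -
  interpret S: abelian_group S using left_moduleD(2)[OF S] .
  note fr = frag_in_pairs[OF assms(2,3)] frag_in_pairs[OF assms(2,4)]
  have "tens S m (s \<oplus>\<^bsub>S\<^esub> s') =
      tensor_subgroup R M S #>\<^bsub>pairs S\<^esub> (frag_of (m, s) \<otimes>\<^bsub>pairs S\<^esub> frag_of (m, s'))"
    unfolding tens_def
  proof (rule coset_eqI[OF S frag_in_pairs])
    show "frag_of (m, s) \<otimes>\<^bsub>pairs S\<^esub> frag_of (m, s') \<in> carrier (pairs S)"
      by (rule monoid.m_closed[OF group.is_monoid[OF group_free_Abelian_group] fr])
    show "frag_of (m, s \<oplus>\<^bsub>S\<^esub> s') - frag_of (m, s) \<otimes>\<^bsub>pairs S\<^esub> frag_of (m, s') \<in> tensor_relations R M S"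
      unfolding tensor_relations_def mult_free_Abelian_group diff_diff_eq[symmetric] using assms by blast
  qed (use assms in simp_all)
  then show ?thesis
    unfolding hom_mult[OF coset_hom[OF S] fr] tens_def .
qed

lemma tens_balanced:
  assumes S: "left_module R S" and "a \<in> carrier R" "m \<in> carrier M" "s \<in> carrier S"
  shows "tens S (a \<odot>\<^bsub>M\<^esub> m) s = tens S m (a \<odot>\<^bsub>S\<^esub> s)"
  unfolding tens_def
proof (rule coset_eqI[OF S frag_in_pairs frag_in_pairs])
  show "frag_of (a \<odot>\<^bsub>M\<^esub> m, s) - frag_of (m, a \<odot>\<^bsub>S\<^esub> s) \<in> tensor_relations R M S"
    unfolding tensor_relations_def using assms by blast
qed (use assms right_moduleD(3)[OF M] left_moduleD(3)[OF S] in simp_all)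

lemma tensor_induct [consumes 2, case_names one tens diff]:
  assumes S: "left_module R S" and y: "y \<in> carrier (tgroup S)"
    and one: "P \<one>\<^bsub>tgroup S\<^esub>"
    and tens: "\<And>m s. m \<in> carrier M \<Longrightarrow> s \<in> carrier S \<Longrightarrow> P (tens S m s)"
    and diff: "\<And>x y. x \<in> carrier (tgroup S) \<Longrightarrow> y \<in> carrier (tgroup S) \<Longrightarrow> P x \<Longrightarrow> P y \<Longrightarrow>
      P (x \<otimes>\<^bsub>tgroup S\<^esub> inv\<^bsub>tgroup S\<^esub> y)"
  shows "P y"
proof -
  let ?q = "\<lambda>w. tensor_subgroup R M S #>\<^bsub>pairs S\<^esub> w"
  interpret q: group_hom "pairs S" "tgroup S" ?q
    using group_tgroup[OF S] coset_hom[OF S] by (simp add: group_hom_def group_hom_axioms_def)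
  obtain w where w: "w \<in> carrier (pairs S)" "y = ?q w" using y unfolding tgroup_elem by blast
  have "Poly_Mapping.keys w \<subseteq> carrier M \<times> carrier S" using w(1) by simp
  then have "P (?q w)"
  proof (induction w rule: free_Abelian_group_induct[consumes 1])
    case 1
    then show ?case using one q.hom_one by simp
  next
    case (2 x y)
    have xy: "x \<in> carrier (pairs S)" "y \<in> carrier (pairs S)" using 2 by simp_all
    have "x - y = x \<otimes>\<^bsub>pairs S\<^esub> inv\<^bsub>pairs S\<^esub> y" using 2 by simp
    then have "?q (x - y) = ?q x \<otimes>\<^bsub>tgroup S\<^esub> inv\<^bsub>tgroup S\<^esub> ?q y"
      using xy by (simp only: q.hom_mult q.hom_inv q.G.inv_closed)
    then show ?case using diff[OF q.hom_closed[OF xy(1)] q.hom_closed[OF xy(2)] 2(3,4)] by simp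
  next
    case (3 p)
    then show ?case using tens unfolding tens_def by auto
  qed
  then show ?thesis using w by simp
qed

lemma tensor_hom_eq:
  assumes S: "left_module R S" and G: "group G" and h: "h \<in> hom (tgroup S) G" and k: "k \<in> hom (tgroup S) G"
    and eq: "\<And>m s. m \<in> carrier M \<Longrightarrow> s \<in> carrier S \<Longrightarrow> h (tens S m s) = k (tens S m s)"
    and y: "y \<in> carrier (tgroup S)"
  shows "h y = k y"
proof -
  interpret h: group_hom "tgroup S" G h
    using group_tgroup[OF S] G h by (simp add: group_hom_def group_hom_axioms_def)
  interpret k: group_hom "tgroup S" G k
    using group_tgroup[OF S] G k by (simp add: group_hom_def group_hom_axioms_def)
  show ?thesis
    using S y by (induction rule: tensor_induct) (simp_all add: eq)
qed

lemma tensor_universal: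
  assumes S: "left_module R S" and G: "comm_group G"
    and closed: "\<And>m s. m \<in> carrier M \<Longrightarrow> s \<in> carrier S \<Longrightarrow> b m s \<in> carrier G"
    and left: "\<And>m m' s. m \<in> carrier M \<Longrightarrow> m' \<in> carrier M \<Longrightarrow> s \<in> carrier S \<Longrightarrow>
      b (m \<oplus>\<^bsub>M\<^esub> m') s = b m s \<otimes>\<^bsub>G\<^esub> b m' s"
    and right: "\<And>m s s'. m \<in> carrier M \<Longrightarrow> s \<in> carrier S \<Longrightarrow> s' \<in> carrier S \<Longrightarrow>
      b m (s \<oplus>\<^bsub>S\<^esub> s') = b m s \<otimes>\<^bsub>G\<^esub> b m s'"
    and balanced: "\<And>a m s. a \<in> carrier R \<Longrightarrow> m \<in> carrier M \<Longrightarrow> s \<in> carrier S \<Longrightarrow>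
      b (a \<odot>\<^bsub>M\<^esub> m) s = b m (a \<odot>\<^bsub>S\<^esub> s)"
  obtains h where "h \<in> hom (tgroup S) G"
    "\<And>m s. m \<in> carrier M \<Longrightarrow> s \<in> carrier S \<Longrightarrow> h (tens S m s) = b m s"
proof -
  interpret S: abelian_group S using left_moduleD(2)[OF S] .
  interpret G: comm_group G by (rule G)
  have "(\<lambda>(m, s). b m s) ` (carrier M \<times> carrier S) \<subseteq> carrier G" using closed by auto
  then obtain k where k: "k \<in> hom (pairs S) G"
    and k_frag: "\<And>p. p \<in> carrier M \<times> carrier S \<Longrightarrow> k (frag_of p) = (\<lambda>(m, s). b m s) p"
    by (rule G.free_Abelian_group_universal) auto
  interpret k: group_hom "pairs S" G k
    using k by (simp add: group_hom_def group_hom_axioms_def)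
  have kd: "k (x - y) = k x \<otimes>\<^bsub>G\<^esub> inv\<^bsub>G\<^esub> k y" if "x \<in> carrier (pairs S)" "y \<in> carrier (pairs S)" for x y
  proof -
    have "x - y = x \<otimes>\<^bsub>pairs S\<^esub> inv\<^bsub>pairs S\<^esub> y" using that by simp
    then show ?thesis using that by (simp only: k.hom_mult k.hom_inv k.G.inv_closed)
  qed
  have kf: "k (frag_of (m, s)) = b m s" if "m \<in> carrier M" "s \<in> carrier S" for m s
    using k_frag[of "(m, s)"] that by simp
  have "tensor_relations R M S \<subseteq> kernel (pairs S) G k"
  proof
    fix q assume q: "q \<in> tensor_relations R M S"
    then have "k q = \<one>\<^bsub>G\<^esub>"
    proof (cases rule: relationE)
      case (left m m' s)
      have "k q = b (m \<oplus>\<^bsub>M\<^esub> m') s \<otimes>\<^bsub>G\<^esub> inv\<^bsub>G\<^esub> b m s \<otimes>\<^bsub>G\<^esub> inv\<^bsub>G\<^esub> b m' s"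
        unfolding left(4) using left(1-3)
        by (simp only: kd diff_in_pairs frag_in_pairs kf M.a_closed)
      also have "\<dots> = \<one>\<^bsub>G\<^esub>"
        using closed left(1-3)
        by (simp add: assms(4) G.m_assoc G.m_comm[of "b m s"] flip: G.inv_mult)
      finally show ?thesis .
    next
      case (right m s s')
      have "k q = b m (s \<oplus>\<^bsub>S\<^esub> s') \<otimes>\<^bsub>G\<^esub> inv\<^bsub>G\<^esub> b m s \<otimes>\<^bsub>G\<^esub> inv\<^bsub>G\<^esub> b m s'"
        unfolding right(4) using right(1-3)
        by (simp only: kd diff_in_pairs frag_in_pairs kf S.a_closed)
      also have "\<dots> = \<one>\<^bsub>G\<^esub>"
        using closed right(1-3)
        by (simp add: assms(5) G.m_assoc G.m_comm[of "b m s"] flip: G.inv_mult)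
      finally show ?thesis .
    next
      case (balanced a m s)
      have "k q = b (a \<odot>\<^bsub>M\<^esub> m) s \<otimes>\<^bsub>G\<^esub> inv\<^bsub>G\<^esub> b m (a \<odot>\<^bsub>S\<^esub> s)"
        unfolding balanced(4) using balanced(1-3)
        by (simp only: kd frag_in_pairs kf right_moduleD(3)[OF M] left_moduleD(3)[OF S])
      also have "\<dots> = \<one>\<^bsub>G\<^esub>"
        using closed balanced(1-3) left_moduleD(3)[OF S] assms(6) by simp
      finally show ?thesis .
    qed
    then show "q \<in> kernel (pairs S) G k"
      unfolding kernel_def using q tensor_relations_sub[OF S] by blast
  qed
  then have "tensor_subgroup R M S \<subseteq> kernel (pairs S) G k"
    unfolding tensor_subgroup_def by (rule k.G.generate_subgroup_incl[OF _ k.subgroup_kernel])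
  then obtain h where "h \<in> hom (tgroup S) G"
    and h: "\<And>w. w \<in> carrier (pairs S) \<Longrightarrow> h (tensor_subgroup R M S #>\<^bsub>pairs S\<^esub> w) = k w"
    using k.FactGroup_universal_kernel[OF comm_group.subgroup_imp_normal[OF abelian_free_Abelian_group subgroup_T[OF S]]]
    unfolding tgroup by metis
  moreover have "h (tens S m s) = b m s" if "m \<in> carrier M" "s \<in> carrier S" for m s
    unfolding tens_def h[OF frag_in_pairs[OF that]] by (rule kf[OF that])
  ultimately show thesis using that by blast
qed

text \<open>
  The universal property gives a homomorphism that sends \<open>m \<otimes> s\<close> to \<open>m \<otimes> f s\<close>. It agrees with the
  arrow, which is defined through cosets in the free group, on the class of each generator.
\<close>

lemma farr_tensor:
  assumes S: "left_module R S" and T: "left_module R T" and f: "f \<in> linear_maps R S T"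
  shows "farr (quasi_coherent R M) S T f \<in> hom (tgroup S) (tgroup T)"
    and "\<And>m s. m \<in> carrier M \<Longrightarrow> s \<in> carrier S \<Longrightarrow>
      farr (quasi_coherent R M) S T f (tens S m s) = tens T m (f s)"
proof -
  obtain h where h: "h \<in> hom (tgroup S) (tgroup T)"
    and h_tens: "\<And>m s. m \<in> carrier M \<Longrightarrow> s \<in> carrier S \<Longrightarrow> h (tens S m s) = tens T m (f s)"
  proof (rule tensor_universal[OF S comm_group_tgroup[OF T], of "\<lambda>m s. tens T m (f s)"])
  qed (simp_all add: tens_closed linear_mapsD[OF f] tens_add_left[OF T] tens_add_right[OF T] tens_balanced[OF T])
  interpret hh: group_hom "tgroup S" "tgroup T" h
    using h group_tgroup[OF S] group_tgroup[OF T] by (simp add: group_hom_def group_hom_axioms_def)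
  let ?e = "frag_extend (\<lambda>(m, s). frag_of (m, f s))"
  have e: "?e \<in> hom (pairs S) (pairs T)"
  proof (rule homI)
    fix x assume x: "x \<in> carrier (pairs S)"
    have "Poly_Mapping.keys (?e x) \<subseteq> (\<Union>p\<in>Poly_Mapping.keys x. Poly_Mapping.keys ((\<lambda>(m, s). frag_of (m, f s)) p))"
      by (rule keys_frag_extend)
    also have "\<dots> \<subseteq> carrier M \<times> carrier T"
      using x linear_mapsD(1)[OF f] by auto
    finally show "?e x \<in> carrier (pairs T)" by simp
  qed (simp add: frag_extend_add)
  interpret e: group_hom "pairs S" "pairs T" ?e
    using e by (simp add: group_hom_def group_hom_axioms_def)
  let ?q = "\<lambda>w. tensor_subgroup R M S #>\<^bsub>pairs S\<^esub> w" and ?p = "\<lambda>w. tensor_subgroup R M T #>\<^bsub>pairs T\<^esub> w"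
  interpret q: group_hom "pairs S" "tgroup S" ?q
    using group_tgroup[OF S] coset_hom[OF S] by (simp add: group_hom_def group_hom_axioms_def)
  interpret p: group_hom "pairs T" "tgroup T" ?p
    using group_tgroup[OF T] coset_hom[OF T] by (simp add: group_hom_def group_hom_axioms_def)
  have hq: "h (?q w) = ?p (?e w)" if "w \<in> carrier (pairs S)" for w
  proof -
    have "Poly_Mapping.keys w \<subseteq> carrier M \<times> carrier S" using that by simp
    then show ?thesis
    proof (induction w rule: free_Abelian_group_induct[consumes 1])
      case 1
      then show ?case using hh.hom_one p.hom_one q.hom_one by simp
    next
      case (2 x y)
      have xy: "x \<in> carrier (pairs S)" "y \<in> carrier (pairs S)" using 2 by simp_all
      have "x - y = x \<otimes>\<^bsub>pairs S\<^esub> inv\<^bsub>pairs S\<^esub> y" using 2 by simp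
      then show ?case
        using xy 2(3,4)
        by (simp only: hh.hom_mult hh.hom_inv q.hom_mult q.hom_inv p.hom_mult p.hom_inv e.hom_mult e.hom_inv
            e.G.inv_closed hh.G.inv_closed e.H.inv_closed q.hom_closed e.hom_closed)
    next
      case (3 r)
      then show ?case using h_tens unfolding tens_def by auto
    qed
  qed
  have "?e ` tensor_subgroup R M S \<subseteq> tensor_subgroup R M T"
  proof (rule image_subsetI)
    fix w assume w: "w \<in> tensor_subgroup R M S"
    then have wc: "w \<in> carrier (pairs S)" using subgroup.subset[OF subgroup_T[OF S]] by blast
    have "?q w = \<one>\<^bsub>tgroup S\<^esub>"
      using e.G.coset_eq_subgroup_iff[OF subgroup_T[OF S] wc] w by (simp add: tgroup)
    then have "?p (?e w) = tensor_subgroup R M T"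
      using hq[OF wc] hh.hom_one by (simp add: tgroup)
    then show "?e w \<in> tensor_subgroup R M T"
      using e.H.coset_eq_subgroup_iff[OF subgroup_T[OF T] e.hom_closed[OF wc]] by simp
  qed
  then have "farr (quasi_coherent R M) S T f (?q w) = h (?q w)" if "w \<in> carrier (pairs S)" for w
    unfolding hq[OF that]
    using quotient_map_coset[OF group_free_Abelian_group subgroup_T[OF S] abelian_free_Abelian_group
        subgroup_T[OF T] e _ that]
    by (simp add: quasi_coherent_def)
  then have eq: "farr (quasi_coherent R M) S T f y = h y" if "y \<in> carrier (tgroup S)" for y
    using that unfolding tgroup_elem by blast
  show "farr (quasi_coherent R M) S T f \<in> hom (tgroup S) (tgroup T)"
    using h eq hh.G.m_closed unfolding hom_def by (simp add: Pi_iff)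
  show "farr (quasi_coherent R M) S T f (tens S m s) = tens T m (f s)" if "m \<in> carrier M" "s \<in> carrier S" for m s
    using eq[OF tens_closed[OF that]] h_tens[OF that] by simp
qed

lemma functor_module_tensor: "functor_module R (quasi_coherent R M :: ('r, 'u, ('a \<times> 'u \<Rightarrow>\<^sub>0 int) set) functr)"
  unfolding functor_module_def
proof (intro conjI allI impI ballI)
  fix S :: "('r, 'u) module" assume S: "left_module R S"
  show "comm_group (tgroup S)" by (rule comm_group_tgroup[OF S])
  have id: "linear_id S \<in> linear_maps R S S"
    using abelian_groupE(1)[OF left_moduleD(2)[OF S]] left_moduleD(3)[OF S]
    by (simp add: linear_maps_def linear_id_def)
  fix y assume y: "y \<in> carrier (tgroup S)"
  show "farr (quasi_coherent R M) S S (linear_id S) y = y"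
  proof (rule tensor_hom_eq[where k = "\<lambda>y. y", OF S group_tgroup[OF S] farr_tensor(1)[OF S S id] _ _ y])
    show "farr (quasi_coherent R M) S S (linear_id S) (tens S m s) = tens S m s"
      if "m \<in> carrier M" "s \<in> carrier S" for m s
      unfolding farr_tensor(2)[OF S S id that] using that by (simp add: linear_id_def)
  qed (simp add: hom_def)
next
  fix S T :: "('r, 'u) module" and f assume S: "left_module R S" and T: "left_module R T" and f: "f \<in> linear_maps R S T"
  show "farr (quasi_coherent R M) S T f \<in> hom (tgroup S) (tgroup T)" by (rule farr_tensor(1)[OF S T f])
  fix g y assume g: "g \<in> linear_maps R S T" and y: "y \<in> carrier (tgroup S)"
  interpret T: abelian_group T using left_moduleD(2)[OF T] .
  interpret G: comm_group "tgroup T" by (rule comm_group_tgroup[OF T])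
  have fg: "linear_add S T f g \<in> linear_maps R S T"
    by (rule linear_add_closed[OF S T f g])
  have hom: "(\<lambda>y. farr (quasi_coherent R M) S T f y \<otimes>\<^bsub>tgroup T\<^esub> farr (quasi_coherent R M) S T g y)
      \<in> hom (tgroup S) (tgroup T)"
    using hom_in_carrier[OF farr_tensor(1)[OF S T f]] hom_in_carrier[OF farr_tensor(1)[OF S T g]]
    by (intro homI) (simp_all add: hom_mult[OF farr_tensor(1)[OF S T f]] hom_mult[OF farr_tensor(1)[OF S T g]] G.m_ac)
  show "farr (quasi_coherent R M) S T (linear_add S T f g) y =
      farr (quasi_coherent R M) S T f y \<otimes>\<^bsub>tgroup T\<^esub> farr (quasi_coherent R M) S T g y"
  proof (rule tensor_hom_eq[OF S group_tgroup[OF T] farr_tensor(1)[OF S T fg] hom _ y])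
    fix m s assume m: "m \<in> carrier M" and s: "s \<in> carrier S"
    have "linear_add S T f g s = f s \<oplus>\<^bsub>T\<^esub> g s" using s by (simp add: linear_add_def)
    then show "farr (quasi_coherent R M) S T (linear_add S T f g) (tens S m s) =
        farr (quasi_coherent R M) S T f (tens S m s) \<otimes>\<^bsub>tgroup T\<^esub> farr (quasi_coherent R M) S T g (tens S m s)"
      unfolding farr_tensor(2)[OF S T fg m s] farr_tensor(2)[OF S T f m s] farr_tensor(2)[OF S T g m s]
      using tens_add_right[OF T m linear_mapsD(1)[OF f s] linear_mapsD(1)[OF g s]] by simp
  qed
next
  fix S T U :: "('r, 'u) module" and f g y
  assume S: "left_module R S" and T: "left_module R T" and U: "left_module R U"
    and f: "f \<in> linear_maps R S T" and g: "g \<in> linear_maps R T U" and y: "y \<in> carrier (tgroup S)"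
  have gf: "compose (carrier S) g f \<in> linear_maps R S U" by (rule linear_compose[OF f g S])
  have cmp: "compose (carrier S) g f s = g (f s)" if "s \<in> carrier S" for s using that by (simp add: compose_def)
  have hom: "farr (quasi_coherent R M) T U g \<circ> farr (quasi_coherent R M) S T f \<in> hom (tgroup S) (tgroup U)"
    by (rule hom_compose[OF farr_tensor(1)[OF S T f] farr_tensor(1)[OF T U g]])
  have "farr (quasi_coherent R M) S U (compose (carrier S) g f) y =
      (farr (quasi_coherent R M) T U g \<circ> farr (quasi_coherent R M) S T f) y"
    by (rule tensor_hom_eq[OF S group_tgroup[OF U] farr_tensor(1)[OF S U gf] hom _ y])
       (simp add: farr_tensor(2)[OF S U gf] farr_tensor(2)[OF S T f] farr_tensor(2)[OF T U g] linear_mapsD(1)[OF f] cmp)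
  then show "farr (quasi_coherent R M) S U (compose (carrier S) g f) y =
      farr (quasi_coherent R M) T U g (farr (quasi_coherent R M) S T f y)" by simp
qed

end

text \<open>
  To see that nothing is lost in the limit, the inverse of \<open>lim (M \<otimes> S i) \<rightarrow> M \<otimes> L\<close> is built from the
  universal property: \<open>m \<otimes> c i s\<close> is sent to the class of \<open>m \<otimes> s\<close>.
\<close>

lemma (in limit_diagram) preserved_tensor:
  assumes M: "right_module R M"
  shows "preserved (quasi_coherent R M)"
proof -
  interpret tensor R M by (rule tensor.intro[OF M])
  let ?Q = "quasi_coherent R M"
  interpret C: group_cocone I r "\<lambda>i. tgroup (S i)" "\<lambda>i j. farr ?Q (S i) (S j) (s i j)" "tgroup L"
    "\<lambda>i. farr ?Q (S i) L (c i)"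
    by (rule functor_cocone[OF functor_module_tensor])
  let ?G = "lim_group I r (\<lambda>i. tgroup (S i)) (\<lambda>i j. farr ?Q (S i) (S j) (s i j))"
  note farr_s = farr_tensor(2)[OF module_S module_S s_linear]
  note farr_c = farr_tensor(2)[OF module_S module_L c_linear]
  have G: "comm_group ?G"
  proof (rule group.group_comm_groupI[OF C.group_lim_group])
    fix K L assume "K \<in> carrier ?G" "L \<in> carrier ?G"
    then obtain k u v where k: "k \<in> I" and u: "u \<in> carrier (tgroup (S k))" and v: "v \<in> carrier (tgroup (S k))"
      and K: "K = C.cls k u" and L: "L = C.cls k v"
      by (rule C.common_stage)
    interpret k: comm_group "tgroup (S k)" by (rule comm_group_tgroup[OF module_S[OF k]])
    show "K \<otimes>\<^bsub>?G\<^esub> L = L \<otimes>\<^bsub>?G\<^esub> K"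
      unfolding K L C.mult_cls[OF k u v] C.mult_cls[OF k v u] k.m_comm[OF u v] ..
  qed
  have tens_cls_eq: "C.cls i (tens (S i) m x) = C.cls j (tens (S j) m y)"
    if i: "i \<in> I" and x: "x \<in> carrier (S i)" and j: "j \<in> I" and y: "y \<in> carrier (S j)" and eq: "c i x = c j y"
      and m: "m \<in> carrier M" for i x j y m
  proof -
    obtain k where k: "(i, k) \<in> r" "(j, k) \<in> r" using upper[OF i j] .
    have kI: "k \<in> I" by (rule index(2)[OF k(1)])
    interpret Sk: abelian_group "S k" using left_moduleD(2)[OF module_S[OF kI]] .
    interpret L: abelian_group L using left_moduleD(2)[OF module_L] .
    let ?x = "s i k x" and ?y = "s j k y"
    have xy: "?x \<in> carrier (S k)" "?y \<in> carrier (S k)"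
      using linear_mapsD(1)[OF s_linear[OF k(1)] x] linear_mapsD(1)[OF s_linear[OF k(2)] y] .
    interpret ck: group_hom "additive_group (S k)" "additive_group L" "c k"
      using comm_group.axioms(2)[OF comm_group_additive_group[OF Sk.abelian_group_axioms]]
        comm_group.axioms(2)[OF comm_group_additive_group[OF L.abelian_group_axioms]]
        linear_maps_hom[OF c_linear[OF kI]] by (simp add: group_hom_def group_hom_axioms_def)
    have "c k ?x = c k ?y"
      using eq x y c_comp[OF k(1)] c_comp[OF k(2)] by (simp add: compose_def)
    moreover have "?x \<oplus>\<^bsub>S k\<^esub> inv\<^bsub>additive_group (S k)\<^esub> ?y \<in> carrier (S k)"
      using ck.G.inv_closed[of ?y] xy by simp
    ultimately have "c k (?x \<oplus>\<^bsub>S k\<^esub> inv\<^bsub>additive_group (S k)\<^esub> ?y) = \<zero>\<^bsub>L\<^esub>"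
      using ck.hom_mult[of ?x "inv\<^bsub>additive_group (S k)\<^esub> ?y"] ck.hom_inv[of ?y] ck.H.r_inv[of "c k ?y"]
        ck.G.inv_closed[of ?y] ck.hom_closed[of ?y] xy by simp
    then obtain l where l: "(k, l) \<in> r" "s k l (?x \<oplus>\<^bsub>S k\<^esub> inv\<^bsub>additive_group (S k)\<^esub> ?y) = \<zero>\<^bsub>S l\<^esub>"
      using lim_inj[OF kI] ck.G.inv_closed[of ?y] xy by (metis Sk.a_closed additive_group_sel(1))
    have lI: "l \<in> I" by (rule index(2)[OF l(1)])
    interpret sl: group_hom "additive_group (S k)" "additive_group (S l)" "s k l"
      using ck.G.is_group comm_group.axioms(2)[OF comm_group_additive_group[OF left_moduleD(2)[OF module_S[OF lI]]]]
        linear_maps_hom[OF s_linear[OF l(1)]] by (simp add: group_hom_def group_hom_axioms_def)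
    have "s k l ?x = s k l ?y"
      using l(2) sl.hom_mult[of ?x "inv\<^bsub>additive_group (S k)\<^esub> ?y"] sl.hom_inv[of ?y]
        sl.H.inv_solve_right'[of "\<zero>\<^bsub>S l\<^esub>" "s k l ?x" "s k l ?y"] ck.G.inv_closed[of ?y]
        sl.hom_closed[of ?x] sl.hom_closed[of ?y] xy sl.H.l_one sl.H.one_closed by simp
    then have *: "s i l x = s j l y"
      using s_comp[OF k(1) l(1)] s_comp[OF k(2) l(1)] x y by (simp add: compose_def)
    have il: "(i, l) \<in> r" and jl: "(j, l) \<in> r" using trans k l(1) by blast+
    have "C.cls i (tens (S i) m x) = C.cls l (tens (S l) m (s i l x))"
      unfolding C.cls_push[OF il tens_closed[OF m x]] farr_s[OF i lI il m x] ..
    also have "\<dots> = C.cls j (tens (S j) m y)"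
      unfolding * C.cls_push[OF jl tens_closed[OF m y]] farr_s[OF j lI jl m y] ..
    finally show ?thesis .
  qed
  \<comment> \<open>A choice of a representative of \<open>l\<close> at some stage; by \<open>tens_cls_eq\<close> the class of \<open>m \<otimes> x\<close> depends
    on \<open>m\<close> and \<open>l\<close> only.\<close>
  define stage where "stage l = (SOME p. fst p \<in> I \<and> snd p \<in> carrier (S (fst p)) \<and> c (fst p) (snd p) = l)" for l
  define b where "b m l = C.cls (fst (stage l)) (tens (S (fst (stage l))) m (snd (stage l)))" for m l
  have b_eq: "b m (c i x) = C.cls i (tens (S i) m x)"
    if i: "i \<in> I" and x: "x \<in> carrier (S i)" and m: "m \<in> carrier M" for m i x
  proof -
    let ?P = "\<lambda>p. fst p \<in> I \<and> snd p \<in> carrier (S (fst p)) \<and> c (fst p) (snd p) = c i x"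
    have "?P (i, x)" using i x by simp
    then have "?P (stage (c i x))" unfolding stage_def by (rule someI)
    then show ?thesis unfolding b_def using tens_cls_eq[OF _ _ i x _ m] by blast
  qed
  have stage2: "\<exists>k u v. k \<in> I \<and> u \<in> carrier (S k) \<and> v \<in> carrier (S k) \<and> l = c k u \<and> l' = c k v"
    if l: "l \<in> carrier L" and l': "l' \<in> carrier L" for l l'
  proof -
    obtain i x where i: "i \<in> I" "x \<in> carrier (S i)" "c i x = l" using lim_surj[OF l] .
    obtain j y where j: "j \<in> I" "y \<in> carrier (S j)" "c j y = l'" using lim_surj[OF l'] .
    obtain k where k: "(i, k) \<in> r" "(j, k) \<in> r" using upper[OF i(1) j(1)] .
    have "c k (s i k x) = l" "c k (s j k y) = l'"
      using i j c_comp[OF k(1)] c_comp[OF k(2)] by (simp_all add: compose_def)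
    then show ?thesis
      using index(2)[OF k(1)] linear_mapsD(1)[OF s_linear[OF k(1)] i(2)] linear_mapsD(1)[OF s_linear[OF k(2)] j(2)]
      by blast
  qed
  obtain h where h: "h \<in> hom (tgroup L) ?G"
    and h_tens: "\<And>m l. m \<in> carrier M \<Longrightarrow> l \<in> carrier L \<Longrightarrow> h (tens L m l) = b m l"
  proof (rule tensor_universal[OF module_L G, of b])
    fix m l assume m: "m \<in> carrier M" and l: "l \<in> carrier L"
    obtain i x where i: "i \<in> I" "x \<in> carrier (S i)" "c i x = l" using lim_surj[OF l] .
    show "b m l \<in> carrier ?G"
      unfolding i(3)[symmetric] b_eq[OF i(1,2) m] by (rule C.cls_in_carrier[OF i(1) tens_closed[OF m i(2)]])
    have mi: "left_module R (S i)" by (rule module_S[OF i(1)])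
    { fix m' assume m': "m' \<in> carrier M"
      show "b (m \<oplus>\<^bsub>M\<^esub> m') l = b m l \<otimes>\<^bsub>?G\<^esub> b m' l"
        unfolding i(3)[symmetric] b_eq[OF i(1,2) m] b_eq[OF i(1,2) m'] b_eq[OF i(1,2) M.a_closed[OF m m']]
          tens_add_left[OF mi m m' i(2)] C.mult_cls[OF i(1) tens_closed[OF m i(2)] tens_closed[OF m' i(2)]] .. }
    { fix a assume a: "a \<in> carrier R"
      have "c i (a \<odot>\<^bsub>S i\<^esub> x) = a \<odot>\<^bsub>L\<^esub> l" using linear_mapsD(3)[OF c_linear[OF i(1)] a i(2)] i(3) by simp
      then have "b m (a \<odot>\<^bsub>L\<^esub> l) = C.cls i (tens (S i) m (a \<odot>\<^bsub>S i\<^esub> x))"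
        using b_eq[OF i(1) left_moduleD(3)[OF mi a i(2)] m] by simp
      then show "b (a \<odot>\<^bsub>M\<^esub> m) l = b m (a \<odot>\<^bsub>L\<^esub> l)"
        using b_eq[OF i(1,2) right_moduleD(3)[OF M a m]] tens_balanced[OF mi a m i(2)] i(3) by simp }
    fix l' assume l': "l' \<in> carrier L"
    obtain k u v where k: "k \<in> I" and u: "u \<in> carrier (S k)" and v: "v \<in> carrier (S k)"
      and lu: "l = c k u" and lv: "l' = c k v"
      using stage2[OF l l'] by blast
    interpret Sk: abelian_group "S k" using left_moduleD(2)[OF module_S[OF k]] .
    have uv: "l \<oplus>\<^bsub>L\<^esub> l' = c k (u \<oplus>\<^bsub>S k\<^esub> v)" using linear_mapsD(2)[OF c_linear[OF k] u v] lu lv by simp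
    show "b m (l \<oplus>\<^bsub>L\<^esub> l') = b m l \<otimes>\<^bsub>?G\<^esub> b m l'"
      unfolding uv b_eq[OF k Sk.a_closed[OF u v] m] unfolding lu lv b_eq[OF k u m] b_eq[OF k v m]
        tens_add_right[OF module_S[OF k] m u v] C.mult_cls[OF k tens_closed[OF m u] tens_closed[OF m v]] ..
  qed (use that in blast)
  have h_cls: "h (farr ?Q (S i) L (c i) y) = C.cls i y" if i: "i \<in> I" and y: "y \<in> carrier (tgroup (S i))" for i y
  proof -
    have hc: "h \<circ> farr ?Q (S i) L (c i) \<in> hom (tgroup (S i)) ?G"
      by (rule hom_compose[OF farr_tensor(1)[OF module_S[OF i] module_L c_linear[OF i]] h])
    have cls: "C.cls i \<in> hom (tgroup (S i)) ?G"
      by (rule homI) (simp_all add: C.cls_in_carrier[OF i] C.mult_cls[OF i])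
    have "(h \<circ> farr ?Q (S i) L (c i)) y = C.cls i y"
      by (rule tensor_hom_eq[OF module_S[OF i] C.group_lim_group hc cls _ y])
         (simp add: farr_c[OF i i] h_tens linear_mapsD(1)[OF c_linear[OF i]] b_eq[OF i])
    then show ?thesis by simp
  qed
  interpret h: group_hom "tgroup L" ?G h
    using h group_tgroup[OF module_L] C.group_lim_group by (simp add: group_hom_def group_hom_axioms_def)
  show ?thesis
  proof (rule preservedI)
    fix y assume "y \<in> carrier (tgroup L)"
    with module_L show "\<exists>i\<in>I. \<exists>x\<in>carrier (tgroup (S i)). farr ?Q (S i) L (c i) x = y"
    proof (induction rule: tensor_induct)
      case one
      obtain i where i: "i \<in> I" by (rule nonempty)
      then show ?case
        using hom_one[OF farr_tensor(1)[OF module_S[OF i] module_L c_linear[OF i]] group_tgroup[OF module_S[OF i]] group_tgroup[OF module_L]]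
          monoid.one_closed[OF group.is_monoid[OF group_tgroup[OF module_S[OF i]]]] by blast
    next
      case (tens m l)
      obtain i x where i: "i \<in> I" "x \<in> carrier (S i)" "c i x = l" using lim_surj[OF tens(2)] .
      then show ?case using farr_c[OF i(1) i(1) tens(1) i(2)] tens_closed[OF tens(1) i(2)] by blast
    next
      case (diff y z)
      obtain i u where i: "i \<in> I" "u \<in> carrier (tgroup (S i))" "farr ?Q (S i) L (c i) u = y" using diff(3) by blast
      obtain j v where j: "j \<in> I" "v \<in> carrier (tgroup (S j))" "farr ?Q (S j) L (c j) v = z" using diff(4) by blast
      obtain k where k: "(i, k) \<in> r" "(j, k) \<in> r" using upper[OF i(1) j(1)] .
      have kI: "k \<in> I" by (rule index(2)[OF k(1)])
      interpret k: group_hom "tgroup (S k)" "tgroup L" "farr ?Q (S k) L (c k)"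
        by (rule farr_group_hom[OF functor_module_tensor module_S[OF kI] module_L c_linear[OF kI]])
      let ?u = "farr ?Q (S i) (S k) (s i k) u" and ?v = "farr ?Q (S j) (S k) (s j k) v"
      have uv: "?u \<in> carrier (tgroup (S k))" "?v \<in> carrier (tgroup (S k))"
        using C.closed[OF k(1) i(2)] C.closed[OF k(2) j(2)] .
      have "farr ?Q (S k) L (c k) (?u \<otimes>\<^bsub>tgroup (S k)\<^esub> inv\<^bsub>tgroup (S k)\<^esub> ?v) = y \<otimes>\<^bsub>tgroup L\<^esub> inv\<^bsub>tgroup L\<^esub> z"
        using uv C.compat[OF k(1) i(2)] C.compat[OF k(2) j(2)] i(3) j(3) by simp
      then show ?case using kI uv k.G.m_closed k.G.inv_closed by blast
    qed
  next
    fix i y assume i: "i \<in> I" and y: "y \<in> carrier (tgroup (S i))" and 1: "farr ?Q (S i) L (c i) y = \<one>\<^bsub>tgroup L\<^esub>"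
    have "C.cls i y = \<one>\<^bsub>?G\<^esub>" using h_cls[OF i y] 1 h.hom_one by simp
    then show "\<exists>k. (i, k) \<in> r \<and> farr ?Q (S i) (S k) (s i k) y = \<one>\<^bsub>tgroup (S k)\<^esub>"
      using C.cls_eq_one_iff[OF i y] by blast
  qed
qed

section \<open>The functors that preserve direct limits form a stable subcategory\<close>

lemma Qs_ch_I:
  fixes F :: "('r, 'u, 'u) functr"
  assumes "functor_module R F"
    and "\<And>(I :: 'u set) r S s L c. limit_diagram R I r S s L c \<Longrightarrow> preserves_limit_elements R I r S s L c F"
  shows "F \<in> Qs_ch R"
  using assms preserves_direct_limits_iff[OF assms(1)] unfolding Qs_ch_def by blast

lemma Qs_chD:
  fixes F :: "('r, 'u, 'u) functr" and I :: "'u set"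
  assumes "F \<in> Qs_ch R"
  shows "functor_module R F" "limit_diagram R I r S s L c \<Longrightarrow> preserves_limit_elements R I r S s L c F"
  using assms preserves_direct_limits_iff[of R F] unfolding Qs_ch_def by blast+

text \<open>
  The constructions take their values in other types, whereas the members of the subcategory have
  values in \<open>'u\<close>. All closure properties therefore speak of the functors isomorphic to the result.
\<close>

lemma Qs_ch_contains_copies:
  fixes K :: "('r, 'u, 'b) functr"
  assumes grp: "\<And>S. left_module R S \<Longrightarrow> group (fobj K S)"
    and pres: "\<And>(I :: 'u set) r S s L c. limit_diagram R I r S s L c \<Longrightarrow> preserves_limit_elements R I r S s L c K"
  shows "contains_copies R (Qs_ch R) K"
  unfolding contains_copies_def
proof (intro allI impI)
  fix F :: "('r, 'u, 'u) functr" assume F: "functor_module R F" and iso: "functor_iso R F K"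
  show "F \<in> Qs_ch R"
    by (rule Qs_ch_I[OF F limit_diagram.preserved_iso[OF _ F iso grp pres]])
qed

lemma group_kernel_functor:
  assumes "nat_trans R F G \<eta>" "functor_module R F" "functor_module R G" "left_module R S"
  shows "subgroup (kernel (fobj F S) (fobj G S) (\<eta> S)) (fobj F S)"
proof -
  interpret group_hom "fobj F S" "fobj G S" "\<eta> S"
    using assms by (simp add: group_hom_def group_hom_axioms_def functor_module_group nat_transD(1))
  show ?thesis by (rule subgroup_kernel)
qed

lemma stable_subcategory_Qs_ch: "stable_subcategory R (Qs_ch R :: ('r, 'u, 'u) functr set)"
  unfolding stable_subcategory_def
proof (intro conjI)
  show "full_subcategory R (Qs_ch R :: ('r, 'u, 'u) functr set)"
    unfolding full_subcategory_def Qs_ch_def by blast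
  show "stable_kernels R (Qs_ch R :: ('r, 'u, 'u) functr set)"
    unfolding stable_kernels_def
  proof (intro ballI allI impI Qs_ch_contains_copies)
    fix F G :: "('r, 'u, 'u) functr" and \<eta>
    assume F: "F \<in> Qs_ch R" and G: "G \<in> Qs_ch R" and \<eta>: "nat_trans R F G \<eta>"
    show "group (fobj (kernel_functor F G \<eta>) S)" if S: "left_module R S" for S
      using subgroup.subgroup_is_group[OF group_kernel_functor[OF \<eta> Qs_chD(1)[OF F] Qs_chD(1)[OF G] S]
          functor_module_group[OF Qs_chD(1)[OF F] S]]
      by (simp add: kernel_functor_def)
    show "preserves_limit_elements R I r S s L c (kernel_functor F G \<eta>)"
      if "limit_diagram R I r S s L c" for I :: "'u set" and r S s L c
      by (rule limit_diagram.preserved_kernel[OF that Qs_chD(1)[OF F] Qs_chD(2)[OF F that]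
            Qs_chD(1)[OF G] Qs_chD(2)[OF G that] \<eta>])
  qed
  show "stable_cokernels R (Qs_ch R :: ('r, 'u, 'u) functr set)"
    unfolding stable_cokernels_def
  proof (intro ballI allI impI Qs_ch_contains_copies)
    fix F G :: "('r, 'u, 'u) functr" and \<eta>
    assume F: "F \<in> Qs_ch R" and G: "G \<in> Qs_ch R" and \<eta>: "nat_trans R F G \<eta>"
    show "group (fobj (cokernel_functor F G \<eta>) S)" if S: "left_module R S" for S
      unfolding cokernel_functor_fobj
      by (rule comm_group.axioms(2)[OF comm_group.abelian_FactGroup[OF functor_moduleD(1)[OF Qs_chD(1)[OF G] S]
            image_subgroup[OF \<eta> Qs_chD(1)[OF F] Qs_chD(1)[OF G] S]]])
    show "preserves_limit_elements R I r S s L c (cokernel_functor F G \<eta>)"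
      if "limit_diagram R I r S s L c" for I :: "'u set" and r S s L c
      by (rule limit_diagram.preserved_cokernel[OF that Qs_chD(1)[OF F] Qs_chD(2)[OF F that]
            Qs_chD(1)[OF G] Qs_chD(2)[OF G that] \<eta>])
  qed
  show "stable_direct_limits R (Qs_ch R :: ('r, 'u, 'u) functr set)"
    unfolding stable_direct_limits_def
  proof (intro allI impI Qs_ch_contains_copies)
    fix J :: "'u set" and q \<tau> and F :: "'u \<Rightarrow> ('r, 'u, 'u) functr"
    assume J: "directed_set J q" and sys: "functor_system R J q F \<tau>" and F: "\<forall>i\<in>J. F i \<in> Qs_ch R"
    have D: "functor_diagram R J q F \<tau>" by (rule functor_diagram.intro[OF J sys])
    show "group (fobj (limit_functor J q F \<tau>) S)" if S: "left_module R S" for S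
      by (rule functor_diagram.group_limit[OF D S])
    show "preserves_limit_elements R I r S s L c (limit_functor J q F \<tau>)"
      if "limit_diagram R I r S s L c" for I :: "'u set" and r S s L c
      by (rule limit_diagram.preserved_limit[OF that D]) (rule Qs_chD(2)[OF F[rule_format] that])
  qed
  show "stable_isos R (Qs_ch R :: ('r, 'u, 'u) functr set)"
    unfolding stable_isos_def
  proof (intro ballI Qs_ch_contains_copies)
    fix F :: "('r, 'u, 'u) functr" assume F: "F \<in> Qs_ch R"
    show "group (fobj F S)" if S: "left_module R S" for S
      by (rule functor_module_group[OF Qs_chD(1)[OF F] S])
    show "preserves_limit_elements R I r S s L c F"
      if "limit_diagram R I r S s L c" for I :: "'u set" and r S s L c
      by (rule Qs_chD(2)[OF F that])
  qed
qed

lemma stable_finite_sums_Qs_ch: "stable_finite_sums R (Qs_ch R :: ('r, 'u, 'u) functr set)"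
  unfolding stable_finite_sums_def
proof (intro ballI Qs_ch_contains_copies)
  fix F G :: "('r, 'u, 'u) functr" assume F: "F \<in> Qs_ch R" and G: "G \<in> Qs_ch R"
  show "group (fobj (direct_sum_functor F G) S)" if S: "left_module R S" for S
    using DirProd_group[OF functor_module_group[OF Qs_chD(1)[OF F] S] functor_module_group[OF Qs_chD(1)[OF G] S]]
    by (simp add: direct_sum_functor_def)
  show "preserves_limit_elements R I r S s L c (direct_sum_functor F G)"
    if "limit_diagram R I r S s L c" for I :: "'u set" and r S s L c
    by (rule limit_diagram.preserved_direct_sum[OF that Qs_chD(1)[OF F] Qs_chD(2)[OF F that]
          Qs_chD(1)[OF G] Qs_chD(2)[OF G that]])
qed

lemma ring_functor_in_Qs_ch: "ring_functor \<in> Qs_ch R"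
  by (rule Qs_ch_I[OF functor_module_ring_functor limit_diagram.preserved_ring_functor])

lemma contains_quasi_coherents_Qs_ch: "contains_quasi_coherents R (Qs_ch R :: ('r, 'u, 'u) functr set)"
  unfolding contains_quasi_coherents_def
proof (intro allI impI Qs_ch_contains_copies)
  fix M :: "('r, 'u) module" assume M: "right_module R M"
  show "group (fobj (quasi_coherent R M) S)" if "left_module R S" for S
    by (rule tensor.group_tgroup[OF tensor.intro[OF M] that])
  show "preserves_limit_elements R I r S s L c (quasi_coherent R M)"
    if "limit_diagram R I r S s L c" for I :: "'u set" and r S s L c
    by (rule limit_diagram.preserved_tensor[OF that M])
qed

section \<open>The functors \<open>S \<mapsto> S^(B)\<close> in a stable subcategory\<close>

lemma contains_copies_iso:
  "contains_copies R \<D> K \<Longrightarrow> functor_iso R K' K \<Longrightarrow> contains_copies R \<D> K'"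
  unfolding contains_copies_def using functor_iso_trans by blast

lemma fin_fun_encoding:
  fixes B :: "'x set"
  assumes "infinite (UNIV :: 'u set)" "B \<lesssim> (UNIV :: 'u set)"
  obtains e :: "('r, 'u) module \<Rightarrow> ('x \<Rightarrow> 'u) \<Rightarrow> 'u" and d
  where "\<And>S \<sigma>. \<sigma> \<in> fin_fun B S \<Longrightarrow> d S (e S \<sigma>) = \<sigma>"
proof -
  have "\<exists>e :: ('x \<Rightarrow> 'u) \<Rightarrow> 'u. inj_on e (fin_fun B S)" for S :: "('r, 'u) module"
    using fin_fun_lepoll_infinite[OF assms, of S] subset_imp_lepoll[OF subset_UNIV, of "carrier S"]
    unfolding lepoll_def by blast
  then obtain e :: "('r, 'u) module \<Rightarrow> ('x \<Rightarrow> 'u) \<Rightarrow> 'u" where e: "\<And>S. inj_on (e S) (fin_fun B S)"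
    by metis
  then show thesis
    using that[of "\<lambda>S. inv_into (fin_fun B S) (e S)" e] by (simp add: inv_into_f_f)
qed

lemma left_module_smult_zero:
  assumes S: "left_module R S" and s: "s \<in> carrier S"
  shows "\<zero>\<^bsub>R\<^esub> \<odot>\<^bsub>S\<^esub> s = \<zero>\<^bsub>S\<^esub>"
proof -
  interpret R: ring R using left_moduleD(1)[OF S] .
  interpret S: abelian_group S using left_moduleD(2)[OF S] .
  have "\<zero>\<^bsub>R\<^esub> \<odot>\<^bsub>S\<^esub> s \<oplus>\<^bsub>S\<^esub> \<zero>\<^bsub>R\<^esub> \<odot>\<^bsub>S\<^esub> s = \<zero>\<^bsub>R\<^esub> \<odot>\<^bsub>S\<^esub> s"
    using left_moduleD(4)[OF S R.zero_closed R.zero_closed s] by simp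
  then show ?thesis
    using left_moduleD(3)[OF S R.zero_closed s] by (metis S.add.l_cancel_one)
qed

lemma left_module_smult_zero_right:
  assumes S: "left_module R S" and a: "a \<in> carrier R"
  shows "a \<odot>\<^bsub>S\<^esub> \<zero>\<^bsub>S\<^esub> = \<zero>\<^bsub>S\<^esub>"
proof -
  interpret S: abelian_group S using left_moduleD(2)[OF S] .
  have "a \<odot>\<^bsub>S\<^esub> \<zero>\<^bsub>S\<^esub> \<oplus>\<^bsub>S\<^esub> a \<odot>\<^bsub>S\<^esub> \<zero>\<^bsub>S\<^esub> = a \<odot>\<^bsub>S\<^esub> \<zero>\<^bsub>S\<^esub>"
    using left_moduleD(5)[OF S a S.zero_closed S.zero_closed] by simp
  then show ?thesis
    using left_moduleD(3)[OF S a S.zero_closed] by (metis S.add.l_cancel_one)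
qed

subsection \<open>Generation by the tensor products\<close>

definition free_right :: "('r, 'k) ring_scheme \<Rightarrow> 'x set \<Rightarrow> ('r, 'x \<Rightarrow> 'r) module" where
  "free_right R B = \<lparr>carrier = fin_fun B R, monoid.mult = undefined, one = undefined,
     ring.zero = (\<lambda>_. \<zero>\<^bsub>R\<^esub>), ring.add = (\<lambda>\<mu> \<nu> x. \<mu> x \<oplus>\<^bsub>R\<^esub> \<nu> x), smult = (\<lambda>a \<mu> x. \<mu> x \<otimes>\<^bsub>R\<^esub> a)\<rparr>"

lemma fin_fun_pointwise:
  assumes "\<mu> \<in> fin_fun B R" "\<And>x. g x \<in> carrier S" "\<And>x. \<mu> x = \<zero>\<^bsub>R\<^esub> \<Longrightarrow> g x = \<zero>\<^bsub>S\<^esub>"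
  shows "g \<in> fin_fun B S"
proof -
  have "finite {x. g x \<noteq> \<zero>\<^bsub>S\<^esub>}"
    by (rule finite_subset[OF _ fin_funD(3)[OF assms(1)]]) (use assms(3) in auto)
  then show ?thesis using assms(2,3) fin_funD(2)[OF assms(1)] unfolding fin_fun_def by simp
qed

lemma abelian_group_fin_fun:
  assumes "abelian_group S" and "carrier A = fin_fun B S" "\<zero>\<^bsub>A\<^esub> = (\<lambda>_. \<zero>\<^bsub>S\<^esub>)"
    "\<And>\<sigma> \<tau>. \<sigma> \<oplus>\<^bsub>A\<^esub> \<tau> = (\<lambda>x. \<sigma> x \<oplus>\<^bsub>S\<^esub> \<tau> x)"
  shows "abelian_group (A :: ('r, 'x \<Rightarrow> 'a) module)"
proof -
  interpret S: abelian_group S by (rule assms(1))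
  have "additive_group A = fin_fun_group B S"
    unfolding additive_group_def fin_fun_group_def using assms(2-4) by (simp add: fun_eq_iff)
  then show ?thesis
    using S.comm_group_fin_fun[of B] comm_group_add_monoid_iff[of A] by simp
qed

lemma right_module_free_right:
  assumes "ring R"
  shows "right_module R (free_right R B)"
proof -
  interpret R: ring R by (rule assms)
  have ab: "abelian_group (free_right R B)"
    by (rule abelian_group_fin_fun[OF R.abelian_group_axioms, of _ B]) (simp_all add: free_right_def)
  have "(\<lambda>x. \<mu> x \<otimes>\<^bsub>R\<^esub> a) \<in> fin_fun B R" if "\<mu> \<in> fin_fun B R" "a \<in> carrier R" for \<mu> a
    by (rule fin_fun_pointwise[OF that(1)]) (use that fin_funD(1)[OF that(1)] in simp_all)
  then show ?thesis
    unfolding right_module_def using assms ab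
    by (simp add: free_right_def fin_funD(1) R.r_distr R.l_distr R.m_assoc)
qed

text \<open>
  \<open>R^(B) \<otimes> S\<close> is isomorphic to \<open>S^(B)\<close> by the maps \<open>h\<close> with \<open>\<mu> \<otimes> s \<mapsto> (\<mu> x \<cdot> s)\<close> and \<open>k\<close> with
  \<open>\<sigma> \<mapsto> \<Sum>x. u x \<otimes> \<sigma> x\<close>, where \<open>u x\<close> are the basis vectors. That they are inverse to each other needs to
  be checked on the functions supported at one point only, as both sides are additive.
\<close>

lemma contains_free_functor_of_quasi_coherents:
  fixes R :: "('r, 'k) ring_scheme" and B :: "'x set" and \<D> :: "('r, 'u, 'u) functr set"
  assumes R: "ring R" and U: "infinite (UNIV :: 'u set)" and small: "carrier R \<lesssim> (UNIV :: 'u set)"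
    and qc: "contains_quasi_coherents R \<D>" and B: "B \<lesssim> (UNIV :: 'u set)"
  shows "contains_copies R \<D> (free_functor B)"
proof -
  interpret R: ring R by (rule R)
  let ?A = "free_right R B"
  obtain e :: "('x \<Rightarrow> 'r) \<Rightarrow> 'u" where e: "inj_on e (fin_fun B R)"
    using fin_fun_lepoll_infinite[OF U B small] unfolding lepoll_def by blast
  define d where "d = inv_into (fin_fun B R) e"
  have de: "d (e \<mu>) = \<mu>" if "\<mu> \<in> fin_fun B R" for \<mu>
    unfolding d_def using e that by (rule inv_into_f_f)
  define M :: "('r, 'u) module" where
    "M = \<lparr>carrier = e ` fin_fun B R, monoid.mult = undefined, one = undefined, ring.zero = e (\<lambda>_. \<zero>\<^bsub>R\<^esub>),
       ring.add = (\<lambda>u v. e (\<lambda>x. d u x \<oplus>\<^bsub>R\<^esub> d v x)), smult = (\<lambda>a u. e (\<lambda>x. d u x \<otimes>\<^bsub>R\<^esub> a))\<rparr>"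
  have M: "right_module R M"
    by (rule right_module_image[OF right_module_free_right[OF R, of B], of _ e])
       (simp_all add: M_def free_right_def de)
  interpret tensor R M by (rule tensor.intro[OF M])
  have M_elem: "\<exists>\<mu>\<in>fin_fun B R. m = e \<mu>" if "m \<in> carrier M" for m
    using that by (auto simp: M_def)
  have eM: "e \<mu> \<in> carrier M" if "\<mu> \<in> fin_fun B R" for \<mu> using that by (simp add: M_def)
  have M_add: "e \<mu> \<oplus>\<^bsub>M\<^esub> e \<nu> = e (\<lambda>x. \<mu> x \<oplus>\<^bsub>R\<^esub> \<nu> x)" if "\<mu> \<in> fin_fun B R" "\<nu> \<in> fin_fun B R" for \<mu> \<nu>
    using that by (simp add: M_def de)
  have M_smult: "a \<odot>\<^bsub>M\<^esub> e \<mu> = e (\<lambda>x. \<mu> x \<otimes>\<^bsub>R\<^esub> a)" if "\<mu> \<in> fin_fun B R" for a \<mu>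
    using that by (simp add: M_def de)
  have scale: "(\<lambda>x. \<mu> x \<odot>\<^bsub>S\<^esub> s) \<in> fin_fun B S"
    if "left_module R S" "\<mu> \<in> fin_fun B R" "s \<in> carrier S" for S :: "('r, 'u) module" and \<mu> s
    by (rule fin_fun_pointwise[OF that(2)])
       (use that fin_funD(1)[OF that(2)] left_moduleD(3)[OF that(1)] left_module_smult_zero[OF that(1)] in simp_all)
  define good where "good S h \<longleftrightarrow> h \<in> hom (tgroup S) (fin_fun_group B S) \<and>
      (\<forall>\<mu>\<in>fin_fun B R. \<forall>s\<in>carrier S. h (tens S (e \<mu>) s) = (\<lambda>x. \<mu> x \<odot>\<^bsub>S\<^esub> s))"
    for S :: "('r, 'u) module" and h
  have ex: "\<exists>h. good S h"
    if S: "left_module R S" for S :: "('r, 'u) module"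
  proof -
    interpret S: abelian_group S using left_moduleD(2)[OF S] .
    obtain h where h: "h \<in> hom (tgroup S) (fin_fun_group B S)"
      "\<And>m s. m \<in> carrier M \<Longrightarrow> s \<in> carrier S \<Longrightarrow> h (tens S m s) = (\<lambda>x. d m x \<odot>\<^bsub>S\<^esub> s)"
    proof (rule tensor_universal[OF S S.comm_group_fin_fun[of B], of "\<lambda>m s x. d m x \<odot>\<^bsub>S\<^esub> s"])
      fix m s assume "m \<in> carrier M" and s: "s \<in> carrier S"
      then obtain \<mu> where \<mu>: "\<mu> \<in> fin_fun B R" and m: "m = e \<mu>" using M_elem by blast
      note \<mu>c = fin_funD(1)[OF \<mu>]
      show "(\<lambda>x. d m x \<odot>\<^bsub>S\<^esub> s) \<in> carrier (fin_fun_group B S)" unfolding m de[OF \<mu>] using scale[OF S \<mu> s] by simp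
      { fix m' assume "m' \<in> carrier M"
        then obtain \<nu> where \<nu>: "\<nu> \<in> fin_fun B R" and m': "m' = e \<nu>" using M_elem by blast
        show "(\<lambda>x. d (m \<oplus>\<^bsub>M\<^esub> m') x \<odot>\<^bsub>S\<^esub> s) = (\<lambda>x. d m x \<odot>\<^bsub>S\<^esub> s) \<otimes>\<^bsub>fin_fun_group B S\<^esub> (\<lambda>x. d m' x \<odot>\<^bsub>S\<^esub> s)"
          unfolding m m' M_add[OF \<mu> \<nu>] de[OF R.fin_fun_add[OF \<mu> \<nu>]] de[OF \<mu>] de[OF \<nu>]
          using left_moduleD(4)[OF S \<mu>c fin_funD(1)[OF \<nu>] s] by simp }
      { fix s' assume s': "s' \<in> carrier S"
        show "(\<lambda>x. d m x \<odot>\<^bsub>S\<^esub> (s \<oplus>\<^bsub>S\<^esub> s')) = (\<lambda>x. d m x \<odot>\<^bsub>S\<^esub> s) \<otimes>\<^bsub>fin_fun_group B S\<^esub> (\<lambda>x. d m x \<odot>\<^bsub>S\<^esub> s')"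
          unfolding m de[OF \<mu>] using left_moduleD(5)[OF S \<mu>c s s'] by simp }
      fix a assume a: "a \<in> carrier R"
      have \<mu>a: "(\<lambda>x. \<mu> x \<otimes>\<^bsub>R\<^esub> a) \<in> fin_fun B R"
        by (rule fin_fun_pointwise[OF \<mu>]) (use a \<mu>c in simp_all)
      show "(\<lambda>x. d (a \<odot>\<^bsub>M\<^esub> m) x \<odot>\<^bsub>S\<^esub> s) = (\<lambda>x. d m x \<odot>\<^bsub>S\<^esub> (a \<odot>\<^bsub>S\<^esub> s))"
        unfolding m M_smult[OF \<mu>] de[OF \<mu>a] de[OF \<mu>] using left_moduleD(6)[OF S \<mu>c a s] by simp
    qed (use that in blast)
    then show ?thesis unfolding good_def using eM de by (intro exI[of _ h]) simp
  qed
  define h where "h S = (SOME h. good S h)" for S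
  have good: "good S (h S)" if "left_module R S" for S
    unfolding h_def by (rule someI_ex[OF ex[OF that]])
  have h: "h S \<in> hom (tgroup S) (fin_fun_group B S)" if "left_module R S" for S
    using good[OF that] unfolding good_def by blast
  have h_tens: "h S (tens S (e \<mu>) s) = (\<lambda>x. \<mu> x \<odot>\<^bsub>S\<^esub> s)"
    if "left_module R S" "\<mu> \<in> fin_fun B R" "s \<in> carrier S" for S \<mu> s
    using good[OF that(1)] that(2,3) unfolding good_def by blast
  have nat: "nat_trans R (quasi_coherent R M) (free_functor B) h"
  proof (rule nat_transI)
    fix S T :: "('r, 'u) module" and f y
    assume S: "left_module R S" and T: "left_module R T" and f: "f \<in> linear_maps R S T" and y: "y \<in> carrier (tgroup S)"
    have fh: "farr (free_functor B) S T f \<in> hom (fin_fun_group B S) (fin_fun_group B T)"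
      using functor_moduleD(2)[OF functor_module_free S T f] by simp
    have grpT: "group (fin_fun_group B T)" using functor_module_group[OF functor_module_free T] by simp
    have "(h T \<circ> farr (quasi_coherent R M) S T f) y = (farr (free_functor B) S T f \<circ> h S) y"
    proof (rule tensor_hom_eq[OF S grpT hom_compose[OF farr_tensor(1)[OF S T f] h[OF T]] hom_compose[OF h[OF S] fh] _ y])
      fix m s assume m: "m \<in> carrier M" and s: "s \<in> carrier S"
      obtain \<mu> where \<mu>: "\<mu> \<in> fin_fun B R" and me: "m = e \<mu>" using M_elem[OF m] by blast
      have "(h T \<circ> farr (quasi_coherent R M) S T f) (tens S m s) = (\<lambda>x. \<mu> x \<odot>\<^bsub>T\<^esub> f s)"
        using farr_tensor(2)[OF S T f m s] h_tens[OF T \<mu> linear_mapsD(1)[OF f s]] me by simp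
      also have "\<dots> = f \<circ> (\<lambda>x. \<mu> x \<odot>\<^bsub>S\<^esub> s)"
        using linear_mapsD(3)[OF f fin_funD(1)[OF \<mu>] s] by auto
      finally show "(h T \<circ> farr (quasi_coherent R M) S T f) (tens S m s) = (farr (free_functor B) S T f \<circ> h S) (tens S m s)"
        using h_tens[OF S \<mu> s] me by simp
    qed
    then show "h T (farr (quasi_coherent R M) S T f y) = farr (free_functor B) S T f (h S y)" by simp
  qed (use hom_in_carrier[OF h] hom_mult[OF h] in simp_all)
  have bij: "bij_betw (h S) (carrier (tgroup S)) (carrier (fin_fun_group B S))"
    if S: "left_module R S" for S :: "('r, 'u) module"
  proof -
    interpret S: abelian_group S using left_moduleD(2)[OF S] .
    interpret G: comm_group "tgroup S" by (rule comm_group_tgroup[OF S])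
    interpret H: comm_group "fin_fun_group B S" by (rule S.comm_group_fin_fun)
    interpret h: group_hom "tgroup S" "fin_fun_group B S" "h S"
      using h[OF S] G.is_group H.is_group by (simp add: group_hom_def group_hom_axioms_def)
    define u where "u x = e (single R x \<one>\<^bsub>R\<^esub>)" for x
    have u: "u x \<in> carrier M" if "x \<in> B" for x
      unfolding u_def by (rule eM[OF R.fin_fun_single[OF that R.one_closed]])
    have tens_zero: "tens S m \<zero>\<^bsub>S\<^esub> = \<one>\<^bsub>tgroup S\<^esub>" if "m \<in> carrier M" for m
      using tens_add_right[OF S that S.zero_closed S.zero_closed] tens_closed[OF that, of "\<zero>\<^bsub>S\<^esub>" S]
      by (simp add: G.r_cancel_one')
    have tens_zero': "tens S \<zero>\<^bsub>M\<^esub> s = \<one>\<^bsub>tgroup S\<^esub>" if "s \<in> carrier S" for s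
      using tens_add_left[OF S M.zero_closed M.zero_closed that] tens_closed[OF M.zero_closed that]
      by (simp add: G.r_cancel_one')
    define k where "k \<sigma> = gfinprod (tgroup S) (\<lambda>x. tens S (u x) (\<sigma> x)) B" for \<sigma>
    have k_fun: "(\<lambda>x. tens S (u x) (\<sigma> x)) \<in> B \<rightarrow> carrier (tgroup S)" if "\<sigma> \<in> fin_fun B S" for \<sigma>
      by (intro Pi_I tens_closed u fin_funD(1)[OF that])
    have k_fin: "finite {x \<in> B. tens S (u x) (\<sigma> x) \<noteq> \<one>\<^bsub>tgroup S\<^esub>}" if "\<sigma> \<in> fin_fun B S" for \<sigma>
      by (rule finite_subset[OF _ fin_funD(3)[OF that]]) (use tens_zero u in auto)
    have k_hom: "k \<in> hom (fin_fun_group B S) (tgroup S)"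
    proof (rule homI)
      fix \<sigma> \<tau> assume "\<sigma> \<in> carrier (fin_fun_group B S)" "\<tau> \<in> carrier (fin_fun_group B S)"
      then have \<sigma>: "\<sigma> \<in> fin_fun B S" and \<tau>: "\<tau> \<in> fin_fun B S" by simp_all
      have "k (\<sigma> \<otimes>\<^bsub>fin_fun_group B S\<^esub> \<tau>) =
          gfinprod (tgroup S) (\<lambda>x. tens S (u x) (\<sigma> x) \<otimes>\<^bsub>tgroup S\<^esub> tens S (u x) (\<tau> x)) B"
        unfolding k_def
        by (rule G.gfinprod_cong)
           (use k_fun[OF \<sigma>] k_fun[OF \<tau>] tens_add_right[OF S u fin_funD(1)[OF \<sigma>] fin_funD(1)[OF \<tau>]] in
             \<open>auto simp: Pi_iff simp_implies_def\<close>)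
      then show "k (\<sigma> \<otimes>\<^bsub>fin_fun_group B S\<^esub> \<tau>) = k \<sigma> \<otimes>\<^bsub>tgroup S\<^esub> k \<tau>"
        unfolding k_def using G.gfinprod_distrib[OF k_fin[OF \<sigma>] k_fin[OF \<tau>] k_fun[OF \<sigma>] k_fun[OF \<tau>]] by simp
    qed (simp add: k_def k_fun)
    interpret k: group_hom "fin_fun_group B S" "tgroup S" k
      using k_hom G.is_group H.is_group by (simp add: group_hom_def group_hom_axioms_def)
    have k_single: "k (single S x s) = tens S (u x) s" if x: "x \<in> B" and s: "s \<in> carrier S" for x s
    proof -
      have "k (single S x s) = gfinprod (tgroup S) (\<lambda>_. tens S (u x) s) {x}"
        unfolding k_def
        by (rule G.gfinprod_mono_neutral_cong_right)
           (use x tens_zero u k_fun[OF S.fin_fun_single[OF x s]] in \<open>auto simp: single_def\<close>)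
      then show ?thesis using tens_closed[OF u[OF x] s] by simp
    qed
    have hk: "h S (k \<sigma>) = \<sigma>" if \<sigma>: "\<sigma> \<in> fin_fun B S" for \<sigma>
      using \<sigma>
    proof (induction rule: S.fin_fun_induct)
      case zero
      then show ?case using k.hom_one h.hom_one by simp
    next
      case (single x s)
      have "h S (k (single S x s)) = (\<lambda>y. single R x \<one>\<^bsub>R\<^esub> y \<odot>\<^bsub>S\<^esub> s)"
        unfolding k_single[OF single] unfolding u_def
        by (rule h_tens[OF S R.fin_fun_single[OF single(1) R.one_closed] single(2)])
      then show ?case
        using left_moduleD(7)[OF S single(2)] left_module_smult_zero[OF S single(2)] by (auto simp: single_def)
    next
      case (add \<sigma> \<tau>)
      then show ?case using k.hom_mult[of \<sigma> \<tau>] h.hom_mult[of "k \<sigma>" "k \<tau>"] k.hom_closed[of \<sigma>] k.hom_closed[of \<tau>] by simp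
    qed
    have kh_tens: "k (h S (tens S (e \<mu>) s)) = tens S (e \<mu>) s" if \<mu>: "\<mu> \<in> fin_fun B R" and s: "s \<in> carrier S" for \<mu> s
      using \<mu>
    proof (induction rule: R.fin_fun_induct)
      case zero
      have "e (\<lambda>_. \<zero>\<^bsub>R\<^esub>) = \<zero>\<^bsub>M\<^esub>" by (simp add: M_def)
      then show ?case using tens_zero'[OF s] k.hom_one h.hom_one by simp
    next
      case (single x a)
      note x1 = R.fin_fun_single[OF single(1) R.one_closed]
      have eq: "e (single R x a) = a \<odot>\<^bsub>M\<^esub> u x"
        unfolding u_def M_smult[OF x1] using single(2) by (intro arg_cong[of _ _ e]) (auto simp: single_def)
      have "h S (tens S (e (single R x a)) s) = single S x (a \<odot>\<^bsub>S\<^esub> s)"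
        unfolding h_tens[OF S R.fin_fun_single[OF single] s]
        using left_module_smult_zero[OF S s] by (auto simp: single_def)
      then show ?case
        using k_single[OF single(1) left_moduleD(3)[OF S single(2) s]] tens_balanced[OF S single(2) u[OF single(1)] s] eq
        by simp
    next
      case (add \<mu> \<nu>)
      have "tens S (e (\<lambda>x. \<mu> x \<oplus>\<^bsub>R\<^esub> \<nu> x)) s = tens S (e \<mu>) s \<otimes>\<^bsub>tgroup S\<^esub> tens S (e \<nu>) s"
        unfolding M_add[OF add(1,2), symmetric] by (rule tens_add_left[OF S eM[OF add(1)] eM[OF add(2)] s])
      then show ?case
        using add(3,4) tens_closed[OF eM[OF add(1)] s] tens_closed[OF eM[OF add(2)] s] h.hom_closed
        by (simp only: h.hom_mult k.hom_mult)
    qed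
    have kh: "k (h S y) = y" if y: "y \<in> carrier (tgroup S)" for y
    proof -
      have "(k \<circ> h S) y = y"
      proof (rule tensor_hom_eq[where k = "\<lambda>y. y", OF S G.is_group hom_compose[OF h[OF S] k_hom] _ _ y])
        show "(k \<circ> h S) (tens S m s) = tens S m s" if m: "m \<in> carrier M" and s: "s \<in> carrier S" for m s
          using M_elem[OF m] kh_tens s by auto
      qed (simp add: hom_def)
      then show ?thesis by simp
    qed
    show ?thesis
      by (rule bij_betw_byWitness[where f' = k])
         (use kh hk h.hom_closed k.hom_closed in \<open>auto\<close>)
  qed
  have "functor_iso R (quasi_coherent R M) (free_functor B :: ('r, 'u, 'x \<Rightarrow> 'u) functr)"
    by (rule functor_isoI[OF nat]) (use bij in simp)
  then have "functor_iso R (free_functor B :: ('r, 'u, 'x \<Rightarrow> 'u) functr) (quasi_coherent R M)"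
    by (rule functor_iso_sym_functor[OF _ functor_module_tensor])
  moreover have "contains_copies R \<D> (quasi_coherent R M)"
    using qc M unfolding contains_quasi_coherents_def by blast
  ultimately show ?thesis by (rule contains_copies_iso[rotated])
qed

subsection \<open>Generation by the identity functor\<close>

text \<open>
  The functor \<open>0\<close> is the kernel of the identity of \<open>S \<mapsto> S\<close>, and a new element \<open>b\<close> of the basis adds a
  direct summand \<open>S\<close>.
\<close>

lemma contains_free_functor_finite:
  fixes R :: "('r, 'k) ring_scheme" and B :: "'x set" and \<D> :: "('r, 'u, 'u) functr set"
  assumes U: "infinite (UNIV :: 'u set)"
    and stable: "stable_subcategory R \<D>" "stable_finite_sums R \<D>" and ring: "ring_functor \<in> \<D>"
    and B: "finite B"
  shows "contains_copies R \<D> (free_functor B)"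
  using B
proof (induction B)
  case empty
  let ?id = "\<lambda>(_ :: ('r, 'u) module) (s :: 'u). s"
  have id: "nat_trans R ring_functor ring_functor ?id"
    by (rule nat_transI) simp_all
  have empty: "fin_fun {} S = {\<lambda>_ :: 'x. \<zero>\<^bsub>S\<^esub>}" if S: "left_module R S" for S :: "('r, 'u) module"
    using abelian_groupE(2)[OF left_moduleD(2)[OF S]] by (auto simp: fin_fun_def)
  have "functor_iso R (free_functor ({} :: 'x set)) (kernel_functor ring_functor ring_functor ?id)"
  proof (rule functor_isoI)
    show "nat_trans R (free_functor ({} :: 'x set)) (kernel_functor ring_functor ring_functor ?id) (\<lambda>S \<sigma>. \<zero>\<^bsub>S\<^esub>)"
    proof (rule nat_transI)
      show "\<zero>\<^bsub>T\<^esub> = farr (kernel_functor ring_functor ring_functor ?id) S T f \<zero>\<^bsub>S\<^esub>"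
        if "left_module R S" "left_module R T" "f \<in> linear_maps R S T" for S T :: "('r, 'u) module" and f
        using linear_maps_zero[OF that] by (simp add: kernel_functor_def ring_functor_def)
      fix S :: "('r, 'u) module" assume S: "left_module R S"
      interpret S: abelian_group S using left_moduleD(2)[OF S] .
      show "\<zero>\<^bsub>S\<^esub> \<in> carrier (fobj (kernel_functor ring_functor ring_functor ?id) S)"
        by (simp add: kernel_functor_def ring_functor_def kernel_def)
      show "\<zero>\<^bsub>S\<^esub> = \<zero>\<^bsub>S\<^esub> \<otimes>\<^bsub>fobj (kernel_functor ring_functor ring_functor ?id) S\<^esub> \<zero>\<^bsub>S\<^esub>"
        by (simp add: kernel_functor_def ring_functor_def)
    qed
    show "bij_betw (\<lambda>\<sigma>. \<zero>\<^bsub>S\<^esub>) (carrier (fobj (free_functor ({} :: 'x set)) S))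
        (carrier (fobj (kernel_functor ring_functor ring_functor ?id) S))" if S: "left_module R S" for S
      using empty[OF S] abelian_groupE(2)[OF left_moduleD(2)[OF S]]
      by (auto simp: bij_betw_def kernel_functor_def ring_functor_def kernel_def)
  qed
  moreover have "contains_copies R \<D> (kernel_functor ring_functor ring_functor ?id)"
    using stable(1) ring id unfolding stable_subcategory_def stable_kernels_def by blast
  ultimately show ?case by (rule contains_copies_iso[rotated])
next
  case (insert b B)
  obtain e :: "('r, 'u) module \<Rightarrow> ('x \<Rightarrow> 'u) \<Rightarrow> 'u" and d
    where de: "\<And>S \<sigma>. \<sigma> \<in> fin_fun B S \<Longrightarrow> d S (e S \<sigma>) = \<sigma>"
    by (rule fin_fun_encoding[OF U finite_lepoll_infinite[OF U insert.hyps(1)]]) blast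
  let ?G = "copy_functor e d (free_functor B)"
  have de': "\<And>S \<sigma>. left_module R S \<Longrightarrow> \<sigma> \<in> carrier (fobj (free_functor B) S) \<Longrightarrow> d S (e S \<sigma>) = \<sigma>"
    using de by simp
  have G: "functor_module R ?G"
    by (rule functor_module_copy[OF functor_module_free de'])
  have "functor_iso R ?G (free_functor B)"
    by (rule functor_iso_copy[OF functor_module_free de'])
  then have "?G \<in> \<D>" using insert.IH G unfolding contains_copies_def by blast
  then have "contains_copies R \<D> (direct_sum_functor ?G ring_functor)"
    using stable(2) ring unfolding stable_finite_sums_def by blast
  moreover have "functor_iso R (free_functor (insert b B)) (direct_sum_functor ?G ring_functor)"
  proof (rule functor_isoI)
    define \<eta> where "\<eta> S \<sigma> = (e S (\<sigma>(b := \<zero>\<^bsub>S\<^esub>)), \<sigma> b)" for S :: "('r, 'u) module" and \<sigma> :: "'x \<Rightarrow> 'u"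
    have upd: "\<sigma>(b := \<zero>\<^bsub>S\<^esub>) \<in> fin_fun B S" if S: "left_module R S" and \<sigma>: "\<sigma> \<in> fin_fun (insert b B) S"
      for S :: "('r, 'u) module" and \<sigma>
    proof -
      have "finite {x. (\<sigma>(b := \<zero>\<^bsub>S\<^esub>)) x \<noteq> \<zero>\<^bsub>S\<^esub>}"
        by (rule finite_subset[OF _ fin_funD(3)[OF \<sigma>]]) auto
      then show ?thesis
        using fin_funD(1,2)[OF \<sigma>] abelian_groupE(2)[OF left_moduleD(2)[OF S]] unfolding fin_fun_def by simp
    qed
    show "nat_trans R (free_functor (insert b B)) (direct_sum_functor ?G ring_functor) \<eta>"
    proof (rule nat_transI)
      fix S :: "('r, 'u) module" and \<sigma> assume S: "left_module R S" and "\<sigma> \<in> carrier (fobj (free_functor (insert b B)) S)"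
      then have \<sigma>: "\<sigma> \<in> fin_fun (insert b B) S" by simp
      show "\<eta> S \<sigma> \<in> carrier (fobj (direct_sum_functor ?G ring_functor) S)"
        using upd[OF S \<sigma>] fin_funD(1)[OF \<sigma>]
        by (simp add: \<eta>_def direct_sum_functor_def DirProd_def copy_functor_sel ring_functor_def)
      fix \<tau> assume "\<tau> \<in> carrier (fobj (free_functor (insert b B)) S)"
      then have \<tau>: "\<tau> \<in> fin_fun (insert b B) S" by simp
      interpret S: abelian_group S using left_moduleD(2)[OF S] .
      have "(\<lambda>x. \<sigma> x \<oplus>\<^bsub>S\<^esub> \<tau> x)(b := \<zero>\<^bsub>S\<^esub>) = (\<lambda>x. (\<sigma>(b := \<zero>\<^bsub>S\<^esub>)) x \<oplus>\<^bsub>S\<^esub> (\<tau>(b := \<zero>\<^bsub>S\<^esub>)) x)" by auto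
      then show "\<eta> S (\<sigma> \<otimes>\<^bsub>fobj (free_functor (insert b B)) S\<^esub> \<tau>) =
          \<eta> S \<sigma> \<otimes>\<^bsub>fobj (direct_sum_functor ?G ring_functor) S\<^esub> \<eta> S \<tau>"
        by (simp add: \<eta>_def direct_sum_functor_def DirProd_def copy_functor_sel ring_functor_def
            de[OF upd[OF S \<sigma>]] de[OF upd[OF S \<tau>]])
    next
      fix S T :: "('r, 'u) module" and f \<sigma> assume S: "left_module R S" and T: "left_module R T"
        and f: "f \<in> linear_maps R S T" and "\<sigma> \<in> carrier (fobj (free_functor (insert b B)) S)"
      then have \<sigma>: "\<sigma> \<in> fin_fun (insert b B) S" by simp
      have "(f \<circ> \<sigma>)(b := \<zero>\<^bsub>T\<^esub>) = f \<circ> \<sigma>(b := \<zero>\<^bsub>S\<^esub>)" using linear_maps_zero[OF S T f] by auto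
      then show "\<eta> T (farr (free_functor (insert b B)) S T f \<sigma>) =
          farr (direct_sum_functor ?G ring_functor) S T f (\<eta> S \<sigma>)"
        by (simp add: \<eta>_def direct_sum_functor_def copy_functor_sel ring_functor_def de[OF upd[OF S \<sigma>]])
    qed
    show "bij_betw (\<eta> S) (carrier (fobj (free_functor (insert b B)) S)) (carrier (fobj (direct_sum_functor ?G ring_functor) S))"
      if S: "left_module R S" for S
    proof -
      have inverse: "(d S u)(b := s) \<in> fin_fun (insert b B) S" "e S (((d S u)(b := s))(b := \<zero>\<^bsub>S\<^esub>)) = u"
        if u: "u \<in> e S ` fin_fun B S" and s: "s \<in> carrier S" for u s
      proof -
        obtain \<sigma> where \<sigma>: "\<sigma> \<in> fin_fun B S" "u = e S \<sigma>" using u by blast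
        have "finite {x. (\<sigma>(b := s)) x \<noteq> \<zero>\<^bsub>S\<^esub>}"
          by (rule finite_subset[of _ "insert b {x. \<sigma> x \<noteq> \<zero>\<^bsub>S\<^esub>}"]) (use fin_funD(3)[OF \<sigma>(1)] in auto)
        then show "(d S u)(b := s) \<in> fin_fun (insert b B) S"
          using fin_funD(1,2)[OF \<sigma>(1)] s unfolding \<sigma>(2) de[OF \<sigma>(1)] fin_fun_def by simp
        have "\<sigma>(b := \<zero>\<^bsub>S\<^esub>) = \<sigma>" using fin_funD(2)[OF \<sigma>(1) insert.hyps(2)] by auto
        then show "e S (((d S u)(b := s))(b := \<zero>\<^bsub>S\<^esub>)) = u" unfolding \<sigma>(2) de[OF \<sigma>(1)] by simp
      qed
      show ?thesis
      proof (rule bij_betw_byWitness[where f' = "\<lambda>(u, s). (d S u)(b := s)"])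
        show "\<forall>\<sigma>\<in>carrier (fobj (free_functor (insert b B)) S). (\<lambda>(u, s). (d S u)(b := s)) (\<eta> S \<sigma>) = \<sigma>"
          using de[OF upd[OF S]] by (simp add: \<eta>_def)
        show "\<forall>p\<in>carrier (fobj (direct_sum_functor ?G ring_functor) S). \<eta> S ((\<lambda>(u, s). (d S u)(b := s)) p) = p"
          using inverse(2) by (auto simp: \<eta>_def direct_sum_functor_def DirProd_def copy_functor_sel ring_functor_def)
        show "\<eta> S ` carrier (fobj (free_functor (insert b B)) S) \<subseteq> carrier (fobj (direct_sum_functor ?G ring_functor) S)"
          using upd[OF S] fin_funD(1)
          by (auto simp: \<eta>_def direct_sum_functor_def DirProd_def copy_functor_sel ring_functor_def)
        show "(\<lambda>(u, s). (d S u)(b := s)) ` carrier (fobj (direct_sum_functor ?G ring_functor) S)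
            \<subseteq> carrier (fobj (free_functor (insert b B)) S)"
          using inverse(1) by (auto simp: direct_sum_functor_def DirProd_def copy_functor_sel ring_functor_def)
      qed
    qed
  qed
  ultimately show ?case by (rule contains_copies_iso)
qed

text \<open>
  \<open>S^(B)\<close> is the union of the subgroups \<open>S^A\<close> for the finite subsets \<open>A\<close> of \<open>B\<close>. As one encoding of
  \<open>S^(B)\<close> is used for all \<open>A\<close>, the transition maps between the copies of \<open>S^A\<close> are inclusions.
\<close>

lemma contains_free_functor_of_sums:
  fixes R :: "('r, 'k) ring_scheme" and B :: "'x set" and \<D> :: "('r, 'u, 'u) functr set"
  assumes U: "infinite (UNIV :: 'u set)"
    and stable: "stable_subcategory R \<D>" "stable_finite_sums R \<D>" and ring: "ring_functor \<in> \<D>"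
    and B: "B \<lesssim> (UNIV :: 'u set)"
  shows "contains_copies R \<D> (free_functor B)"
proof -
  obtain e :: "('r, 'u) module \<Rightarrow> ('x \<Rightarrow> 'u) \<Rightarrow> 'u" and d
    where de: "\<And>S \<sigma>. \<sigma> \<in> fin_fun B S \<Longrightarrow> d S (e S \<sigma>) = \<sigma>"
    by (rule fin_fun_encoding[OF U B]) blast
  obtain code :: "'x set \<Rightarrow> 'u" where code: "inj_on code (Fpow B)"
    using Fpow_lepoll_infinite[OF U B] unfolding lepoll_def by blast
  define dec where "dec = inv_into (Fpow B) code"
  have dec: "dec (code A) = A" if "A \<in> Fpow B" for A
    unfolding dec_def using code that by (rule inv_into_f_f)
  define I where "I = code ` Fpow B"
  define r where "r = {(i, j). i \<in> I \<and> j \<in> I \<and> dec i \<subseteq> dec j}"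
  have dec_in: "dec i \<in> Fpow B" if "i \<in> I" for i using that dec unfolding I_def by auto
  have directed: "directed_set I r"
    unfolding directed_set_def
  proof (intro conjI ballI)
    show "I \<noteq> {}" unfolding I_def Fpow_def by auto
    show "preorder_on I r" unfolding preorder_on_def r_def refl_on_def trans_def by auto
    fix i j assume i: "i \<in> I" and j: "j \<in> I"
    have k: "dec i \<union> dec j \<in> Fpow B" using dec_in[OF i] dec_in[OF j] unfolding Fpow_def by simp
    then have "code (dec i \<union> dec j) \<in> I" unfolding I_def by blast
    then show "\<exists>k\<in>I. (i, k) \<in> r \<and> (j, k) \<in> r" using i j dec[OF k] unfolding r_def by auto
  qed
  let ?F = "\<lambda>i. copy_functor e d (free_functor (dec i))" and ?G = "copy_functor e d (free_functor B)"
  have sub: "fin_fun (dec i) S \<subseteq> fin_fun B S" if "i \<in> I" for i and S :: "('r, 'u) module"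
    using dec_in[OF that] unfolding Fpow_def by (intro fin_fun_mono) simp
  have de_i: "d S (e S \<sigma>) = \<sigma>" if "i \<in> I" "\<sigma> \<in> carrier (fobj (free_functor (dec i)) S)" for i S \<sigma>
    using de sub[OF that(1)] that(2) by auto
  have F: "functor_module R (?F i)" if i: "i \<in> I" for i
    by (rule functor_module_copy[OF functor_module_free de_i[OF i]])
  have F_in: "?F i \<in> \<D>" if i: "i \<in> I" for i
  proof -
    have "finite (dec i)" using dec_in[OF i] unfolding Fpow_def by simp
    then have "contains_copies R \<D> (free_functor (dec i))"
      by (rule contains_free_functor_finite[OF U stable ring])
    moreover have "functor_iso R (?F i) (free_functor (dec i))"
      by (rule functor_iso_copy[OF functor_module_free de_i[OF i]])
    ultimately show ?thesis using F[OF i] unfolding contains_copies_def by blast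
  qed
  have G: "functor_module R ?G"
    by (rule functor_module_copy[OF functor_module_free]) (simp add: de)
  let ?\<tau> = "\<lambda>(_ :: 'u) (_ :: 'u) (_ :: ('r, 'u) module) (x :: 'u). x"
  have inclusion: "nat_trans R (copy_functor e d (free_functor A)) (copy_functor e d (free_functor A')) (\<lambda>_ x. x)"
    if "A \<subseteq> A'" for A A' :: "'x set"
  proof (rule nat_transI)
    show "x \<in> carrier (fobj (copy_functor e d (free_functor A')) S)"
      if "x \<in> carrier (fobj (copy_functor e d (free_functor A)) S)" for S x
      using that fin_fun_mono[OF \<open>A \<subseteq> A'\<close>, of S] by (auto simp: copy_functor_sel)
  qed (simp_all add: copy_functor_sel)
  have system: "functor_system R I r ?F ?\<tau>"
    unfolding functor_system_def using F by (auto simp: r_def intro!: inclusion)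
  interpret D: functor_diagram R I r ?F ?\<tau>
    by (rule functor_diagram.intro[OF directed system])
  have "functor_iso R (limit_functor I r ?F ?\<tau>) ?G"
  proof (rule D.limit_functor_iso[OF G, where c = "\<lambda>_ _ x. x"])
    show "nat_trans R (?F i) ?G (\<lambda>_ x. x)" if "i \<in> I" for i
      using dec_in[OF that] unfolding Fpow_def by (intro inclusion) simp
    fix S :: "('r, 'u) module" assume S: "left_module R S"
    show "\<exists>i\<in>I. \<exists>x\<in>carrier (fobj (?F i) S). x = y" if y: "y \<in> carrier (fobj ?G S)" for y
    proof -
      obtain \<sigma> where \<sigma>: "\<sigma> \<in> fin_fun B S" "y = e S \<sigma>" using y by (auto simp: copy_functor_sel)
      let ?A = "{x. \<sigma> x \<noteq> \<zero>\<^bsub>S\<^esub>}"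
      have A: "?A \<in> Fpow B" using fin_funD(2,3)[OF \<sigma>(1)] unfolding Fpow_def by auto
      have "\<sigma> \<in> fin_fun ?A S" using \<sigma>(1) unfolding fin_fun_def by simp
      then have "y \<in> carrier (fobj (?F (code ?A)) S)" using \<sigma>(2) by (simp add: copy_functor_sel dec[OF A])
      then show ?thesis using A unfolding I_def by blast
    qed
    show "\<exists>k. (i, k) \<in> r \<and> x = \<one>\<^bsub>fobj (?F k) S\<^esub>" if "i \<in> I" "x = \<one>\<^bsub>fobj ?G S\<^esub>" for i x
      using that by (intro exI[of _ i]) (simp add: r_def copy_functor_sel)
  qed simp
  then have "functor_iso R ?G (limit_functor I r ?F ?\<tau>)"
    by (rule functor_iso_sym) (erule D.group_limit, rule D.farr_limit_closed)
  moreover have "functor_iso R (free_functor B) ?G"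
    by (rule functor_iso_sym_functor[OF functor_iso_copy[OF functor_module_free] G]) (simp add: de)
  ultimately have "functor_iso R (free_functor B) (limit_functor I r ?F ?\<tau>)"
    using functor_iso_trans by blast
  moreover have "contains_copies R \<D> (limit_functor I r ?F ?\<tau>)"
    using stable(1) directed system F_in unfolding stable_subcategory_def stable_direct_limits_def by blast
  ultimately show ?thesis by (rule contains_copies_iso[rotated])
qed

section \<open>Linear combinations\<close>

lemma finsum_hom:
  assumes S: "abelian_group S" and T: "abelian_group T"
    and h: "\<And>x. x \<in> carrier S \<Longrightarrow> h x \<in> carrier T"
    and add: "\<And>x y. x \<in> carrier S \<Longrightarrow> y \<in> carrier S \<Longrightarrow> h (x \<oplus>\<^bsub>S\<^esub> y) = h x \<oplus>\<^bsub>T\<^esub> h y"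
    and zero: "h \<zero>\<^bsub>S\<^esub> = \<zero>\<^bsub>T\<^esub>" and fin: "finite Y" and g: "\<And>y. y \<in> Y \<Longrightarrow> g y \<in> carrier S"
  shows "h (finsum S g Y) = finsum T (\<lambda>y. h (g y)) Y"
proof -
  interpret S: abelian_group S by (rule S)
  interpret T: abelian_group T by (rule T)
  show ?thesis
    using fin g
  proof (induction Y)
    case empty
    then show ?case by (simp add: zero)
  next
    case (insert y Y)
    have gY: "g \<in> Y \<rightarrow> carrier S" and gy: "g y \<in> carrier S" using insert.prems by auto
    have hY: "(\<lambda>y. h (g y)) \<in> Y \<rightarrow> carrier T" using gY h by auto
    show ?case
      using insert S.finsum_insert[OF insert.hyps gY gy] T.finsum_insert[OF insert.hyps hY h[OF gy]]
        add[OF gy S.finsum_closed[OF gY]] by simp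
  qed
qed

definition lin :: "('r, 'a) module \<Rightarrow> 'x set \<Rightarrow> ('x \<Rightarrow> 'r) \<Rightarrow> ('x \<Rightarrow> 'a) \<Rightarrow> 'a" where
  "lin S Y \<sigma> s = finsum S (\<lambda>y. \<sigma> y \<odot>\<^bsub>S\<^esub> s y) Y"

context
  fixes R :: "('r, 'k) ring_scheme" and S :: "('r, 'a) module"
  assumes S: "left_module R S"
begin

interpretation R: ring R using left_moduleD(1)[OF S] .
interpretation S: abelian_group S using left_moduleD(2)[OF S] .

lemma lin_term:
  "\<sigma> \<in> fin_fun V R \<Longrightarrow> (\<And>y. y \<in> Y \<Longrightarrow> s y \<in> carrier S) \<Longrightarrow> (\<lambda>y. \<sigma> y \<odot>\<^bsub>S\<^esub> s y) \<in> Y \<rightarrow> carrier S"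
  by (intro Pi_I left_moduleD(3)[OF S] fin_funD(1)[of \<sigma> V R])

lemma lin_closed:
  "\<sigma> \<in> fin_fun V R \<Longrightarrow> (\<And>y. y \<in> Y \<Longrightarrow> s y \<in> carrier S) \<Longrightarrow> lin S Y \<sigma> s \<in> carrier S"
  unfolding lin_def by (rule S.finsum_closed[OF lin_term])

lemma lin_cong:
  assumes "\<sigma> \<in> fin_fun V R" "\<And>y. y \<in> Y \<Longrightarrow> s y \<in> carrier S" "\<And>y. y \<in> Y \<Longrightarrow> s' y = s y"
  shows "lin S Y \<sigma> s' = lin S Y \<sigma> s"
  unfolding lin_def by (rule S.finsum_cong'[OF refl lin_term[OF assms(1,2)]]) (simp_all add: assms(3))

lemma lin_zero: "(\<And>y. y \<in> Y \<Longrightarrow> s y \<in> carrier S) \<Longrightarrow> lin S Y (\<lambda>_. \<zero>\<^bsub>R\<^esub>) s = \<zero>\<^bsub>S\<^esub>"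
  unfolding lin_def by (rule S.add.finprod_one_eqI) (simp add: left_module_smult_zero[OF S])

lemma lin_zero_right: "\<sigma> \<in> fin_fun V R \<Longrightarrow> lin S Y \<sigma> (\<lambda>_. \<zero>\<^bsub>S\<^esub>) = \<zero>\<^bsub>S\<^esub>"
  unfolding lin_def by (rule S.add.finprod_one_eqI) (simp add: left_module_smult_zero_right[OF S] fin_funD(1))

lemma lin_add:
  assumes \<sigma>: "\<sigma> \<in> fin_fun V R" and \<tau>: "\<tau> \<in> fin_fun W R" and s: "\<And>y. y \<in> Y \<Longrightarrow> s y \<in> carrier S"
  shows "lin S Y (\<lambda>y. \<sigma> y \<oplus>\<^bsub>R\<^esub> \<tau> y) s = lin S Y \<sigma> s \<oplus>\<^bsub>S\<^esub> lin S Y \<tau> s"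
proof -
  have "lin S Y (\<lambda>y. \<sigma> y \<oplus>\<^bsub>R\<^esub> \<tau> y) s = finsum S (\<lambda>y. \<sigma> y \<odot>\<^bsub>S\<^esub> s y \<oplus>\<^bsub>S\<^esub> \<tau> y \<odot>\<^bsub>S\<^esub> s y) Y"
    unfolding lin_def
    using left_moduleD(3)[OF S fin_funD(1)[OF \<sigma>] s] left_moduleD(3)[OF S fin_funD(1)[OF \<tau>] s]
    by (intro S.finsum_cong' refl Pi_I S.a_closed left_moduleD(4)[OF S fin_funD(1)[OF \<sigma>] fin_funD(1)[OF \<tau>] s])
  then show ?thesis
    unfolding lin_def using S.finsum_addf[OF lin_term[OF \<sigma> s] lin_term[OF \<tau> s]] by simp
qed

lemma lin_add_right:
  assumes \<sigma>: "\<sigma> \<in> fin_fun V R" and s: "\<And>y. y \<in> Y \<Longrightarrow> s y \<in> carrier S" and t: "\<And>y. y \<in> Y \<Longrightarrow> t y \<in> carrier S"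
  shows "lin S Y \<sigma> (\<lambda>y. s y \<oplus>\<^bsub>S\<^esub> t y) = lin S Y \<sigma> s \<oplus>\<^bsub>S\<^esub> lin S Y \<sigma> t"
proof -
  have "lin S Y \<sigma> (\<lambda>y. s y \<oplus>\<^bsub>S\<^esub> t y) = finsum S (\<lambda>y. \<sigma> y \<odot>\<^bsub>S\<^esub> s y \<oplus>\<^bsub>S\<^esub> \<sigma> y \<odot>\<^bsub>S\<^esub> t y) Y"
    unfolding lin_def
    using left_moduleD(3)[OF S fin_funD(1)[OF \<sigma>] s] left_moduleD(3)[OF S fin_funD(1)[OF \<sigma>] t]
    by (intro S.finsum_cong' refl Pi_I S.a_closed left_moduleD(5)[OF S fin_funD(1)[OF \<sigma>] s t])
  then show ?thesis
    unfolding lin_def using S.finsum_addf[OF lin_term[OF \<sigma> s] lin_term[OF \<sigma> t]] by simp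
qed

lemma lin_smult:
  assumes \<sigma>: "\<sigma> \<in> fin_fun V R" and a: "a \<in> carrier R" and Y: "finite Y" and s: "\<And>y. y \<in> Y \<Longrightarrow> s y \<in> carrier S"
  shows "lin S Y (\<lambda>y. a \<otimes>\<^bsub>R\<^esub> \<sigma> y) s = a \<odot>\<^bsub>S\<^esub> lin S Y \<sigma> s"
proof -
  have "a \<odot>\<^bsub>S\<^esub> finsum S (\<lambda>y. \<sigma> y \<odot>\<^bsub>S\<^esub> s y) Y = finsum S (\<lambda>y. a \<odot>\<^bsub>S\<^esub> (\<sigma> y \<odot>\<^bsub>S\<^esub> s y)) Y"
    by (rule finsum_hom[OF left_moduleD(2)[OF S] left_moduleD(2)[OF S] _ _ _ Y])
       (use left_moduleD(3,5)[OF S a] left_module_smult_zero_right[OF S a] left_moduleD(3)[OF S fin_funD(1)[OF \<sigma>] s] in simp_all)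
  also have "\<dots> = finsum S (\<lambda>y. (a \<otimes>\<^bsub>R\<^esub> \<sigma> y) \<odot>\<^bsub>S\<^esub> s y) Y"
    by (rule S.finsum_cong')
       (use left_moduleD(6)[OF S a fin_funD(1)[OF \<sigma>] s] left_moduleD(3)[OF S R.m_closed[OF a fin_funD(1)[OF \<sigma>]] s] in auto)
  finally show ?thesis unfolding lin_def by simp
qed

lemma lin_mono:
  assumes \<sigma>: "\<sigma> \<in> fin_fun Y R" and Y': "finite Y'" "Y \<subseteq> Y'" and s: "\<And>y. y \<in> Y' \<Longrightarrow> s y \<in> carrier S"
  shows "lin S Y \<sigma> s = lin S Y' \<sigma> s"
  unfolding lin_def
  by (rule S.add.finprod_mono_neutral_cong_left)
     (use Y' lin_term[OF \<sigma> s] fin_funD(2)[OF \<sigma>] left_module_smult_zero[OF S s] in auto)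

lemma lin_single:
  assumes Y: "finite Y" "y \<in> Y" and a: "a \<in> carrier R" and s: "\<And>y. y \<in> Y \<Longrightarrow> s y \<in> carrier S"
  shows "lin S Y (single R y a) s = a \<odot>\<^bsub>S\<^esub> s y"
proof -
  have single: "single R y a \<in> fin_fun {y} R" by (rule R.fin_fun_single[OF _ a]) simp
  have "lin S Y (single R y a) s = lin S {y} (single R y a) s"
    by (rule lin_mono[OF single Y(1) _ s, symmetric]) (use Y in auto)
  also have "\<dots> = a \<odot>\<^bsub>S\<^esub> s y"
    unfolding lin_def using left_moduleD(3)[OF S a s[OF Y(2)]] by (simp add: single_def)
  finally show ?thesis .
qed

end

lemma lin_linear_map:
  assumes S: "left_module R S" and T: "left_module R T" and f: "f \<in> linear_maps R S T"
    and \<sigma>: "\<sigma> \<in> fin_fun V R" and Y: "finite Y" and s: "\<And>y. y \<in> Y \<Longrightarrow> s y \<in> carrier S"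
  shows "f (lin S Y \<sigma> s) = lin T Y \<sigma> (\<lambda>y. f (s y))"
proof -
  interpret T: abelian_group T using left_moduleD(2)[OF T] .
  have "f (lin S Y \<sigma> s) = finsum T (\<lambda>y. f (\<sigma> y \<odot>\<^bsub>S\<^esub> s y)) Y"
    unfolding lin_def
    by (rule finsum_hom[OF left_moduleD(2)[OF S] left_moduleD(2)[OF T] _ _ _ Y])
       (use linear_mapsD(1,2)[OF f] linear_maps_zero[OF S T f] left_moduleD(3)[OF S fin_funD(1)[OF \<sigma>] s] in simp_all)
  also have "\<dots> = lin T Y \<sigma> (\<lambda>y. f (s y))"
    unfolding lin_def
    by (rule T.finsum_cong')
       (use linear_mapsD(3)[OF f fin_funD(1)[OF \<sigma>] s] left_moduleD(3)[OF T fin_funD(1)[OF \<sigma>] linear_mapsD(1)[OF f s]] in auto)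
  finally show ?thesis .
qed

section \<open>Finitely presented modules\<close>

inductive_set span :: "('r, 'k) ring_scheme \<Rightarrow> ('x \<Rightarrow> 'r) set \<Rightarrow> ('x \<Rightarrow> 'r) set"
  for R :: "('r, 'k) ring_scheme" and N where
  zero: "(\<lambda>_. \<zero>\<^bsub>R\<^esub>) \<in> span R N"
| incl: "n \<in> N \<Longrightarrow> n \<in> span R N"
| add: "\<sigma> \<in> span R N \<Longrightarrow> \<tau> \<in> span R N \<Longrightarrow> (\<lambda>x. \<sigma> x \<oplus>\<^bsub>R\<^esub> \<tau> x) \<in> span R N"
| smult: "a \<in> carrier R \<Longrightarrow> \<sigma> \<in> span R N \<Longrightarrow> (\<lambda>x. a \<otimes>\<^bsub>R\<^esub> \<sigma> x) \<in> span R N"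

lemma (in ring) fin_fun_smult:
  assumes "a \<in> carrier R" "f \<in> fin_fun Y R"
  shows "(\<lambda>x. a \<otimes> f x) \<in> fin_fun Y R"
  by (rule fin_fun_pointwise[OF assms(2)]) (use assms(1) fin_funD(1)[OF assms(2)] in simp_all)

lemma (in ring) fin_fun_minus:
  assumes "f \<in> fin_fun Y R" "g \<in> fin_fun Y R"
  shows "(\<lambda>x. f x \<ominus> g x) \<in> fin_fun Y R"
proof -
  have "(\<lambda>x. \<ominus> g x) \<in> fin_fun Y R"
    by (rule fin_fun_pointwise[OF assms(2)]) (use fin_funD(1)[OF assms(2)] in simp_all)
  then show ?thesis unfolding a_minus_def by (rule fin_fun_add[OF assms(1)])
qed

lemma (in ring) span_sub:
  assumes N: "N \<subseteq> fin_fun Y R"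
  shows "span R N \<subseteq> fin_fun Y R"
proof
  fix f assume "f \<in> span R N"
  then show "f \<in> fin_fun Y R"
  proof (induction rule: span.induct)
    case (incl n)
    then show ?case using N by blast
  qed (rule fin_fun_zero fin_fun_add fin_fun_smult; assumption)+
qed

text \<open>
  \<open>Q\<close> is the module with generators \<open>Y\<close> and relations \<open>N\<close>, that is, \<open>R^(Y)\<close> modulo the span of \<open>N\<close>; \<open>\<pi>\<close> is
  the projection. The elements of \<open>Q\<close> need not be cosets, so that \<open>Q\<close> may lie in the universe.
\<close>

definition presents ::
  "('r, 'k) ring_scheme \<Rightarrow> 'x set \<Rightarrow> ('x \<Rightarrow> 'r) set \<Rightarrow> ('r, 'u) module \<Rightarrow> (('x \<Rightarrow> 'r) \<Rightarrow> 'u) \<Rightarrow> bool" where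
  "presents R Y N Q \<pi> \<longleftrightarrow> left_module R Q \<and> carrier Q = \<pi> ` fin_fun Y R \<and>
     (\<forall>\<sigma>\<in>fin_fun Y R. \<forall>\<tau>\<in>fin_fun Y R. \<pi> (\<lambda>x. \<sigma> x \<oplus>\<^bsub>R\<^esub> \<tau> x) = \<pi> \<sigma> \<oplus>\<^bsub>Q\<^esub> \<pi> \<tau>) \<and>
     (\<forall>a\<in>carrier R. \<forall>\<sigma>\<in>fin_fun Y R. \<pi> (\<lambda>x. a \<otimes>\<^bsub>R\<^esub> \<sigma> x) = a \<odot>\<^bsub>Q\<^esub> \<pi> \<sigma>) \<and>
     (\<forall>\<sigma>\<in>fin_fun Y R. \<pi> \<sigma> = \<zero>\<^bsub>Q\<^esub> \<longleftrightarrow> \<sigma> \<in> span R N)"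

definition free_left :: "('r, 'k) ring_scheme \<Rightarrow> 'x set \<Rightarrow> ('r, 'x \<Rightarrow> 'r) module" where
  "free_left R B = \<lparr>carrier = fin_fun B R, monoid.mult = undefined, one = undefined,
     ring.zero = (\<lambda>_. \<zero>\<^bsub>R\<^esub>), ring.add = (\<lambda>\<mu> \<nu> x. \<mu> x \<oplus>\<^bsub>R\<^esub> \<nu> x), smult = (\<lambda>a \<mu> x. a \<otimes>\<^bsub>R\<^esub> \<mu> x)\<rparr>"

lemma left_module_free_left:
  assumes "ring R"
  shows "left_module R (free_left R B)"
proof -
  interpret R: ring R by (rule assms)
  have ab: "abelian_group (free_left R B)"
    by (rule abelian_group_fin_fun[OF R.abelian_group_axioms, of _ B]) (simp_all add: free_left_def)
  show ?thesis
    unfolding left_module_def using assms ab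
    by (simp add: free_left_def R.fin_fun_smult fin_funD(1) R.r_distr R.l_distr R.m_assoc)
qed

text \<open>
  A coset is represented by the code of one chosen element of it.
\<close>

lemma quotient_module_exists:
  fixes A :: "('r, 'a) module" and e :: "'a \<Rightarrow> 'u"
  assumes A: "left_module R A" and e: "inj_on e (carrier A)"
    and N: "N \<subseteq> carrier A" "\<zero>\<^bsub>A\<^esub> \<in> N"
      "\<And>x y. x \<in> N \<Longrightarrow> y \<in> N \<Longrightarrow> x \<oplus>\<^bsub>A\<^esub> y \<in> N" "\<And>a x. a \<in> carrier R \<Longrightarrow> x \<in> N \<Longrightarrow> a \<odot>\<^bsub>A\<^esub> x \<in> N"
  obtains Q :: "('r, 'u) module" and \<pi> where "left_module R Q" "carrier Q = \<pi> ` carrier A"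
    "\<And>x y. x \<in> carrier A \<Longrightarrow> y \<in> carrier A \<Longrightarrow> \<pi> (x \<oplus>\<^bsub>A\<^esub> y) = \<pi> x \<oplus>\<^bsub>Q\<^esub> \<pi> y"
    "\<And>a x. a \<in> carrier R \<Longrightarrow> x \<in> carrier A \<Longrightarrow> \<pi> (a \<odot>\<^bsub>A\<^esub> x) = a \<odot>\<^bsub>Q\<^esub> \<pi> x"
    "\<And>x. x \<in> carrier A \<Longrightarrow> \<pi> x = \<zero>\<^bsub>Q\<^esub> \<longleftrightarrow> x \<in> N"
proof -
  interpret R: ring R using left_moduleD(1)[OF A] .
  interpret A: abelian_group A using left_moduleD(2)[OF A] .
  note smult = left_moduleD(3)[OF A]
  have neg: "\<ominus>\<^bsub>A\<^esub> x = (\<ominus>\<^bsub>R\<^esub> \<one>\<^bsub>R\<^esub>) \<odot>\<^bsub>A\<^esub> x" if x: "x \<in> carrier A" for x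
  proof -
    have "(\<ominus>\<^bsub>R\<^esub> \<one>\<^bsub>R\<^esub>) \<odot>\<^bsub>A\<^esub> x \<oplus>\<^bsub>A\<^esub> x = (\<ominus>\<^bsub>R\<^esub> \<one>\<^bsub>R\<^esub>) \<odot>\<^bsub>A\<^esub> x \<oplus>\<^bsub>A\<^esub> \<one>\<^bsub>R\<^esub> \<odot>\<^bsub>A\<^esub> x"
      by (simp only: left_moduleD(7)[OF A x])
    also have "\<dots> = (\<ominus>\<^bsub>R\<^esub> \<one>\<^bsub>R\<^esub> \<oplus>\<^bsub>R\<^esub> \<one>\<^bsub>R\<^esub>) \<odot>\<^bsub>A\<^esub> x"
      using left_moduleD(4)[OF A _ _ x] by simp
    also have "\<dots> = \<zero>\<^bsub>A\<^esub>" using left_module_smult_zero[OF A x] by (simp add: R.l_neg)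
    finally show ?thesis using x smult[OF _ x] by (intro A.minus_equality) simp_all
  qed
  have N_neg: "\<ominus>\<^bsub>A\<^esub> x \<in> N" if "x \<in> N" for x
    using N(1) N(4)[of "\<ominus>\<^bsub>R\<^esub> \<one>\<^bsub>R\<^esub>" x] neg[of x] that by auto
  define eqv where "eqv x y \<longleftrightarrow> x \<ominus>\<^bsub>A\<^esub> y \<in> N" for x y
  have eqv_refl: "eqv x x" if "x \<in> carrier A" for x using that N(2) by (simp add: eqv_def A.r_neg A.minus_eq)
  have eqv_sym: "eqv y x" if "x \<in> carrier A" "y \<in> carrier A" "eqv x y" for x y
  proof -
    have "y \<ominus>\<^bsub>A\<^esub> x = \<ominus>\<^bsub>A\<^esub> (x \<ominus>\<^bsub>A\<^esub> y)" using that(1,2) by (simp add: A.minus_eq A.minus_add A.a_comm)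
    then show ?thesis using N_neg that(3) unfolding eqv_def by simp
  qed
  have eqv_trans: "eqv x z" if "x \<in> carrier A" "y \<in> carrier A" "z \<in> carrier A" "eqv x y" "eqv y z" for x y z
  proof -
    have "x \<ominus>\<^bsub>A\<^esub> z = (x \<ominus>\<^bsub>A\<^esub> y) \<oplus>\<^bsub>A\<^esub> (y \<ominus>\<^bsub>A\<^esub> z)"
      using that(1-3) by (simp add: A.minus_eq A.a_assoc A.r_neg1)
    then show ?thesis using N(3) that(4,5) unfolding eqv_def by simp
  qed
  define rep where "rep x = (SOME y. y \<in> carrier A \<and> eqv x y)" for x
  have rep: "rep x \<in> carrier A" "eqv x (rep x)" if "x \<in> carrier A" for x
    using someI[of "\<lambda>y. y \<in> carrier A \<and> eqv x y" x] that eqv_refl[OF that] unfolding rep_def by auto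
  have rep_eq: "rep x = rep y \<longleftrightarrow> eqv x y" if x: "x \<in> carrier A" and y: "y \<in> carrier A" for x y
  proof
    assume "rep x = rep y"
    then show "eqv x y" using eqv_trans[OF x rep(1)[OF y] y] eqv_sym[OF y rep(1)[OF y] rep(2)[OF y]] rep(2)[OF x] by simp
  next
    assume "eqv x y"
    then have "(z \<in> carrier A \<and> eqv x z) = (z \<in> carrier A \<and> eqv y z)" for z
      using eqv_trans[OF x y] eqv_trans[OF y x] eqv_sym[OF x y] by blast
    then show "rep x = rep y" unfolding rep_def by simp
  qed
  define \<pi> where "\<pi> x = e (rep x)" for x
  define d where "d = inv_into (carrier A) e"
  have d: "d (\<pi> x) = rep x" if "x \<in> carrier A" for x
    unfolding d_def \<pi>_def by (rule inv_into_f_f[OF e rep(1)[OF that]])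
  have \<pi>_eq: "\<pi> x = \<pi> y \<longleftrightarrow> eqv x y" if x: "x \<in> carrier A" and y: "y \<in> carrier A" for x y
    using rep_eq[OF x y] inj_on_eq_iff[OF e rep(1)[OF x] rep(1)[OF y]] by (simp add: \<pi>_def)
  define Q :: "('r, 'u) module" where "Q = \<lparr>carrier = \<pi> ` carrier A, monoid.mult = undefined, one = undefined,
     ring.zero = \<pi> \<zero>\<^bsub>A\<^esub>, ring.add = (\<lambda>u v. \<pi> (d u \<oplus>\<^bsub>A\<^esub> d v)), smult = (\<lambda>a u. \<pi> (a \<odot>\<^bsub>A\<^esub> d u))\<rparr>"
  have Q_car: "carrier Q = \<pi> ` carrier A" and Q_zero: "\<zero>\<^bsub>Q\<^esub> = \<pi> \<zero>\<^bsub>A\<^esub>" by (simp_all add: Q_def)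
  have Q_add: "\<pi> x \<oplus>\<^bsub>Q\<^esub> \<pi> y = \<pi> (x \<oplus>\<^bsub>A\<^esub> y)" if x: "x \<in> carrier A" and y: "y \<in> carrier A" for x y
  proof -
    have "(x \<oplus>\<^bsub>A\<^esub> y) \<ominus>\<^bsub>A\<^esub> (rep x \<oplus>\<^bsub>A\<^esub> rep y) = (x \<ominus>\<^bsub>A\<^esub> rep x) \<oplus>\<^bsub>A\<^esub> (y \<ominus>\<^bsub>A\<^esub> rep y)"
      using x y rep(1)[OF x] rep(1)[OF y] by (simp add: A.minus_eq A.minus_add A.a_ac)
    then have "eqv (x \<oplus>\<^bsub>A\<^esub> y) (rep x \<oplus>\<^bsub>A\<^esub> rep y)"
      using N(3) rep(2)[OF x] rep(2)[OF y] unfolding eqv_def by simp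
    then have "\<pi> (x \<oplus>\<^bsub>A\<^esub> y) = \<pi> (rep x \<oplus>\<^bsub>A\<^esub> rep y)" using \<pi>_eq x y rep(1)[OF x] rep(1)[OF y] by simp
    then show ?thesis using d[OF x] d[OF y] by (simp add: Q_def)
  qed
  have Q_smult: "a \<odot>\<^bsub>Q\<^esub> \<pi> x = \<pi> (a \<odot>\<^bsub>A\<^esub> x)" if a: "a \<in> carrier R" and x: "x \<in> carrier A" for a x
  proof -
    note rx = rep(1)[OF x]
    have "a \<odot>\<^bsub>A\<^esub> (\<ominus>\<^bsub>A\<^esub> rep x) \<oplus>\<^bsub>A\<^esub> a \<odot>\<^bsub>A\<^esub> rep x = \<zero>\<^bsub>A\<^esub>"
      using left_moduleD(5)[OF A a A.a_inv_closed[OF rx] rx] left_module_smult_zero_right[OF A a] A.l_neg[OF rx] by simp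
    then have "\<ominus>\<^bsub>A\<^esub> (a \<odot>\<^bsub>A\<^esub> rep x) = a \<odot>\<^bsub>A\<^esub> (\<ominus>\<^bsub>A\<^esub> rep x)"
      using smult[OF a] rx by (intro A.minus_equality) simp_all
    then have "(a \<odot>\<^bsub>A\<^esub> x) \<ominus>\<^bsub>A\<^esub> (a \<odot>\<^bsub>A\<^esub> rep x) = a \<odot>\<^bsub>A\<^esub> (x \<ominus>\<^bsub>A\<^esub> rep x)"
      using left_moduleD(5)[OF A a x A.a_inv_closed[OF rx]] by (simp add: A.minus_eq)
    then have "eqv (a \<odot>\<^bsub>A\<^esub> x) (a \<odot>\<^bsub>A\<^esub> rep x)"
      using N(4)[OF a] rep(2)[OF x] unfolding eqv_def by simp
    then have "\<pi> (a \<odot>\<^bsub>A\<^esub> x) = \<pi> (a \<odot>\<^bsub>A\<^esub> rep x)" using \<pi>_eq smult[OF a x] smult[OF a rx] by simp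
    then show ?thesis using d[OF x] by (simp add: Q_def)
  qed
  have "left_module R Q" by (rule left_module_image[OF A Q_car Q_add Q_smult Q_zero])
  moreover have "\<pi> x = \<zero>\<^bsub>Q\<^esub> \<longleftrightarrow> x \<in> N" if "x \<in> carrier A" for x
    unfolding Q_zero using \<pi>_eq[OF that A.zero_closed] that
      A.minus_equality[OF A.l_zero[OF A.zero_closed] A.zero_closed A.zero_closed]
    by (simp add: eqv_def A.minus_eq)
  ultimately show thesis using that[of Q \<pi>] Q_car Q_add Q_smult by simp
qed

lemma presentation_exists:
  fixes R :: "('r, 'k) ring_scheme" and Y :: "'x set" and enc :: "('x \<Rightarrow> 'r) \<Rightarrow> 'u"
  assumes R: "ring R" and enc: "inj_on enc (fin_fun UNIV R)" and N: "N \<subseteq> fin_fun Y R"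
  shows "\<exists>(Q :: ('r, 'u) module) \<pi>. presents R Y N Q \<pi>"
proof -
  interpret R: ring R by (rule R)
  have "fin_fun Y R \<subseteq> fin_fun UNIV R" by (rule fin_fun_mono[OF subset_UNIV])
  then have e: "inj_on enc (carrier (free_left R Y))"
    using inj_on_subset[OF enc] by (simp add: free_left_def)
  obtain Q :: "('r, 'u) module" and \<pi> where "left_module R Q" "carrier Q = \<pi> ` carrier (free_left R Y)"
    "\<And>x y. x \<in> carrier (free_left R Y) \<Longrightarrow> y \<in> carrier (free_left R Y) \<Longrightarrow> \<pi> (x \<oplus>\<^bsub>free_left R Y\<^esub> y) = \<pi> x \<oplus>\<^bsub>Q\<^esub> \<pi> y"
    "\<And>a x. a \<in> carrier R \<Longrightarrow> x \<in> carrier (free_left R Y) \<Longrightarrow> \<pi> (a \<odot>\<^bsub>free_left R Y\<^esub> x) = a \<odot>\<^bsub>Q\<^esub> \<pi> x"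
    "\<And>x. x \<in> carrier (free_left R Y) \<Longrightarrow> \<pi> x = \<zero>\<^bsub>Q\<^esub> \<longleftrightarrow> x \<in> span R N"
    by (rule quotient_module_exists[OF left_module_free_left[OF R] e, of "span R N"])
       (use R.span_sub[OF N] span.zero[of R N] in \<open>auto simp: free_left_def intro: span.add span.smult\<close>)
  then show ?thesis unfolding presents_def by (intro exI[of _ Q] exI[of _ \<pi>]) (simp add: free_left_def)
qed

definition presentation_data :: "('r, 'k) ring_scheme \<Rightarrow> ('u set \<times> ('u \<Rightarrow> 'r) set) set" where
  "presentation_data R = {(Y, N). finite Y \<and> finite N \<and> N \<subseteq> fin_fun Y R}"

text \<open>
  For \<open>i = (Y, N)\<close> these are the homomorphisms to \<open>S\<close> from the module presented by \<open>i\<close>, given by the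
  images \<open>s y\<close> of the generators; the values outside \<open>Y\<close> are arbitrary.
\<close>

definition solutions ::
  "('r, 'u) module \<Rightarrow> 'u set \<times> ('u \<Rightarrow> 'r) set \<Rightarrow> ('u \<Rightarrow> 'u) set" where
  "solutions S i = {s. (\<forall>y\<in>fst i. s y \<in> carrier S) \<and> (\<forall>n\<in>snd i. lin S (fst i) n s = \<zero>\<^bsub>S\<^esub>)}"

locale presentations =
  fixes R :: "('r, 'k) ring_scheme"
    and P :: "'u set \<times> ('u \<Rightarrow> 'r) set \<Rightarrow> ('r, 'u) module"
    and \<pi> :: "'u set \<times> ('u \<Rightarrow> 'r) set \<Rightarrow> ('u \<Rightarrow> 'r) \<Rightarrow> 'u"
  assumes R: "ring R" and U: "infinite (UNIV :: 'u set)" and small: "carrier R \<lesssim> (UNIV :: 'u set)"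
    and presents: "\<And>i. i \<in> presentation_data R \<Longrightarrow> presents R (fst i) (snd i) (P i) (\<pi> i)"
begin

sublocale R: ring R by (rule R)

lemma data:
  assumes "i \<in> presentation_data R"
  shows "finite (fst i)" "finite (snd i)" "snd i \<subseteq> fin_fun (fst i) R"
  using assms unfolding presentation_data_def by auto

lemma P:
  assumes i: "i \<in> presentation_data R"
  shows "left_module R (P i)" "carrier (P i) = \<pi> i ` fin_fun (fst i) R"
    "\<And>f g. f \<in> fin_fun (fst i) R \<Longrightarrow> g \<in> fin_fun (fst i) R \<Longrightarrow>
       \<pi> i (\<lambda>x. f x \<oplus>\<^bsub>R\<^esub> g x) = \<pi> i f \<oplus>\<^bsub>P i\<^esub> \<pi> i g"
    "\<And>a f. a \<in> carrier R \<Longrightarrow> f \<in> fin_fun (fst i) R \<Longrightarrow> \<pi> i (\<lambda>x. a \<otimes>\<^bsub>R\<^esub> f x) = a \<odot>\<^bsub>P i\<^esub> \<pi> i f"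
    "\<And>f. f \<in> fin_fun (fst i) R \<Longrightarrow> \<pi> i f = \<zero>\<^bsub>P i\<^esub> \<longleftrightarrow> f \<in> span R (snd i)"
  using presents[OF i] unfolding presents_def by auto

lemma solutionsD:
  assumes "s \<in> solutions S i"
  shows "\<And>y. y \<in> fst i \<Longrightarrow> s y \<in> carrier S" "\<And>n. n \<in> snd i \<Longrightarrow> lin S (fst i) n s = \<zero>\<^bsub>S\<^esub>"
  using assms unfolding solutions_def by auto

lemma lin_span:
  assumes S: "left_module R S" and i: "i \<in> presentation_data R" and s: "s \<in> solutions S i"
    and f: "f \<in> span R (snd i)"
  shows "lin S (fst i) f s = \<zero>\<^bsub>S\<^esub>"
proof -
  interpret S: abelian_group S using left_moduleD(2)[OF S] .
  note ff = subsetD[OF R.span_sub[OF data(3)[OF i]]]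
  note sc = solutionsD(1)[OF s]
  show ?thesis
    using f
  proof (induction rule: span.induct)
    case zero
    show ?case by (rule lin_zero[OF S sc])
  next
    case (incl n)
    then show ?case by (rule solutionsD(2)[OF s])
  next
    case (add g h)
    then show ?case using lin_add[OF S ff[OF add(1)] ff[OF add(2)] sc] by simp
  next
    case (smult a g)
    then show ?case
      using lin_smult[OF S ff[OF smult(2)] smult(1) data(1)[OF i] sc] left_module_smult_zero_right[OF S smult(1)] by simp
  qed
qed

definition lift :: "('r, 'u) module \<Rightarrow> 'u set \<times> ('u \<Rightarrow> 'r) set \<Rightarrow> ('u \<Rightarrow> 'u) \<Rightarrow> 'u \<Rightarrow> 'u" where
  "lift S i s = restrict (\<lambda>u. lin S (fst i) (inv_into (fin_fun (fst i) R) (\<pi> i) u) s) (carrier (P i))"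

text \<open>
  The value does not depend on the combination of generators chosen by \<open>inv_into\<close>: two combinations
  with the same class differ by an element of the span of the relations, which \<open>s\<close> annihilates.
\<close>

lemma lift_\<pi>:
  assumes S: "left_module R S" and i: "i \<in> presentation_data R" and s: "s \<in> solutions S i"
    and f: "f \<in> fin_fun (fst i) R"
  shows "lift S i s (\<pi> i f) = lin S (fst i) f s"
proof -
  interpret S: abelian_group S using left_moduleD(2)[OF S] .
  interpret Pi: abelian_group "P i" using left_moduleD(2)[OF P(1)[OF i]] .
  let ?g = "inv_into (fin_fun (fst i) R) (\<pi> i) (\<pi> i f)"
  have mem: "\<pi> i f \<in> \<pi> i ` fin_fun (fst i) R" using f by blast
  have g: "?g \<in> fin_fun (fst i) R" "\<pi> i ?g = \<pi> i f"
    by (rule inv_into_into[OF mem], rule f_inv_into_f[OF mem])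
  let ?h = "\<lambda>x. f x \<ominus>\<^bsub>R\<^esub> ?g x"
  have h: "?h \<in> fin_fun (fst i) R" by (rule R.fin_fun_minus[OF f g(1)])
  have sum: "(\<lambda>x. ?h x \<oplus>\<^bsub>R\<^esub> ?g x) = f"
    using fin_funD(1)[OF f] fin_funD(1)[OF g(1)] by (simp add: R.minus_eq R.a_assoc R.l_neg)
  have "\<pi> i f = \<pi> i ?h \<oplus>\<^bsub>P i\<^esub> \<pi> i f"
    using P(3)[OF i h g(1)] sum g(2) by simp
  moreover have "\<pi> i f \<in> carrier (P i)" "\<pi> i ?h \<in> carrier (P i)" using P(2)[OF i] f h by blast+
  ultimately have "\<pi> i ?h = \<zero>\<^bsub>P i\<^esub>" by (metis Pi.add.r_cancel_one')
  then have "?h \<in> span R (snd i)" using P(5)[OF i h] by simp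
  then have "lin S (fst i) ?h s = \<zero>\<^bsub>S\<^esub>" by (rule lin_span[OF S i s])
  then have "lin S (fst i) f s = lin S (fst i) ?g s"
    using lin_add[OF S h g(1) solutionsD(1)[OF s]] sum lin_closed[OF S g(1) solutionsD(1)[OF s]] by simp
  then show ?thesis unfolding lift_def using P(2)[OF i] f by simp
qed

lemma lift_linear:
  assumes S: "left_module R S" and i: "i \<in> presentation_data R" and s: "s \<in> solutions S i"
  shows "lift S i s \<in> linear_maps R (P i) S"
proof -
  note l = lift_\<pi>[OF S i s]
  note sc = solutionsD(1)[OF s]
  have "lift S i s \<in> carrier (P i) \<rightarrow>\<^sub>E carrier S"
  proof (rule PiE_I)
    show "lift S i s u \<in> carrier S" if "u \<in> carrier (P i)" for u
      using that l lin_closed[OF S _ sc] unfolding P(2)[OF i] by fastforce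
    show "lift S i s u = undefined" if "u \<notin> carrier (P i)" for u using that by (simp add: lift_def)
  qed
  moreover have "lift S i s (u \<oplus>\<^bsub>P i\<^esub> v) = lift S i s u \<oplus>\<^bsub>S\<^esub> lift S i s v"
    if u: "u \<in> carrier (P i)" and v: "v \<in> carrier (P i)" for u v
  proof -
    obtain f g where f: "f \<in> fin_fun (fst i) R" "u = \<pi> i f" and g: "g \<in> fin_fun (fst i) R" "v = \<pi> i g"
      using u v unfolding P(2)[OF i] by blast
    show ?thesis
      unfolding f(2) g(2) P(3)[OF i f(1) g(1), symmetric] l[OF f(1)] l[OF g(1)] l[OF R.fin_fun_add[OF f(1) g(1)]]
      by (rule lin_add[OF S f(1) g(1) sc])
  qed
  moreover have "lift S i s (a \<odot>\<^bsub>P i\<^esub> u) = a \<odot>\<^bsub>S\<^esub> lift S i s u"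
    if a: "a \<in> carrier R" and u: "u \<in> carrier (P i)" for a u
  proof -
    obtain f where f: "f \<in> fin_fun (fst i) R" "u = \<pi> i f"
      using u unfolding P(2)[OF i] by blast
    show ?thesis
      unfolding f(2) P(4)[OF i a f(1), symmetric] l[OF f(1)] l[OF R.fin_fun_smult[OF a f(1)]]
      by (rule lin_smult[OF S f(1) a data(1)[OF i] sc])
  qed
  ultimately show ?thesis unfolding linear_maps_def by simp
qed

lemma linear_maps_eqI:
  assumes i: "i \<in> presentation_data R" and p: "p \<in> linear_maps R (P i) S" and q: "q \<in> linear_maps R (P i) S"
    and eq: "\<And>f. f \<in> fin_fun (fst i) R \<Longrightarrow> p (\<pi> i f) = q (\<pi> i f)"
  shows "p = q"
proof (rule extensionalityI[OF linear_mapsD(4)[OF p] linear_mapsD(4)[OF q]])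
  fix u assume "u \<in> carrier (P i)"
  then show "p u = q u" unfolding P(2)[OF i] using eq by blast
qed

lemma lift_cong:
  assumes "\<And>y. y \<in> fst i \<Longrightarrow> s y \<in> carrier S" "\<And>y. y \<in> fst i \<Longrightarrow> s' y = s y"
    and S: "left_module R S" and i: "i \<in> presentation_data R"
  shows "lift S i s' = lift S i s"
proof -
  have "lin S (fst i) (inv_into (fin_fun (fst i) R) (\<pi> i) u) s' = lin S (fst i) (inv_into (fin_fun (fst i) R) (\<pi> i) u) s"
    if "u \<in> carrier (P i)" for u
    by (rule lin_cong[OF S inv_into_into assms(1,2)]) (use that P(2)[OF i] in auto)
  then show ?thesis unfolding lift_def by (auto simp: restrict_def)
qed

lemma solutions_add:
  assumes S: "left_module R S" and i: "i \<in> presentation_data R" and s: "s \<in> solutions S i" and t: "t \<in> solutions S i"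
  shows "(\<lambda>y. s y \<oplus>\<^bsub>S\<^esub> t y) \<in> solutions S i"
proof -
  interpret S: abelian_group S using left_moduleD(2)[OF S] .
  have "lin S (fst i) n (\<lambda>y. s y \<oplus>\<^bsub>S\<^esub> t y) = \<zero>\<^bsub>S\<^esub>" if "n \<in> snd i" for n
    using lin_add_right[OF S subsetD[OF data(3)[OF i] that] solutionsD(1)[OF s] solutionsD(1)[OF t]]
      solutionsD(2)[OF s that] solutionsD(2)[OF t that] by simp
  then show ?thesis
    using solutionsD(1)[OF s] solutionsD(1)[OF t] unfolding solutions_def by simp
qed

lemma lift_add:
  assumes S: "left_module R S" and i: "i \<in> presentation_data R" and s: "s \<in> solutions S i" and t: "t \<in> solutions S i"
  shows "lift S i (\<lambda>y. s y \<oplus>\<^bsub>S\<^esub> t y) = linear_add (P i) S (lift S i s) (lift S i t)"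
proof (rule linear_maps_eqI[OF i lift_linear[OF S i solutions_add[OF S i s t]]
      linear_add_closed[OF P(1)[OF i] S lift_linear[OF S i s] lift_linear[OF S i t]]])
  fix f assume f: "f \<in> fin_fun (fst i) R"
  then have "\<pi> i f \<in> carrier (P i)" unfolding P(2)[OF i] by blast
  then show "lift S i (\<lambda>y. s y \<oplus>\<^bsub>S\<^esub> t y) (\<pi> i f) = linear_add (P i) S (lift S i s) (lift S i t) (\<pi> i f)"
    unfolding lift_\<pi>[OF S i solutions_add[OF S i s t] f]
    using lin_add_right[OF S f solutionsD(1)[OF s] solutionsD(1)[OF t]]
    by (simp add: linear_add_def lift_\<pi>[OF S i s f] lift_\<pi>[OF S i t f])
qed

lemma solutions_linear:
  assumes S: "left_module R S" and T: "left_module R T" and f: "f \<in> linear_maps R S T"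
    and i: "i \<in> presentation_data R" and s: "s \<in> solutions S i"
  shows "(\<lambda>y. f (s y)) \<in> solutions T i"
proof -
  have "lin T (fst i) n (\<lambda>y. f (s y)) = \<zero>\<^bsub>T\<^esub>" if "n \<in> snd i" for n
    using lin_linear_map[where s = s, OF S T f subsetD[OF data(3)[OF i] that] data(1)[OF i] solutionsD(1)[OF s]]
      solutionsD(2)[OF s that] linear_maps_zero[OF S T f] by simp
  then show ?thesis using linear_mapsD(1)[OF f] solutionsD(1)[OF s] unfolding solutions_def by simp
qed

lemma lift_natural:
  assumes S: "left_module R S" and T: "left_module R T" and f: "f \<in> linear_maps R S T"
    and i: "i \<in> presentation_data R" and s: "s \<in> solutions S i"
  shows "lift T i (\<lambda>y. f (s y)) = compose (carrier (P i)) f (lift S i s)"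
proof (rule linear_maps_eqI[OF i lift_linear[OF T i solutions_linear[OF S T f i s]]
      linear_compose[OF lift_linear[OF S i s] f P(1)[OF i]]])
  fix g assume g: "g \<in> fin_fun (fst i) R"
  then have "\<pi> i g \<in> carrier (P i)" unfolding P(2)[OF i] by blast
  then show "lift T i (\<lambda>y. f (s y)) (\<pi> i g) = compose (carrier (P i)) f (lift S i s) (\<pi> i g)"
    unfolding lift_\<pi>[OF T i solutions_linear[OF S T f i s] g]
    using lin_linear_map[OF S T f g data(1)[OF i] solutionsD(1)[OF s]]
    by (simp add: compose_def lift_\<pi>[OF S i s g])
qed

lemma solutions_zero:
  assumes "left_module R S" "i \<in> presentation_data R"
  shows "(\<lambda>_. \<zero>\<^bsub>S\<^esub>) \<in> solutions S i"
  using lin_zero_right[OF assms(1) subsetD[OF data(3)[OF assms(2)]]] abelian_groupE(2)[OF left_moduleD(2)[OF assms(1)]]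
  unfolding solutions_def by simp

text \<open>
  An additive functor sends the zero map to the zero map, because \<open>0 + 0 = 0\<close>. This makes the sums over
  all elements of all \<open>F(P)\<close> in the covering of \<open>F\<close> finite.
\<close>

lemma farr_lift_zero:
  assumes F: "functor_module R F" and S: "left_module R S" and i: "i \<in> presentation_data R"
    and z: "z \<in> carrier (fobj F (P i))"
  shows "farr F (P i) S (lift S i (\<lambda>_. \<zero>\<^bsub>S\<^esub>)) z = \<one>\<^bsub>fobj F S\<^esub>"
proof -
  interpret S: abelian_group S using left_moduleD(2)[OF S] .
  interpret FS: group "fobj F S" by (rule functor_module_group[OF F S])
  let ?l = "lift S i (\<lambda>_. \<zero>\<^bsub>S\<^esub>)"
  note l = lift_linear[OF S i solutions_zero[OF S i]]
  have "?l = linear_add (P i) S ?l ?l"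
    using lift_add[OF S i solutions_zero[OF S i] solutions_zero[OF S i]] by simp
  then have "farr F (P i) S ?l z = farr F (P i) S ?l z \<otimes>\<^bsub>fobj F S\<^esub> farr F (P i) S ?l z"
    using functor_moduleD(5)[OF F P(1)[OF i] S l l z] by simp
  then show ?thesis
    using farr_closed[OF F P(1)[OF i] S l z] by (metis FS.r_cancel_one')
qed

lemma lin_generators:
  assumes i: "i \<in> presentation_data R" and Y: "Y \<subseteq> fst i" and f: "f \<in> fin_fun Y R"
  shows "lin (P i) Y f (\<lambda>y. \<pi> i (single R y \<one>\<^bsub>R\<^esub>)) = \<pi> i f"
proof -
  interpret Pi: abelian_group "P i" using left_moduleD(2)[OF P(1)[OF i]] .
  have fin: "finite Y" using data(1)[OF i] Y finite_subset by blast
  have one: "single R y \<one>\<^bsub>R\<^esub> \<in> fin_fun (fst i) R" if "y \<in> Y" for y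
    by (rule R.fin_fun_single[OF _ R.one_closed]) (use that Y in blast)
  have gen: "\<pi> i (single R y \<one>\<^bsub>R\<^esub>) \<in> carrier (P i)" if "y \<in> Y" for y
    unfolding P(2)[OF i] using one[OF that] by blast
  show ?thesis
    using f
  proof (induction rule: R.fin_fun_induct)
    case zero
    have "\<pi> i (\<lambda>_. \<zero>\<^bsub>R\<^esub>) = \<zero>\<^bsub>P i\<^esub>" using P(5)[OF i R.fin_fun_zero] span.zero by blast
    then show ?case using lin_zero[OF P(1)[OF i] gen] by simp
  next
    case (single y a)
    have "a \<odot>\<^bsub>P i\<^esub> \<pi> i (single R y \<one>\<^bsub>R\<^esub>) = \<pi> i (\<lambda>x. a \<otimes>\<^bsub>R\<^esub> single R y \<one>\<^bsub>R\<^esub> x)"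
      using P(4)[OF i single(2) one[OF single(1)]] by simp
    also have "(\<lambda>x. a \<otimes>\<^bsub>R\<^esub> single R y \<one>\<^bsub>R\<^esub> x) = single R y a"
      using single(2) by (auto simp: single_def)
    finally show ?case using lin_single[OF P(1)[OF i] fin single(1,2) gen] by simp
  next
    case (add g h)
    have gh: "g \<in> fin_fun (fst i) R" "h \<in> fin_fun (fst i) R" using add(1,2) fin_fun_mono[OF Y] by blast+
    show ?case using lin_add[OF P(1)[OF i] add(1,2) gen] add(3,4) P(3)[OF i gh] by simp
  qed
qed

text \<open>
  More generators and more relations give a module that receives a map, the identity on the common
  generators. These are the transition maps of the system whose limit is a given module.
\<close>

lemma transition:
  assumes i: "i \<in> presentation_data R" and j: "j \<in> presentation_data R"
    and sub: "fst i \<subseteq> fst j" "snd i \<subseteq> snd j"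
  shows "(\<lambda>y. \<pi> j (single R y \<one>\<^bsub>R\<^esub>)) \<in> solutions (P j) i"
    and "\<And>f. f \<in> fin_fun (fst i) R \<Longrightarrow> lift (P j) i (\<lambda>y. \<pi> j (single R y \<one>\<^bsub>R\<^esub>)) (\<pi> i f) = \<pi> j f"
proof -
  have "\<pi> j (single R y \<one>\<^bsub>R\<^esub>) \<in> carrier (P j)" if "y \<in> fst i" for y
    unfolding P(2)[OF j] using R.fin_fun_single[OF subsetD[OF sub(1) that] R.one_closed] by (rule imageI)
  moreover have "lin (P j) (fst i) n (\<lambda>y. \<pi> j (single R y \<one>\<^bsub>R\<^esub>)) = \<zero>\<^bsub>P j\<^esub>" if n: "n \<in> snd i" for n
  proof -
    have "n \<in> fin_fun (fst j) R" "n \<in> span R (snd j)"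
      using n sub(2) data(3)[OF j] by (auto intro: span.incl)
    then have "\<pi> j n = \<zero>\<^bsub>P j\<^esub>" using P(5)[OF j] by blast
    then show ?thesis using lin_generators[OF j sub(1) subsetD[OF data(3)[OF i] n]] by simp
  qed
  ultimately show sol: "(\<lambda>y. \<pi> j (single R y \<one>\<^bsub>R\<^esub>)) \<in> solutions (P j) i"
    unfolding solutions_def by blast
  show "lift (P j) i (\<lambda>y. \<pi> j (single R y \<one>\<^bsub>R\<^esub>)) (\<pi> i f) = \<pi> j f" if "f \<in> fin_fun (fst i) R" for f
    unfolding lift_\<pi>[OF P(1)[OF j] i sol that] by (rule lin_generators[OF j sub(1) that])
qed

lemma data_lepoll: "(presentation_data R :: ('u set \<times> ('u \<Rightarrow> 'r) set) set) \<lesssim> (UNIV :: 'u set)"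
proof -
  have ff: "fin_fun (UNIV :: 'u set) R \<lesssim> (UNIV :: 'u set)"
    by (rule fin_fun_lepoll_infinite[OF U lepoll_refl small])
  have "fin_fun Y R \<subseteq> fin_fun UNIV R" for Y :: "'u set" by (rule fin_fun_mono[OF subset_UNIV])
  then have "(presentation_data R :: ('u set \<times> ('u \<Rightarrow> 'r) set) set) \<subseteq> Fpow UNIV \<times> Fpow (fin_fun UNIV R)"
    unfolding presentation_data_def Fpow_def by blast
  moreover have "Fpow (UNIV :: 'u set) \<times> Fpow (fin_fun (UNIV :: 'u set) R) \<lesssim> (UNIV :: 'u set)"
    by (rule times_lepoll_infinite[OF U Fpow_lepoll_infinite[OF U lepoll_refl] Fpow_lepoll_infinite[OF U ff]])
  ultimately show ?thesis using subset_imp_lepoll lepoll_trans by blast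
qed

text \<open>
  The module \<open>S\<close> is the direct limit of the modules presented by the pairs \<open>(Y, N)\<close> of a finite subset \<open>Y\<close>
  of \<open>S\<close> and a finite set \<open>N\<close> of relations that hold between the elements of \<open>Y\<close>, each element being
  sent to itself: \<open>x\<close> comes from the stage \<open>({x}, {})\<close>, and a combination of generators that vanishes
  in \<open>S\<close> vanishes at the stage where it has been added to the relations. Since \<open>F\<close> preserves this
  limit, each element of \<open>F(S)\<close> comes from some \<open>F(P i)\<close>.
\<close>

lemma limit_of_presentations:
  assumes F: "functor_module R (F :: ('r, 'u, 'b) functr)" "preserves_direct_limits R F" and S: "left_module R S"
    and y: "y \<in> carrier (fobj F S)"
  obtains i z where "i \<in> presentation_data R" "(\<lambda>x. x) \<in> solutions S i" "z \<in> carrier (fobj F (P i))"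
    "farr F (P i) S (lift S i (\<lambda>x. x)) z = y"
proof -
  interpret S: abelian_group S using left_moduleD(2)[OF S] .
  \<comment> \<open>Index sets of direct systems are subsets of \<open>'u\<close>, so the presentations are coded by its elements.\<close>
  obtain code :: "'u set \<times> ('u \<Rightarrow> 'r) set \<Rightarrow> 'u" where code: "inj_on code (presentation_data R)"
    using data_lepoll unfolding lepoll_def by blast
  define dec where "dec = inv_into (presentation_data R) code"
  have dec: "dec (code i) = i" if "i \<in> presentation_data R" for i
    unfolding dec_def using code that by (rule inv_into_f_f)
  define I0 where "I0 = {i \<in> presentation_data R. (\<lambda>x. x) \<in> solutions S i}"
  define I where "I = code ` I0"
  define r where "r = {(i, j). i \<in> I \<and> j \<in> I \<and> fst (dec i) \<subseteq> fst (dec j) \<and> snd (dec i) \<subseteq> snd (dec j)}"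
  have dec_I: "dec i \<in> presentation_data R" "(\<lambda>x. x) \<in> solutions S (dec i)" if "i \<in> I" for i
    using that dec unfolding I_def I0_def by auto
  have code_I: "code i \<in> I" "dec (code i) = i" if "i \<in> I0" for i
    using that dec unfolding I_def I0_def by auto
  have rD: "i \<in> I" "j \<in> I" "fst (dec i) \<subseteq> fst (dec j)" "snd (dec i) \<subseteq> snd (dec j)" if "(i, j) \<in> r" for i j
    using that unfolding r_def by auto
  let ?id = "\<lambda>x :: 'u. x"
  define T where "T i = P (dec i)" for i
  define s where "s i j = lift (T j) (dec i) (\<lambda>y. \<pi> (dec j) (single R y \<one>\<^bsub>R\<^esub>))" for i j
  define c where "c i = lift S (dec i) ?id" for i
  have T: "left_module R (T i)" if "i \<in> I" for i unfolding T_def by (rule P(1)[OF dec_I(1)[OF that]])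
  have s_lin: "s i j \<in> linear_maps R (T i) (T j)" if "(i, j) \<in> r" for i j
    unfolding s_def T_def using rD[OF that]
    by (intro lift_linear P(1) transition(1) dec_I(1)) simp_all
  have s_\<pi>: "s i j (\<pi> (dec i) f) = \<pi> (dec j) f" if "(i, j) \<in> r" "f \<in> fin_fun (fst (dec i)) R" for i j f
    unfolding s_def T_def using rD[OF that(1)] that(2) by (intro transition(2) dec_I(1)) simp_all
  have c_lin: "c i \<in> linear_maps R (T i) S" if "i \<in> I" for i
    unfolding c_def T_def by (rule lift_linear[OF S dec_I[OF that]])
  have c_\<pi>: "c i (\<pi> (dec i) f) = lin S (fst (dec i)) f ?id" if "i \<in> I" "f \<in> fin_fun (fst (dec i)) R" for i f
    unfolding c_def by (rule lift_\<pi>[OF S dec_I[OF that(1)] that(2)])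
  have \<pi>_in: "\<pi> (dec i) f \<in> carrier (T i)" if "i \<in> I" "f \<in> fin_fun (fst (dec i)) R" for i f
    unfolding T_def P(2)[OF dec_I(1)[OF that(1)]] using that(2) by blast
  have upper: "code (Y, N) \<in> I \<and> dec (code (Y, N)) = (Y, N)"
    if "finite Y" "finite N" "N \<subseteq> fin_fun Y R" "Y \<subseteq> carrier S" "\<And>n. n \<in> N \<Longrightarrow> lin S Y n ?id = \<zero>\<^bsub>S\<^esub>" for Y N
  proof -
    have "(Y, N) \<in> I0" using that unfolding I0_def presentation_data_def solutions_def by auto
    then show ?thesis using code_I by blast
  qed
  have directed: "directed_set I r"
    unfolding directed_set_def
  proof (intro conjI ballI)
    show "I \<noteq> {}" using upper[of "{}" "{}"] by auto
    show "preorder_on I r" unfolding preorder_on_def r_def refl_on_def trans_def by auto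
    fix i j assume i: "i \<in> I" and j: "j \<in> I"
    let ?Y = "fst (dec i) \<union> fst (dec j)" and ?N = "snd (dec i) \<union> snd (dec j)"
    note di = data[OF dec_I(1)[OF i]] and dj = data[OF dec_I(1)[OF j]]
    have Y: "finite ?Y" using di(1) dj(1) by simp
    have YS: "?Y \<subseteq> carrier S"
      using solutionsD(1)[OF dec_I(2)[OF i]] solutionsD(1)[OF dec_I(2)[OF j]] by blast
    have "code (?Y, ?N) \<in> I \<and> dec (code (?Y, ?N)) = (?Y, ?N)"
    proof (rule upper[OF Y _ _ YS])
      show "finite ?N" using di(2) dj(2) by simp
      show "?N \<subseteq> fin_fun ?Y R"
        using di(3) dj(3) fin_fun_mono[of "fst (dec i)" ?Y R] fin_fun_mono[of "fst (dec j)" ?Y R] by blast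
      fix n assume "n \<in> ?N"
      then show "lin S ?Y n ?id = \<zero>\<^bsub>S\<^esub>"
      proof
        assume n: "n \<in> snd (dec i)"
        show ?thesis
          using lin_mono[where s = ?id, OF S subsetD[OF di(3) n] Y _ subsetD[OF YS]] solutionsD(2)[OF dec_I(2)[OF i] n]
          by simp
      next
        assume n: "n \<in> snd (dec j)"
        show ?thesis
          using lin_mono[where s = ?id, OF S subsetD[OF dj(3) n] Y _ subsetD[OF YS]] solutionsD(2)[OF dec_I(2)[OF j] n]
          by simp
      qed
    qed
    then show "\<exists>k\<in>I. (i, k) \<in> r \<and> (j, k) \<in> r"
      using i j unfolding r_def by (intro bexI[of _ "code (?Y, ?N)"]) auto
  qed
  have refl_r: "(i, i) \<in> r" if "i \<in> I" for i using that unfolding r_def by simp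
  have id_lin: "linear_id (T i) \<in> linear_maps R (T i) (T i)" if "i \<in> I" for i
    using abelian_groupE(1)[OF left_moduleD(2)[OF T[OF that]]] left_moduleD(3)[OF T[OF that]]
    by (simp add: linear_maps_def linear_id_def)
  note eqI = linear_maps_eqI[OF dec_I(1), folded T_def]
  have system: "module_system R I r T s"
    unfolding module_system_def
  proof (intro conjI allI ballI impI)
    show "left_module R (T i)" if "i \<in> I" for i by (rule T[OF that])
    show "s i j \<in> linear_maps R (T i) (T j)" if "(i, j) \<in> r" for i j by (rule s_lin[OF that])
    show "s i i = linear_id (T i)" if i: "i \<in> I" for i
      by (rule eqI[OF i s_lin[OF refl_r[OF i]] id_lin[OF i]])
         (simp add: s_\<pi>[OF refl_r[OF i]] linear_id_def \<pi>_in[OF i])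
    fix i j k assume ij: "(i, j) \<in> r" and jk: "(j, k) \<in> r"
    have ik: "(i, k) \<in> r" using ij jk unfolding r_def by auto
    show "s i k = compose (carrier (T i)) (s j k) (s i j)"
    proof (rule eqI[OF rD(1)[OF ij] s_lin[OF ik] linear_compose[OF s_lin[OF ij] s_lin[OF jk] T[OF rD(1)[OF ij]]]])
      fix f assume f: "f \<in> fin_fun (fst (dec i)) R"
      have f': "f \<in> fin_fun (fst (dec j)) R" using f fin_fun_mono[OF rD(3)[OF ij]] by blast
      show "s i k (\<pi> (dec i) f) = compose (carrier (T i)) (s j k) (s i j) (\<pi> (dec i) f)"
        using \<pi>_in[OF rD(1)[OF ij] f] s_\<pi>[OF ik f] s_\<pi>[OF ij f] s_\<pi>[OF jk f'] by (simp add: compose_def)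
    qed
  qed
  have c_comp: "c i = compose (carrier (T i)) (c j) (s i j)" if ij: "(i, j) \<in> r" for i j
  proof (rule eqI[OF rD(1)[OF ij] c_lin[OF rD(1)[OF ij]] linear_compose[OF s_lin[OF ij] c_lin[OF rD(2)[OF ij]] T[OF rD(1)[OF ij]]]])
    fix f assume f: "f \<in> fin_fun (fst (dec i)) R"
    have f': "f \<in> fin_fun (fst (dec j)) R" using f fin_fun_mono[OF rD(3)[OF ij]] by blast
    have "lin S (fst (dec i)) f ?id = lin S (fst (dec j)) f ?id"
      by (rule lin_mono[OF S f data(1)[OF dec_I(1)[OF rD(2)[OF ij]]] rD(3)[OF ij]])
         (rule solutionsD(1)[OF dec_I(2)[OF rD(2)[OF ij]]])
    then show "c i (\<pi> (dec i) f) = compose (carrier (T i)) (c j) (s i j) (\<pi> (dec i) f)"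
      using \<pi>_in[OF rD(1)[OF ij] f] c_\<pi>[OF rD(1)[OF ij] f] s_\<pi>[OF ij f] c_\<pi>[OF rD(2)[OF ij] f'] by (simp add: compose_def)
  qed
  have cocone: "group_cocone I r (\<lambda>i. additive_group (T i)) s (additive_group S) c"
    by (rule module_group_cocone[OF directed system S c_lin c_comp])
  have "lim_map c \<in> iso (lim_group I r (\<lambda>i. additive_group (T i)) s) (additive_group S)"
  proof (rule iffD2[OF group_cocone.lim_map_iso_iff[OF cocone]], unfold additive_group_sel, intro conjI ballI impI)
    fix x assume x: "x \<in> carrier S"
    have k: "code ({x}, {}) \<in> I \<and> dec (code ({x}, {})) = ({x}, {})" by (rule upper) (use x in auto)
    let ?k = "code ({x}, {})" and ?f = "single R x \<one>\<^bsub>R\<^esub>"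
    have f: "?f \<in> fin_fun (fst (dec ?k)) R" using k by (simp add: R.fin_fun_single)
    have "lin S {x} ?f ?id = \<one>\<^bsub>R\<^esub> \<odot>\<^bsub>S\<^esub> x" by (rule lin_single[OF S]) (use x in auto)
    then have "c ?k (\<pi> (dec ?k) ?f) = x"
      using c_\<pi>[OF _ f] k left_moduleD(7)[OF S x] by simp
    then show "\<exists>i\<in>I. \<exists>u\<in>carrier (T i). c i u = x" using \<pi>_in[OF _ f] k by blast
  next
    fix i u assume i: "i \<in> I" and "u \<in> carrier (T i)" and zero: "c i u = \<zero>\<^bsub>S\<^esub>"
    then obtain f where f: "f \<in> fin_fun (fst (dec i)) R" and u: "u = \<pi> (dec i) f"
      unfolding T_def P(2)[OF dec_I(1)[OF i]] by blast
    let ?Y = "fst (dec i)" and ?N = "insert f (snd (dec i))"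
    note di = data[OF dec_I(1)[OF i]]
    have lin0: "lin S ?Y f ?id = \<zero>\<^bsub>S\<^esub>" using zero c_\<pi>[OF i f] u by simp
    \<comment> \<open>The combination \<open>f\<close> of the generators vanishes in \<open>S\<close> and is added to the relations.\<close>
    have k: "code (?Y, ?N) \<in> I \<and> dec (code (?Y, ?N)) = (?Y, ?N)"
      by (rule upper) (use di f lin0 solutionsD[OF dec_I(2)[OF i]] in auto)
    let ?k = "code (?Y, ?N)"
    have ik: "(i, ?k) \<in> r" using i k unfolding r_def by auto
    have "f \<in> span R (snd (dec ?k))" using k by (simp add: span.incl)
    then have "\<pi> (dec ?k) f = \<zero>\<^bsub>T ?k\<^esub>"
      unfolding T_def using P(5)[OF dec_I(1), of ?k f] k f by simp
    then have "s i ?k u = \<zero>\<^bsub>T ?k\<^esub>" using s_\<pi>[OF ik f] u by simp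
    then show "\<exists>k. (i, k) \<in> r \<and> s i k u = \<zero>\<^bsub>T k\<^esub>" using ik by blast
  qed
  then have "module_limit R I r T s S c"
    unfolding module_limit_def using S c_lin c_comp by blast
  then have "limit_diagram R I r T s S c"
    using directed system by (simp add: limit_diagram_def)
  then have "preserves_limit_elements R I r T s S c F"
    using F(2) unfolding preserves_direct_limits_iff[OF F(1)] by blast
  then obtain i z where "i \<in> I" "z \<in> carrier (fobj F (T i))" "farr F (T i) S (c i) z = y"
    unfolding preserves_limit_elements_def using y by blast
  then show thesis using that[of "dec i" z] dec_I unfolding T_def c_def by blast
qed

end

section \<open>Every functor that preserves direct limits is a cokernel\<close>

lemma functor_module_kernel:
  fixes F :: "('r, 'u, 'b) functr" and G :: "('r, 'u, 'c) functr"
  assumes F: "functor_module R F" and G: "functor_module R G" and \<eta>: "nat_trans R F G \<eta>"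
  shows "functor_module R (kernel_functor F G \<eta>)"
proof -
  have car: "carrier (fobj (kernel_functor F G \<eta>) S) = {x \<in> carrier (fobj F S). \<eta> S x = \<one>\<^bsub>fobj G S\<^esub>}" for S
    by (simp add: kernel_functor_def kernel_def)
  have mult: "x \<otimes>\<^bsub>fobj (kernel_functor F G \<eta>) S\<^esub> y = x \<otimes>\<^bsub>fobj F S\<^esub> y" for S x y
    by (simp add: kernel_functor_def)
  have farr: "farr (kernel_functor F G \<eta>) = farr F" by (simp add: kernel_functor_def)
  show ?thesis
    unfolding functor_module_def farr
  proof (intro conjI allI impI ballI)
    fix S :: "('r, 'u) module" assume S: "left_module R S"
    interpret FS: comm_group "fobj F S" by (rule functor_moduleD(1)[OF F S])
    have sub: "subgroup (kernel (fobj F S) (fobj G S) (\<eta> S)) (fobj F S)"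
      by (rule group_kernel_functor[OF \<eta> F G S])
    have "group (fobj (kernel_functor F G \<eta>) S)"
      using subgroup.subgroup_is_group[OF sub FS.is_group] by (simp add: kernel_functor_def)
    then show "comm_group (fobj (kernel_functor F G \<eta>) S)"
      by (rule group.group_comm_groupI) (simp add: car mult FS.m_comm)
    show "farr F S S (linear_id S) x = x" if "x \<in> carrier (fobj (kernel_functor F G \<eta>) S)" for x
      using functor_moduleD(3)[OF F S] that unfolding car by blast
  next
    fix S T :: "('r, 'u) module" and f assume S: "left_module R S" and T: "left_module R T" and f: "f \<in> linear_maps R S T"
    interpret f: group_hom "fobj G S" "fobj G T" "farr G S T f" by (rule farr_group_hom[OF G S T f])
    show "farr F S T f \<in> hom (fobj (kernel_functor F G \<eta>) S) (fobj (kernel_functor F G \<eta>) T)"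
      by (rule homI)
         (auto simp: car mult farr_closed[OF F S T f] farr_mult[OF F S T f] nat_transD(4)[OF \<eta> S T f])
    fix g x assume g: "g \<in> linear_maps R S T" and x: "x \<in> carrier (fobj (kernel_functor F G \<eta>) S)"
    show "farr F S T (linear_add S T f g) x = farr F S T f x \<otimes>\<^bsub>fobj (kernel_functor F G \<eta>) T\<^esub> farr F S T g x"
      unfolding mult using functor_moduleD(5)[OF F S T f g] x unfolding car by blast
  next
    fix S T U :: "('r, 'u) module" and f g x
    assume "left_module R S" "left_module R T" "left_module R U" "f \<in> linear_maps R S T" "g \<in> linear_maps R T U"
      "x \<in> carrier (fobj (kernel_functor F G \<eta>) S)"
    then show "farr F S U (compose (carrier S) g f) x = farr F T U g (farr F S T f x)"
      using functor_moduleD(4)[OF F] unfolding car by blast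
  qed
qed

lemma kernel_in_subcategory:
  assumes D: "stable_subcategory R \<D>" and F: "F \<in> \<D>" and G: "G \<in> \<D>" and \<eta>: "nat_trans R F G \<eta>"
  shows "kernel_functor F G \<eta> \<in> \<D>"
proof -
  have "functor_module R F" "functor_module R G"
    using D F G unfolding stable_subcategory_def full_subcategory_def by blast+
  then have "functor_module R (kernel_functor F G \<eta>)" using \<eta> by (rule functor_module_kernel)
  moreover have "contains_copies R \<D> (kernel_functor F G \<eta>)"
    using D F G \<eta> unfolding stable_subcategory_def stable_kernels_def by blast
  ultimately show ?thesis unfolding contains_copies_def using functor_iso_refl by blast
qed

text \<open>
  The first isomorphism theorem at each module.
\<close>

lemma cokernel_iso:
  fixes F :: "('r, 'u, 'b) functr" and G :: "('r, 'u, 'c) functr" and H :: "('r, 'u, 'd) functr"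
  assumes F: "functor_module R F" and G: "functor_module R G" and H: "functor_module R H"
    and \<theta>: "nat_trans R G H \<theta>" and \<psi>: "nat_trans R H F \<psi>"
    and surj: "\<And>S. left_module R S \<Longrightarrow> \<psi> S ` carrier (fobj H S) = carrier (fobj F S)"
    and exact: "\<And>S. left_module R S \<Longrightarrow> \<theta> S ` carrier (fobj G S) = kernel (fobj H S) (fobj F S) (\<psi> S)"
  shows "functor_iso R F (cokernel_functor G H \<theta>)"
proof -
  let ?K = "cokernel_functor G H \<theta>"
  have hom: "group_hom (fobj H S) (fobj F S) (\<psi> S)" if "left_module R S" for S
    using nat_transD(1)[OF \<psi> that] functor_module_group[OF H that] functor_module_group[OF F that]
    by (simp add: group_hom_def group_hom_axioms_def)
  define \<eta> where "\<eta> S K = the_elem (\<psi> S ` K)" for S K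
  have \<eta>_coset: "\<eta> S (\<theta> S ` carrier (fobj G S) #>\<^bsub>fobj H S\<^esub> x) = \<psi> S x"
    if S: "left_module R S" and x: "x \<in> carrier (fobj H S)" for S x
  proof -
    interpret group_hom "fobj H S" "fobj F S" "\<psi> S" by (rule hom[OF S])
    have "\<psi> S ` (kernel (fobj H S) (fobj F S) (\<psi> S) #>\<^bsub>fobj H S\<^esub> x) = {\<psi> S x}"
    proof
      show "\<psi> S ` (kernel (fobj H S) (fobj F S) (\<psi> S) #>\<^bsub>fobj H S\<^esub> x) \<subseteq> {\<psi> S x}"
        using x by (auto simp: r_coset_def kernel_def)
      show "{\<psi> S x} \<subseteq> \<psi> S ` (kernel (fobj H S) (fobj F S) (\<psi> S) #>\<^bsub>fobj H S\<^esub> x)"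
        using G.rcos_self[OF x subgroup_kernel] by blast
    qed
    then show ?thesis unfolding \<eta>_def exact[OF S] by simp
  qed
  have \<eta>_iso: "\<eta> S \<in> iso (fobj ?K S) (fobj F S)" if S: "left_module R S" for S
    unfolding \<eta>_def cokernel_functor_fobj exact[OF S] by (rule group_hom.FactGroup_iso_set[OF hom[OF S] surj[OF S]])
  have elem: "\<exists>x\<in>carrier (fobj H S). y = \<theta> S ` carrier (fobj G S) #>\<^bsub>fobj H S\<^esub> x" if "y \<in> carrier (fobj ?K S)" for S y
    using that unfolding cokernel_functor_fobj carrier_FactGroup by blast
  have "nat_trans R ?K F \<eta>"
    unfolding nat_trans_def
  proof (intro conjI allI impI ballI)
    show "\<eta> S \<in> hom (fobj ?K S) (fobj F S)" if "left_module R S" for S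
      using \<eta>_iso[OF that] by (simp add: iso_def)
    fix S T :: "('r, 'u) module" and f y assume S: "left_module R S" and T: "left_module R T"
      and f: "f \<in> linear_maps R S T" and y: "y \<in> carrier (fobj ?K S)"
    obtain x where x: "x \<in> carrier (fobj H S)" and y: "y = \<theta> S ` carrier (fobj G S) #>\<^bsub>fobj H S\<^esub> x"
      using elem[OF y] by blast
    show "\<eta> T (farr ?K S T f y) = farr F S T f (\<eta> S y)"
      unfolding y cokernel_functor_farr[OF \<theta> G H S T f x] \<eta>_coset[OF S x] \<eta>_coset[OF T farr_closed[OF H S T f x]]
      by (rule nat_transD(4)[OF \<psi> S T f x])
  qed
  then have "functor_iso R ?K F" unfolding functor_iso_def using \<eta>_iso by blast
  then show ?thesis
  proof (rule functor_iso_sym)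
    show "group (fobj ?K S)" if S: "left_module R S" for S
      unfolding cokernel_functor_fobj
      by (rule comm_group.axioms(2)[OF comm_group.abelian_FactGroup[OF functor_moduleD(1)[OF H S] image_subgroup[OF \<theta> G H S]]])
    fix S T :: "('r, 'u) module" and f y assume S: "left_module R S" and T: "left_module R T"
      and f: "f \<in> linear_maps R S T" and y: "y \<in> carrier (fobj ?K S)"
    obtain x where x: "x \<in> carrier (fobj H S)" and y: "y = \<theta> S ` carrier (fobj G S) #>\<^bsub>fobj H S\<^esub> x"
      using elem[OF y] by blast
    show "farr ?K S T f y \<in> carrier (fobj ?K T)"
      unfolding y cokernel_functor_farr[OF \<theta> G H S T f x] unfolding cokernel_functor_fobj carrier_FactGroup
      using farr_closed[OF H S T f x] by blast
  qed
qed

lemma gfinprod_hom: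
  assumes G: "comm_group G" and H: "comm_group H" and h: "h \<in> hom G H"
    and g: "g \<in> A \<rightarrow> carrier G" and fin: "finite {x \<in> A. g x \<noteq> \<one>\<^bsub>G\<^esub>}"
  shows "h (gfinprod G g A) = gfinprod H (\<lambda>x. h (g x)) A"
proof -
  interpret G: comm_group G by (rule G)
  interpret H: comm_group H by (rule H)
  interpret h: group_hom G H h using h by (simp add: group_hom_def group_hom_axioms_def)
  let ?T = "{x \<in> A. g x \<noteq> \<one>\<^bsub>G\<^esub>}"
  have fp: "h (finprod G g T) = finprod H (\<lambda>x. h (g x)) T" if "finite T" "T \<subseteq> A" for T
    using that
  proof (induction T)
    case (insert x T)
    have gT: "g \<in> T \<rightarrow> carrier G" and gx: "g x \<in> carrier G" using insert.prems g by auto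
    have hT: "(\<lambda>x. h (g x)) \<in> T \<rightarrow> carrier H" using h.hom_closed[OF Pi_mem[OF gT]] by simp
    show ?case
      using insert G.finprod_insert[OF insert.hyps gT gx] H.finprod_insert[OF insert.hyps hT h.hom_closed[OF gx]]
        h.hom_mult[OF gx G.finprod_closed[OF gT]] by simp
  qed simp
  have hA: "(\<lambda>x. h (g x)) \<in> A \<rightarrow> carrier H" using h.hom_closed[OF Pi_mem[OF g]] by simp
  have "h (gfinprod G g A) = finprod H (\<lambda>x. h (g x)) ?T"
    unfolding gfinprod_def using fin fp[OF fin] by simp
  also have "\<dots> = gfinprod H (\<lambda>x. h (g x)) ?T"
    by (rule H.gfinprod_eq_finprod[symmetric, OF fin]) (use hA in auto)
  also have "\<dots> = gfinprod H (\<lambda>x. h (g x)) A"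
    by (rule H.gfinprod_mono_neutral_cong_left) (use hA in auto)
  finally show ?thesis .
qed

context presentations
begin

text \<open>
  The index set \<open>J\<close> consists of all pairs \<open>j = (i, z)\<close> of a finite presentation \<open>i\<close> and an element \<open>z\<close> of
  \<open>F(P i)\<close>. Let \<open>B\<close> contain a copy of the generators of \<open>i\<close> for each \<open>j\<close>, and \<open>B'\<close> a copy of the relations.
  A finitely supported \<open>\<sigma>\<close> on \<open>B\<close> is a family of rows, one tuple of elements of \<open>S\<close> for each \<open>j\<close>, and
  evaluating the relations on the rows is a transformation \<open>\<alpha>\<close> from \<open>S^(B)\<close> to \<open>S^(B')\<close>. Its kernel \<open>H\<close>
  consists of the families in which each row is a homomorphism \<open>P i \<rightarrow> S\<close>. Following Yoneda's lemma,
  \<open>\<psi>\<close> sends \<open>\<sigma>\<close> to the sum of the images of the elements \<open>z\<close> under \<open>F\<close> of these homomorphisms. By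
  \<open>limit_of_presentations\<close> one row is enough to reach a given element of \<open>F(S)\<close>.

  Two hypotheses on the functors \<open>S^(B)\<close> occur because \<open>B\<close> and \<open>B'\<close> have different types.
\<close>

lemma cover:
  fixes F :: "('r, 'u, 'u) functr" and \<D> :: "('r, 'u, 'u) functr set"
  assumes D: "stable_subcategory R \<D>"
    and generators: "\<And>B :: ((('u set \<times> ('u \<Rightarrow> 'r) set) \<times> 'u) \<times> 'u) set.
      B \<lesssim> (UNIV :: 'u set) \<Longrightarrow> contains_copies R \<D> (free_functor B)"
    and relations: "\<And>B :: ((('u set \<times> ('u \<Rightarrow> 'r) set) \<times> 'u) \<times> ('u \<Rightarrow> 'r)) set.
      B \<lesssim> (UNIV :: 'u set) \<Longrightarrow> contains_copies R \<D> (free_functor B)"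
    and F: "F \<in> Qs_ch R"
  obtains H \<psi> where "H \<in> \<D>" "H \<in> Qs_ch R" "nat_trans R H F \<psi>"
    "\<And>S. left_module R S \<Longrightarrow> \<psi> S ` carrier (fobj H S) = carrier (fobj F S)"
proof -
  have FM: "functor_module R F" and F_pres: "preserves_direct_limits R F"
    using F unfolding Qs_ch_def by blast+
  define J where "J = (SIGMA i:presentation_data R. carrier (fobj F (P i)))"
  define B where "B = (SIGMA j:J. fst (fst j))"
  define B' where "B' = (SIGMA j:J. snd (fst j))"
  have JD: "fst j \<in> presentation_data R" "snd j \<in> carrier (fobj F (P (fst j)))" if "j \<in> J" for j
    using that unfolding J_def by auto
  have small_J: "J \<lesssim> (UNIV :: 'u set)"
  proof -
    have "J \<subseteq> presentation_data R \<times> UNIV" unfolding J_def by blast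
    then show ?thesis
      using times_lepoll_infinite[OF U data_lepoll lepoll_refl] subset_imp_lepoll lepoll_trans by blast
  qed
  have small_B: "B \<lesssim> (UNIV :: 'u set)"
  proof -
    have "B \<subseteq> J \<times> UNIV" unfolding B_def by blast
    then show ?thesis
      using times_lepoll_infinite[OF U small_J lepoll_refl] subset_imp_lepoll lepoll_trans by blast
  qed
  have small_B': "B' \<lesssim> (UNIV :: 'u set)"
  proof -
    have "n \<in> fin_fun UNIV R" if "j \<in> J" "n \<in> snd (fst j)" for j n
      using data(3)[OF JD(1)[OF that(1)]] that(2) fin_fun_mono[OF subset_UNIV] by blast
    then have "B' \<subseteq> J \<times> fin_fun UNIV R" unfolding B'_def by blast
    moreover have "fin_fun (UNIV :: 'u set) R \<lesssim> (UNIV :: 'u set)"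
      by (rule fin_fun_lepoll_infinite[OF U lepoll_refl small])
    ultimately show ?thesis
      using times_lepoll_infinite[OF U small_J] subset_imp_lepoll lepoll_trans by blast
  qed
  obtain e :: "('r, 'u) module \<Rightarrow> ((('u set \<times> ('u \<Rightarrow> 'r) set) \<times> 'u) \<times> 'u \<Rightarrow> 'u) \<Rightarrow> 'u" and d
    where de: "\<And>S \<sigma>. \<sigma> \<in> fin_fun B S \<Longrightarrow> d S (e S \<sigma>) = \<sigma>"
    by (rule fin_fun_encoding[OF U small_B]) blast
  obtain e' :: "('r, 'u) module \<Rightarrow> ((('u set \<times> ('u \<Rightarrow> 'r) set) \<times> 'u) \<times> ('u \<Rightarrow> 'r) \<Rightarrow> 'u) \<Rightarrow> 'u" and d'
    where de': "\<And>S \<sigma>. \<sigma> \<in> fin_fun B' S \<Longrightarrow> d' S (e' S \<sigma>) = \<sigma>"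
    by (rule fin_fun_encoding[OF U small_B']) blast
  define G where "G = copy_functor e d (free_functor B)"
  define G' where "G' = copy_functor e' d' (free_functor B')"
  have G: "functor_module R G" "functor_iso R G (free_functor B)"
    unfolding G_def by (rule functor_module_copy functor_iso_copy, rule functor_module_free, simp add: de)+
  have G': "functor_module R G'" "functor_iso R G' (free_functor B')"
    unfolding G'_def by (rule functor_module_copy functor_iso_copy, rule functor_module_free, simp add: de')+
  have G_in: "G \<in> \<D>" "G' \<in> \<D>"
    using generators[OF small_B] relations[OF small_B'] G G' unfolding contains_copies_def by blast+
  have G_Qs: "G \<in> Qs_ch R" "G' \<in> Qs_ch R"
    using contains_free_functor_of_sums[OF U stable_subcategory_Qs_ch stable_finite_sums_Qs_ch ring_functor_in_Qs_ch small_B]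
      contains_free_functor_of_sums[OF U stable_subcategory_Qs_ch stable_finite_sums_Qs_ch ring_functor_in_Qs_ch small_B']
      G G' unfolding contains_copies_def by blast+
  have G_elem: "\<exists>\<sigma>\<in>fin_fun B S. u = e S \<sigma>" if "u \<in> carrier (fobj G S)" for S u
    using that unfolding G_def copy_functor_sel by auto
  have G_mult: "e S \<sigma> \<otimes>\<^bsub>fobj G S\<^esub> e S \<tau> = e S (\<lambda>x. \<sigma> x \<oplus>\<^bsub>S\<^esub> \<tau> x)"
    if "\<sigma> \<in> fin_fun B S" "\<tau> \<in> fin_fun B S" for S \<sigma> \<tau>
    using that by (simp add: G_def copy_functor_sel de)
  have G_farr: "farr G S T f (e S \<sigma>) = e T (f \<circ> \<sigma>)" if "\<sigma> \<in> fin_fun B S" for S T f \<sigma>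
    using that by (simp add: G_def copy_functor_sel de)
  \<comment> \<open>Outside \<open>J\<close> the rows are zero, as \<open>\<sigma>\<close> is supported in \<open>B\<close>.\<close>
  define row where "row j \<sigma> = (\<lambda>y. \<sigma> (j, y))" for j :: "('u set \<times> ('u \<Rightarrow> 'r) set) \<times> 'u" and \<sigma> :: "_ \<times> 'u \<Rightarrow> 'u"
  define \<alpha> where "\<alpha> S \<sigma> = (\<lambda>p. if p \<in> B' then lin S (fst (fst (fst p))) (snd p) (row (fst p) \<sigma>) else \<zero>\<^bsub>S\<^esub>)"
    for S :: "('r, 'u) module" and \<sigma>
  have row_in: "row j \<sigma> y \<in> carrier S" if "\<sigma> \<in> fin_fun B S" for S \<sigma> j y
    unfolding row_def by (rule fin_funD(1)[OF that])
  have rel: "fst p \<in> J" "snd p \<in> fin_fun (fst (fst (fst p))) R" "finite (fst (fst (fst p)))" if "p \<in> B'" for p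
  proof -
    show p: "fst p \<in> J" using that unfolding B'_def by auto
    have "snd p \<in> snd (fst (fst p))" using that unfolding B'_def by auto
    then show "snd p \<in> fin_fun (fst (fst (fst p))) R" using data(3)[OF JD(1)[OF p]] by blast
    show "finite (fst (fst (fst p)))" by (rule data(1)[OF JD(1)[OF p]])
  qed
  have row_add: "row j (\<lambda>x. \<sigma> x \<oplus>\<^bsub>S\<^esub> \<tau> x) = (\<lambda>y. row j \<sigma> y \<oplus>\<^bsub>S\<^esub> row j \<tau> y)" for S j \<sigma> \<tau>
    by (simp add: row_def)
  have row_comp: "row j (f \<circ> \<sigma>) = (\<lambda>y. f (row j \<sigma> y))" for f j \<sigma>
    by (simp add: row_def)
  have row_zero: "row j \<sigma> = (\<lambda>_. \<zero>\<^bsub>S\<^esub>)" if "\<sigma> \<in> fin_fun B S" "j \<notin> fst ` {x. \<sigma> x \<noteq> \<zero>\<^bsub>S\<^esub>}" for S j \<sigma>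
  proof
    show "row j \<sigma> y = \<zero>\<^bsub>S\<^esub>" for y
      using image_eqI[of j fst "(j, y)" "{x. \<sigma> x \<noteq> \<zero>\<^bsub>S\<^esub>}"] that(2) unfolding row_def by auto
  qed
  have fin_rows: "finite (fst ` {x. \<sigma> x \<noteq> \<zero>\<^bsub>S\<^esub>})" if "\<sigma> \<in> fin_fun B S" for S \<sigma>
    by (rule finite_imageI[OF fin_funD(3)[OF that]])
  have \<alpha>_in: "\<alpha> S \<sigma> \<in> fin_fun B' S" if S: "left_module R S" and \<sigma>: "\<sigma> \<in> fin_fun B S" for S \<sigma>
  proof -
    have closed: "\<alpha> S \<sigma> p \<in> carrier S" for p
      using lin_closed[OF S rel(2) row_in[OF \<sigma>]] abelian_groupE(2)[OF left_moduleD(2)[OF S]] by (simp add: \<alpha>_def)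
    have "{p. \<alpha> S \<sigma> p \<noteq> \<zero>\<^bsub>S\<^esub>} \<subseteq> (SIGMA j:fst ` {x. \<sigma> x \<noteq> \<zero>\<^bsub>S\<^esub>} \<inter> J. snd (fst j))"
    proof
      fix p assume p: "p \<in> {p. \<alpha> S \<sigma> p \<noteq> \<zero>\<^bsub>S\<^esub>}"
      then have pB: "p \<in> B'" by (auto simp: \<alpha>_def split: if_splits)
      have "fst p \<in> fst ` {x. \<sigma> x \<noteq> \<zero>\<^bsub>S\<^esub>}"
      proof (rule ccontr)
        assume "fst p \<notin> fst ` {x. \<sigma> x \<noteq> \<zero>\<^bsub>S\<^esub>}"
        then have "\<alpha> S \<sigma> p = \<zero>\<^bsub>S\<^esub>"
          using row_zero[OF \<sigma>] lin_zero_right[OF S rel(2)[OF pB]] pB by (simp add: \<alpha>_def)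
        then show False using p by simp
      qed
      moreover have "fst p \<in> J" "snd p \<in> snd (fst (fst p))" using pB unfolding B'_def by auto
      ultimately have "(fst p, snd p) \<in> (SIGMA j:fst ` {x. \<sigma> x \<noteq> \<zero>\<^bsub>S\<^esub>} \<inter> J. snd (fst j))"
        by (intro SigmaI IntI)
      then show "p \<in> (SIGMA j:fst ` {x. \<sigma> x \<noteq> \<zero>\<^bsub>S\<^esub>} \<inter> J. snd (fst j))" by simp
    qed
    moreover have "finite (SIGMA j:fst ` {x. \<sigma> x \<noteq> \<zero>\<^bsub>S\<^esub>} \<inter> J. snd (fst j))"
      using fin_rows[OF \<sigma>] data(2)[OF JD(1)] by (intro finite_SigmaI) auto
    ultimately have "finite {p. \<alpha> S \<sigma> p \<noteq> \<zero>\<^bsub>S\<^esub>}" by (rule finite_subset)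
    then show ?thesis using closed unfolding fin_fun_def by (simp add: \<alpha>_def)
  qed
  define \<eta> where "\<eta> S u = e' S (\<alpha> S (d S u))" for S u
  have \<eta>: "nat_trans R G G' \<eta>"
  proof (rule nat_transI)
    fix S :: "('r, 'u) module" and u assume S: "left_module R S" and "u \<in> carrier (fobj G S)"
    then obtain \<sigma> where \<sigma>: "\<sigma> \<in> fin_fun B S" "u = e S \<sigma>" using G_elem by blast
    show "\<eta> S u \<in> carrier (fobj G' S)"
      using \<alpha>_in[OF S \<sigma>(1)] by (simp add: \<eta>_def \<sigma>(2) de[OF \<sigma>(1)] G'_def copy_functor_sel)
    interpret S: abelian_group S using left_moduleD(2)[OF S] .
    fix v assume "v \<in> carrier (fobj G S)"
    then obtain \<tau> where \<tau>: "\<tau> \<in> fin_fun B S" "v = e S \<tau>" using G_elem by blast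
    have "\<alpha> S (\<lambda>x. \<sigma> x \<oplus>\<^bsub>S\<^esub> \<tau> x) = (\<lambda>p. \<alpha> S \<sigma> p \<oplus>\<^bsub>S\<^esub> \<alpha> S \<tau> p)"
    proof
      fix p
      show "\<alpha> S (\<lambda>x. \<sigma> x \<oplus>\<^bsub>S\<^esub> \<tau> x) p = \<alpha> S \<sigma> p \<oplus>\<^bsub>S\<^esub> \<alpha> S \<tau> p"
        using lin_add_right[OF S rel(2) row_in[OF \<sigma>(1)] row_in[OF \<tau>(1)]] by (simp add: \<alpha>_def row_add)
    qed
    then show "\<eta> S (u \<otimes>\<^bsub>fobj G S\<^esub> v) = \<eta> S u \<otimes>\<^bsub>fobj G' S\<^esub> \<eta> S v"
      unfolding \<sigma>(2) \<tau>(2) G_mult[OF \<sigma>(1) \<tau>(1)] \<eta>_def de[OF \<sigma>(1)] de[OF \<tau>(1)] de[OF S.fin_fun_add[OF \<sigma>(1) \<tau>(1)]]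
      by (simp add: G'_def copy_functor_sel de'[OF \<alpha>_in[OF S \<sigma>(1)]] de'[OF \<alpha>_in[OF S \<tau>(1)]])
  next
    fix S T :: "('r, 'u) module" and f u assume S: "left_module R S" and T: "left_module R T"
      and f: "f \<in> linear_maps R S T" and "u \<in> carrier (fobj G S)"
    then obtain \<sigma> where \<sigma>: "\<sigma> \<in> fin_fun B S" "u = e S \<sigma>" using G_elem by blast
    have "\<alpha> T (f \<circ> \<sigma>) = f \<circ> \<alpha> S \<sigma>"
    proof
      fix p
      show "\<alpha> T (f \<circ> \<sigma>) p = (f \<circ> \<alpha> S \<sigma>) p"
        using lin_linear_map[where s = "row (fst p) \<sigma>", OF S T f rel(2)[of p] rel(3)[of p] row_in[OF \<sigma>(1)]]
          linear_maps_zero[OF S T f]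
        by (simp add: \<alpha>_def row_comp)
    qed
    then show "\<eta> T (farr G S T f u) = farr G' S T f (\<eta> S u)"
      unfolding \<sigma>(2) G_farr[OF \<sigma>(1)] \<eta>_def de[OF \<sigma>(1)] de[OF fin_fun_linear_image[OF S T f \<sigma>(1)]]
      by (simp add: G'_def copy_functor_sel de'[OF \<alpha>_in[OF S \<sigma>(1)]])
  qed
  \<comment> \<open>A family is in \<open>H\<close> if and only if all its rows satisfy their relations; this is \<open>H_iff\<close> below.\<close>
  define H where "H = kernel_functor G G' \<eta>"
  have H: "functor_module R H" unfolding H_def by (rule functor_module_kernel[OF G(1) G'(1) \<eta>])
  have H_in: "H \<in> \<D>" unfolding H_def by (rule kernel_in_subcategory[OF D G_in \<eta>])
  have H_Qs: "H \<in> Qs_ch R" unfolding H_def by (rule kernel_in_subcategory[OF stable_subcategory_Qs_ch G_Qs \<eta>])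
  have H_mult: "u \<otimes>\<^bsub>fobj H S\<^esub> v = u \<otimes>\<^bsub>fobj G S\<^esub> v" for S u v by (simp add: H_def kernel_functor_def)
  have H_farr: "farr H = farr G" by (simp add: H_def kernel_functor_def)
  have zero_in: "(\<lambda>_. \<zero>\<^bsub>S\<^esub>) \<in> fin_fun B' S" if "left_module R S" for S :: "('r, 'u) module"
    using abelian_groupE(2)[OF left_moduleD(2)[OF that]] unfolding fin_fun_def by simp
  have H_iff: "e S \<sigma> \<in> carrier (fobj H S) \<longleftrightarrow> (\<forall>j\<in>J. row j \<sigma> \<in> solutions S (fst j))"
    if S: "left_module R S" and \<sigma>: "\<sigma> \<in> fin_fun B S" for S \<sigma>
  proof -
    have "e S \<sigma> \<in> carrier (fobj H S) \<longleftrightarrow> e' S (\<alpha> S \<sigma>) = e' S (\<lambda>_. \<zero>\<^bsub>S\<^esub>)"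
      using \<sigma> by (simp add: H_def kernel_functor_def kernel_def \<eta>_def de G_def G'_def copy_functor_sel)
    also have "\<dots> \<longleftrightarrow> \<alpha> S \<sigma> = (\<lambda>_. \<zero>\<^bsub>S\<^esub>)"
      using de'[OF \<alpha>_in[OF S \<sigma>]] de'[OF zero_in[OF S]] by metis
    also have "\<dots> \<longleftrightarrow> (\<forall>p\<in>B'. lin S (fst (fst (fst p))) (snd p) (row (fst p) \<sigma>) = \<zero>\<^bsub>S\<^esub>)"
      by (auto simp: \<alpha>_def fun_eq_iff)
    also have "\<dots> \<longleftrightarrow> (\<forall>j\<in>J. row j \<sigma> \<in> solutions S (fst j))"
      using row_in[OF \<sigma>] unfolding solutions_def B'_def by auto
    finally show ?thesis .
  qed
  have H_elem: "\<exists>\<sigma>\<in>fin_fun B S. u = e S \<sigma> \<and> (\<forall>j\<in>J. row j \<sigma> \<in> solutions S (fst j))"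
    if S: "left_module R S" and u: "u \<in> carrier (fobj H S)" for S u
  proof -
    have "u \<in> carrier (fobj G S)" using u by (simp add: H_def kernel_functor_def kernel_def)
    then obtain \<sigma> where \<sigma>: "\<sigma> \<in> fin_fun B S" "u = e S \<sigma>" using G_elem by blast
    then show ?thesis using H_iff[OF S \<sigma>(1)] u by blast
  qed
  \<comment> \<open>The image in \<open>F(S)\<close> of the element \<open>z\<close> under the homomorphism \<open>P i \<rightarrow> S\<close> given by row \<open>j = (i, z)\<close>.
    It is trivial unless the row has a non-zero entry.\<close>
  define val where "val S \<sigma> j = farr F (P (fst j)) S (lift S (fst j) (row j \<sigma>)) (snd j)" for S \<sigma> j
  have val_in: "val S \<sigma> \<in> J \<rightarrow> carrier (fobj F S)"
    if S: "left_module R S" and sol: "\<forall>j\<in>J. row j \<sigma> \<in> solutions S (fst j)" for S \<sigma>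
    unfolding val_def
    by (intro Pi_I farr_closed[OF FM P(1)[OF JD(1)] S lift_linear[OF S JD(1)] JD(2)]) (simp_all add: sol)
  have val_fin: "finite {j \<in> J. val S \<sigma> j \<noteq> \<one>\<^bsub>fobj F S\<^esub>}" if S: "left_module R S" and \<sigma>: "\<sigma> \<in> fin_fun B S" for S \<sigma>
  proof (rule finite_subset[OF _ fin_rows[OF \<sigma>]], rule subsetI)
    fix j assume j: "j \<in> {j \<in> J. val S \<sigma> j \<noteq> \<one>\<^bsub>fobj F S\<^esub>}"
    show "j \<in> fst ` {x. \<sigma> x \<noteq> \<zero>\<^bsub>S\<^esub>}"
    proof (rule ccontr)
      assume "j \<notin> fst ` {x. \<sigma> x \<noteq> \<zero>\<^bsub>S\<^esub>}"
      then have "val S \<sigma> j = \<one>\<^bsub>fobj F S\<^esub>"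
        unfolding val_def row_zero[OF \<sigma>] using j farr_lift_zero[OF FM S JD(1) JD(2)] by (simp add: row_zero[OF \<sigma>])
      then show False using j by simp
    qed
  qed
  define \<psi> where "\<psi> S u = gfinprod (fobj F S) (val S (d S u)) J" for S u
  have \<psi>_e: "\<psi> S (e S \<sigma>) = gfinprod (fobj F S) (val S \<sigma>) J" if "\<sigma> \<in> fin_fun B S" for S \<sigma>
    unfolding \<psi>_def de[OF that] ..
  have \<psi>: "nat_trans R H F \<psi>"
  proof (rule nat_transI)
    fix S :: "('r, 'u) module" and u assume S: "left_module R S" and "u \<in> carrier (fobj H S)"
    then obtain \<sigma> where \<sigma>: "\<sigma> \<in> fin_fun B S" "u = e S \<sigma>" "\<forall>j\<in>J. row j \<sigma> \<in> solutions S (fst j)" using H_elem by blast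
    interpret FS: comm_group "fobj F S" by (rule functor_moduleD(1)[OF FM S])
    interpret S: abelian_group S using left_moduleD(2)[OF S] .
    show "\<psi> S u \<in> carrier (fobj F S)"
      unfolding \<sigma>(2) \<psi>_e[OF \<sigma>(1)] by (rule FS.gfinprod_closed[OF val_in[OF S \<sigma>(3)]])
    fix v assume "v \<in> carrier (fobj H S)"
    then obtain \<tau> where \<tau>: "\<tau> \<in> fin_fun B S" "v = e S \<tau>" "\<forall>j\<in>J. row j \<tau> \<in> solutions S (fst j)" using H_elem[OF S] by blast
    have add: "val S (\<lambda>x. \<sigma> x \<oplus>\<^bsub>S\<^esub> \<tau> x) j = val S \<sigma> j \<otimes>\<^bsub>fobj F S\<^esub> val S \<tau> j" if j: "j \<in> J" for j
      unfolding val_def row_add lift_add[OF S JD(1)[OF j] \<sigma>(3)[rule_format, OF j] \<tau>(3)[rule_format, OF j]]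
      by (rule functor_moduleD(5)[OF FM P(1)[OF JD(1)[OF j]] S lift_linear[OF S JD(1)[OF j] \<sigma>(3)[rule_format, OF j]]
            lift_linear[OF S JD(1)[OF j] \<tau>(3)[rule_format, OF j]] JD(2)[OF j]])
    have "\<psi> S (u \<otimes>\<^bsub>fobj H S\<^esub> v) = gfinprod (fobj F S) (val S (\<lambda>x. \<sigma> x \<oplus>\<^bsub>S\<^esub> \<tau> x)) J"
      unfolding H_mult \<sigma>(2) \<tau>(2) G_mult[OF \<sigma>(1) \<tau>(1)] \<psi>_e[OF S.fin_fun_add[OF \<sigma>(1) \<tau>(1)]] ..
    also have "\<dots> = gfinprod (fobj F S) (\<lambda>j. val S \<sigma> j \<otimes>\<^bsub>fobj F S\<^esub> val S \<tau> j) J"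
      using val_in[OF S \<sigma>(3)] val_in[OF S \<tau>(3)]
      by (intro FS.gfinprod_cong) (auto simp: add simp_implies_def Pi_iff)
    also have "\<dots> = \<psi> S u \<otimes>\<^bsub>fobj F S\<^esub> \<psi> S v"
      unfolding \<sigma>(2) \<tau>(2) \<psi>_e[OF \<sigma>(1)] \<psi>_e[OF \<tau>(1)]
      by (rule FS.gfinprod_distrib[OF val_fin[OF S \<sigma>(1)] val_fin[OF S \<tau>(1)] val_in[OF S \<sigma>(3)] val_in[OF S \<tau>(3)]])
    finally show "\<psi> S (u \<otimes>\<^bsub>fobj H S\<^esub> v) = \<psi> S u \<otimes>\<^bsub>fobj F S\<^esub> \<psi> S v" .
  next
    fix S T :: "('r, 'u) module" and f u assume S: "left_module R S" and T: "left_module R T"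
      and f: "f \<in> linear_maps R S T" and "u \<in> carrier (fobj H S)"
    then obtain \<sigma> where \<sigma>: "\<sigma> \<in> fin_fun B S" "u = e S \<sigma>" "\<forall>j\<in>J. row j \<sigma> \<in> solutions S (fst j)" using H_elem by blast
    interpret FT: comm_group "fobj F T" by (rule functor_moduleD(1)[OF FM T])
    have nat: "farr F S T f (val S \<sigma> j) = val T (f \<circ> \<sigma>) j" if j: "j \<in> J" for j
      unfolding val_def row_comp lift_natural[OF S T f JD(1)[OF j] \<sigma>(3)[rule_format, OF j]]
      by (rule functor_moduleD(4)[OF FM P(1)[OF JD(1)[OF j]] S T lift_linear[OF S JD(1)[OF j] \<sigma>(3)[rule_format, OF j]] f
            JD(2)[OF j], symmetric])
    have "farr F S T f (\<psi> S u) = gfinprod (fobj F T) (\<lambda>j. farr F S T f (val S \<sigma> j)) J"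
      unfolding \<sigma>(2) \<psi>_e[OF \<sigma>(1)]
      by (rule gfinprod_hom[OF functor_moduleD(1)[OF FM S] functor_moduleD(1)[OF FM T] functor_moduleD(2)[OF FM S T f]
            val_in[OF S \<sigma>(3)] val_fin[OF S \<sigma>(1)]])
    also have "\<dots> = gfinprod (fobj F T) (val T (f \<circ> \<sigma>)) J"
    proof (rule FT.gfinprod_cong[OF refl, symmetric])
      show "val T (f \<circ> \<sigma>) \<in> J \<rightarrow> carrier (fobj F T)"
        by (rule val_in[OF T]) (use solutions_linear[OF S T f JD(1)] \<sigma>(3) in \<open>simp add: row_comp\<close>)
    qed (simp add: nat simp_implies_def)
    also have "\<dots> = \<psi> T (farr H S T f u)"
      unfolding H_farr \<sigma>(2) G_farr[OF \<sigma>(1)] \<psi>_e[OF fin_fun_linear_image[OF S T f \<sigma>(1)]] ..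
    finally show "\<psi> T (farr H S T f u) = farr F S T f (\<psi> S u)" by simp
  qed
  have surj: "\<psi> S ` carrier (fobj H S) = carrier (fobj F S)" if S: "left_module R S" for S
  proof
    show "\<psi> S ` carrier (fobj H S) \<subseteq> carrier (fobj F S)" using nat_transD(2)[OF \<psi> S] by blast
    interpret FS: comm_group "fobj F S" by (rule functor_moduleD(1)[OF FM S])
    interpret S: abelian_group S using left_moduleD(2)[OF S] .
    show "carrier (fobj F S) \<subseteq> \<psi> S ` carrier (fobj H S)"
    proof
      fix y assume "y \<in> carrier (fobj F S)"
      then obtain i z where i: "i \<in> presentation_data R" and id: "(\<lambda>x. x) \<in> solutions S i"
        and z: "z \<in> carrier (fobj F (P i))" and y: "farr F (P i) S (lift S i (\<lambda>x. x)) z = y"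
        by (rule limit_of_presentations[OF FM F_pres S])
      have iJ: "(i, z) \<in> J" unfolding J_def using i z by simp
      \<comment> \<open>The family whose only row is the inclusion of the generators, which are elements of \<open>S\<close>.\<close>
      define \<sigma> where "\<sigma> p = (if fst p = (i, z) \<and> snd p \<in> fst i then snd p else \<zero>\<^bsub>S\<^esub>)" for p
      have "finite {p. \<sigma> p \<noteq> \<zero>\<^bsub>S\<^esub>}"
        by (rule finite_subset[of _ "{(i, z)} \<times> fst i"]) (use data(1)[OF i] in \<open>auto simp: \<sigma>_def split: if_splits\<close>)
      then have \<sigma>: "\<sigma> \<in> fin_fun B S"
        using solutionsD(1)[OF id] iJ unfolding fin_fun_def B_def by (auto simp: \<sigma>_def)
      have row_eq: "row (i, z) \<sigma> y = y" if "y \<in> fst i" for y using that by (simp add: row_def \<sigma>_def)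
      have row_other: "row j \<sigma> = (\<lambda>_. \<zero>\<^bsub>S\<^esub>)" if "j \<noteq> (i, z)" for j using that by (simp add: row_def \<sigma>_def)
      have sol: "row j \<sigma> \<in> solutions S (fst j)" if j: "j \<in> J" for j
      proof (cases "j = (i, z)")
        case True
        have "lin S (fst i) n (row (i, z) \<sigma>) = \<zero>\<^bsub>S\<^esub>" if n: "n \<in> snd i" for n
          using lin_cong[OF S subsetD[OF data(3)[OF i] n] solutionsD(1)[OF id] row_eq] solutionsD(2)[OF id n] by simp
        then show ?thesis using True row_in[OF \<sigma>] unfolding solutions_def by simp
      next
        case False
        then show ?thesis using solutions_zero[OF S JD(1)[OF j]] row_other by simp
      qed
      have "gfinprod (fobj F S) (val S \<sigma>) J = gfinprod (fobj F S) (\<lambda>_. y) {(i, z)}"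
      proof (rule FS.gfinprod_mono_neutral_cong_right)
        show "{(i, z)} \<subseteq> J" using iJ by simp
        show "val S \<sigma> j = \<one>\<^bsub>fobj F S\<^esub>" if "j \<in> J - {(i, z)}" for j
          using that farr_lift_zero[OF FM S JD(1) JD(2)] by (simp add: val_def row_other)
        show "val S \<sigma> j = y" if "j \<in> {(i, z)}" for j
          using that lift_cong[OF solutionsD(1)[OF id] row_eq S i] y by (simp add: val_def)
        show "val S \<sigma> \<in> J \<rightarrow> carrier (fobj F S)" using val_in[OF S] sol by blast
      qed
      also have "\<dots> = y"
        using farr_closed[OF FM P(1)[OF i] S lift_linear[OF S i id] z] y by simp
      finally have "\<psi> S (e S \<sigma>) = y" unfolding \<psi>_e[OF \<sigma>] .
      moreover have "e S \<sigma> \<in> carrier (fobj H S)" using H_iff[OF S \<sigma>] sol by blast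
      ultimately show "y \<in> \<psi> S ` carrier (fobj H S)" by blast
    qed
  qed
  show thesis by (rule that[OF H_in H_Qs \<psi> surj])
qed

text \<open>
  The kernel of a covering \<open>H \<rightarrow> F\<close> preserves direct limits, since \<open>H\<close> and \<open>F\<close> do. A covering \<open>H'\<close> of this
  kernel yields the exact sequence \<open>H' \<rightarrow> H \<rightarrow> F \<rightarrow> 0\<close> with \<open>H'\<close> and \<open>H\<close> in the subcategory.
\<close>

lemma Qs_ch_minimal:
  fixes \<D> :: "('r, 'u, 'u) functr set"
  assumes D: "stable_subcategory R \<D>"
    and generators: "\<And>B :: ((('u set \<times> ('u \<Rightarrow> 'r) set) \<times> 'u) \<times> 'u) set.
      B \<lesssim> (UNIV :: 'u set) \<Longrightarrow> contains_copies R \<D> (free_functor B)"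
    and relations: "\<And>B :: ((('u set \<times> ('u \<Rightarrow> 'r) set) \<times> 'u) \<times> ('u \<Rightarrow> 'r)) set.
      B \<lesssim> (UNIV :: 'u set) \<Longrightarrow> contains_copies R \<D> (free_functor B)"
  shows "Qs_ch R \<subseteq> \<D>"
proof
  fix F :: "('r, 'u, 'u) functr" assume F: "F \<in> Qs_ch R"
  note Q = stable_subcategory_Qs_ch[where R = R]
  obtain H \<psi> where H: "H \<in> \<D>" "H \<in> Qs_ch R" and \<psi>: "nat_trans R H F \<psi>"
    and \<psi>_surj: "\<And>S. left_module R S \<Longrightarrow> \<psi> S ` carrier (fobj H S) = carrier (fobj F S)"
    using cover[OF D generators relations F] by blast
  let ?K = "kernel_functor H F \<psi>"
  have K: "?K \<in> Qs_ch R" by (rule kernel_in_subcategory[OF Q H(2) F \<psi>])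
  obtain H' \<psi>' where H': "H' \<in> \<D>" "H' \<in> Qs_ch R" and \<psi>': "nat_trans R H' ?K \<psi>'"
    and \<psi>'_surj: "\<And>S. left_module R S \<Longrightarrow> \<psi>' S ` carrier (fobj H' S) = carrier (fobj ?K S)"
    using cover[OF D generators relations K] by blast
  have K_car: "carrier (fobj ?K S) = kernel (fobj H S) (fobj F S) (\<psi> S)" for S
    by (simp add: kernel_functor_def)
  have \<theta>: "nat_trans R H' H \<psi>'"
  proof (rule nat_transI)
    show "\<psi>' S x \<in> carrier (fobj H S)" if "left_module R S" "x \<in> carrier (fobj H' S)" for S x
      using nat_transD(2)[OF \<psi>' that] unfolding K_car kernel_def by blast
    show "\<psi>' S (x \<otimes>\<^bsub>fobj H' S\<^esub> y) = \<psi>' S x \<otimes>\<^bsub>fobj H S\<^esub> \<psi>' S y"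
      if "left_module R S" "x \<in> carrier (fobj H' S)" "y \<in> carrier (fobj H' S)" for S x y
      using nat_transD(3)[OF \<psi>' that] by (simp add: kernel_functor_def)
    show "\<psi>' T (farr H' S T f x) = farr H S T f (\<psi>' S x)"
      if "left_module R S" "left_module R T" "f \<in> linear_maps R S T" "x \<in> carrier (fobj H' S)" for S T f x
      using nat_transD(4)[OF \<psi>' that] by (simp add: kernel_functor_def)
  qed
  have "functor_iso R F (cokernel_functor H' H \<psi>')"
    using \<psi>'_surj unfolding K_car
    by (intro cokernel_iso[OF Qs_chD(1)[OF F] Qs_chD(1)[OF H'(2)] Qs_chD(1)[OF H(2)] \<theta> \<psi> \<psi>_surj])
  moreover have "contains_copies R \<D> (cokernel_functor H' H \<psi>')"
    using D H(1) H'(1) \<theta> unfolding stable_subcategory_def stable_cokernels_def by blast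
  ultimately show "F \<in> \<D>" using Qs_chD(1)[OF F] unfolding contains_copies_def by blast
qed

end

lemma presentations_exist:
  fixes R :: "('r, 'k) ring_scheme"
  assumes "ring R" and "infinite (UNIV :: 'u set)" and "carrier R \<lesssim> (UNIV :: 'u set)"
  obtains P :: "'u set \<times> ('u \<Rightarrow> 'r) set \<Rightarrow> ('r, 'u) module" and \<pi> where "presentations R P \<pi>"
proof -
  obtain enc :: "('u \<Rightarrow> 'r) \<Rightarrow> 'u" where enc: "inj_on enc (fin_fun UNIV R)"
    using fin_fun_lepoll_infinite[OF assms(2) lepoll_refl assms(3)] unfolding lepoll_def by blast
  have "\<exists>p. presents R (fst i) (snd i) (fst p :: ('r, 'u) module) (snd p)"
    if "i \<in> presentation_data R" for i :: "'u set \<times> ('u \<Rightarrow> 'r) set"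
    using presentation_exists[OF assms(1) enc, of "snd i" "fst i"] that unfolding presentation_data_def by auto
  then obtain p where p: "\<And>i :: 'u set \<times> ('u \<Rightarrow> 'r) set. i \<in> presentation_data R \<Longrightarrow>
      presents R (fst i) (snd i) (fst (p i) :: ('r, 'u) module) (snd (p i))"
    by metis
  have "presentations R (\<lambda>i. fst (p i)) (\<lambda>i. snd (p i))"
    by (rule presentations.intro[OF assms p])
  then show thesis by (rule that)
qed

theorem theorem3p9:
  fixes R :: "('r, 'k) ring_scheme"
  assumes "ring R"
    and "infinite (UNIV :: 'u set)"
    and "carrier R \<lesssim> (UNIV :: 'u set)"
  shows "smallest_such (\<lambda>\<D> :: ('r, 'u, 'u) functr set.
             stable_subcategory R \<D> \<and> contains_quasi_coherents R \<D>) (Qs_ch R) \<and>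
         smallest_such (\<lambda>\<D> :: ('r, 'u, 'u) functr set.
             stable_subcategory R \<D> \<and> stable_finite_sums R \<D> \<and> ring_functor \<in> \<D>) (Qs_ch R)"
proof -
  obtain P :: "'u set \<times> ('u \<Rightarrow> 'r) set \<Rightarrow> ('r, 'u) module" and \<pi> where "presentations R P \<pi>"
    by (rule presentations_exist[OF assms])
  then interpret presentations R P \<pi> .
  have quasi_coherents: "Qs_ch R \<subseteq> \<D>" if "stable_subcategory R \<D>" "contains_quasi_coherents R \<D>"
    for \<D> :: "('r, 'u, 'u) functr set"
    by (rule Qs_ch_minimal[OF that(1)]) (rule contains_free_functor_of_quasi_coherents[OF assms that(2)], assumption)+
  have sums: "Qs_ch R \<subseteq> \<D>" if "stable_subcategory R \<D>" "stable_finite_sums R \<D>" "ring_functor \<in> \<D>"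
    for \<D> :: "('r, 'u, 'u) functr set"
    by (rule Qs_ch_minimal[OF that(1)]) (rule contains_free_functor_of_sums[OF assms(2) that], assumption)+
  show ?thesis
    unfolding smallest_such_def
    by (intro conjI allI impI stable_subcategory_Qs_ch contains_quasi_coherents_Qs_ch stable_finite_sums_Qs_ch
        ring_functor_in_Qs_ch) (elim conjE, erule quasi_coherents sums; assumption)+
qed

end
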